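(* For integers $1\le m<n$ and every $i\in\mathbb Z$, in $\widetilde{FK}_n$ we have $${\bf p}_m(i)+\tilde\theta_{i+1}^m={\bf p}_m(i+1).$$
   Context: Fix $n\ge2$. Let $\mathcal S$ be the set of symbols $[ij]$, $i<j$ integers with $i\not\equiv j\pmod n$; for $i>j$ put $[ij]:=-[ji]$. $\mathcal A$ is the completion of the free algebra on $\mathcal S$ along the filtration by subalgebras generated by $[ij]$ with $|i|,|j|\ge N$. $\widetilde S_n$ is the affine symmetric group with length $\ell$, $t_{ij}$ the reflection swapping $i+rn,j+rn$ for all $r$; $\mathbb A$ is the affine nilCoxeter algebra with basis $A_w$; $[ij]$ acts on the right by $A_w\cdot[ij]=A_{wt_{ij}}$ if $\ell(wt_{ij})=\ell(w)-1$, else $0$; $\mathcal E\subset\mathcal A$ is the subalgebra of elements whose action on each $A_w$ has finitely many nonzero terms. $\widetilde{FK}_n$ is the quotient of $\mathcal E$ by: (a) $[ij]^2=0$; (b) $[ij][kl]=[kl][ij]$ if $i,j,k,l$ have distinct residues; (c) for $i,j,k$ with distinct residues, $[ij][jk]=[jk][ik]+[ik][ij]$ and $[jk][ij]=[ik][jk]+[ik][ij]$; (d) for $i\not\equiv j$, $\sum_{i'\equiv i,\,j'\equiv j}[ij'][ji']=0$; (e) $[i,j]=[i+n,j+n]$. $\tilde\theta_i=\sum_{j\in\mathbb Z,\,j\not\equiv i}[ij]$. MN elements: for $a\in\mathbb Z$, a connected tree on $\mathcal D_a$ is a finite set $D$ of boxes $(i,j)\in\mathbb Z^2$ with $i\le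 a<j$ such that the graph on $\mathbb Z$ with an edge $\{i,j\}$ per box has its non-isolated vertices forming a single tree whose vertices have pairwise distinct residues mod $n$; $c(D)$ is the number of tree vertices $\le a$. For a bijection $L:\{1,\dots,|D|\}\to D$, $L(t)=(i_t,j_t)$, set $x_{D_L}=[i_1j_1]\cdots[i_{|D|}j_{|D|}]$; two labelings are equivalent if their words differ by swaps of adjacent letters with disjoint supports. With $l$ the number of distinct second coordinates of boxes of $D$ and $v=|D|-l$, $M(D)$ is a set of one representative from each equivalence class containing a labeling with $i_1,\dots,i_{l-1}$ pairwise distinct, $j_1\le\dots\le j_{l-1}$, $j_l,\dots,j_{l+v}$ pairwise distinct, $i_l\le\dots\le i_{l+v}$. Then ${\bf p}_m(a)=\sum_D\sum_{L\in M(D)}(-1)^{c(D)-1}x_{D_L}$, the sum over connected trees $D$ on $\mathcal D_a$ with $m$ boxes.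
   Formalization: Corrected: l counts distinct first (not second) coordinates; the second relation in (c) ends in [ij][ik]; the filtration uses words with some index of absolute value ≥N; the quotient is by the closed ideal, in the topology grouping words up to shifting each letter by multiples of n. *)

theory Defs
  imports
    "HOL-Algebra.QuotRing"
    "HOL-Number_Theory.Cong"
    "HOL-Library.Poly_Mapping"
    "HOL-Combinatorics.Multiset_Permutations"
begin

subsection \<open>The completed free algebra\<close>

definition fk_symbols :: "nat \<Rightarrow> (int \<times> int) set" where
  "fk_symbols n = {(i, j). i < j \<and> \<not> [i = j] (mod int n)}"

text \<open>
  A formal series assigns a coefficient to every word in the symbols. The coefficient ring is an
  arbitrary commutative ring.
\<close>

type_synonym 'k fk_series = "(int \<times> int) list \<Rightarrow> 'k"

text \<open>
  The stage \<open>N\<close> of the filtration is read as the part spanned by the words that involve an index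
  of absolute value at least \<open>N\<close>; thus an element of the completion has, for every \<open>N\<close>, only
  finitely many words with all indices of absolute value below \<open>N\<close>. (If both indices of a symbol
  had to be large, the series \<open>\<Sum>j. [ij]\<close> would not converge.)
\<close>

definition fk_completion :: "nat \<Rightarrow> 'k::comm_ring_1 fk_series set" where
  "fk_completion n =
    {f. (\<forall>u. f u \<noteq> 0 \<longrightarrow> set u \<subseteq> fk_symbols n) \<and>
        (\<forall>N::int. finite {u. f u \<noteq> 0 \<and> (\<forall>(i, j)\<in>set u. \<bar>i\<bar> < N \<and> \<bar>j\<bar> < N)})}"

definition fk_word :: "(int \<times> int) list \<Rightarrow> 'k::comm_ring_1 fk_series" where
  "fk_word u = (\<lambda>v. if v = u then 1 else 0)"

definition fk_mult :: "'k::comm_ring_1 fk_series \<Rightarrow> 'k fk_series \<Rightarrow> 'k fk_series"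
    (infixl \<open>\<star>\<close> 70) where
  "f \<star> g = (\<lambda>u. \<Sum>k\<le>length u. f (take k u) * g (drop k u))"

text \<open>Only used for \<open>i \<noteq> j\<close>.\<close>

definition fk_bracket :: "int \<Rightarrow> int \<Rightarrow> 'k::comm_ring_1 fk_series" where
  "fk_bracket i j = (if i < j then fk_word [(i, j)] else (\<lambda>u. - fk_word [(j, i)] u))"

text \<open>Infinite sums of series in which every word occurs only finitely often.\<close>

definition fk_sum :: "'i set \<Rightarrow> ('i \<Rightarrow> 'k::comm_ring_1 fk_series) \<Rightarrow> 'k fk_series" where
  "fk_sum I F = (\<lambda>u. \<Sum>x | x \<in> I \<and> F x u \<noteq> 0. F x u)"


subsection \<open>The affine symmetric group and the action on the nilCoxeter algebra\<close>

definition affine_perms :: "nat \<Rightarrow> (int \<Rightarrow> int) set" where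
  "affine_perms n =
    {w. bij w \<and> (\<forall>k. w (k + int n) = w k + int n) \<and> (\<Sum>k=1..int n. w k) = (\<Sum>k=1..int n. k)}"

definition affine_refl :: "nat \<Rightarrow> int \<Rightarrow> int \<Rightarrow> int \<Rightarrow> int" where
  "affine_refl n i j k =
    (if [k = i] (mod int n) then k + (j - i)
     else if [k = j] (mod int n) then k - (j - i) else k)"

definition affine_length :: "nat \<Rightarrow> (int \<Rightarrow> int) \<Rightarrow> nat" where
  "affine_length n w =
    (LEAST k. \<exists>rs. length rs = k \<and> w = foldr (\<lambda>r v. affine_refl n r (r + 1) \<circ> v) rs id)"

text \<open>
  Only the module structure of the nilCoxeter algebra matters here: it is the free module with
  basis \<open>A\<^sub>w = Poly_Mapping.single w 1\<close>.
\<close>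

definition nilcox_act_symbol ::
    "nat \<Rightarrow> ((int \<Rightarrow> int) \<Rightarrow>\<^sub>0 'k::comm_ring_1) \<Rightarrow> int \<times> int \<Rightarrow> ((int \<Rightarrow> int) \<Rightarrow>\<^sub>0 'k)" where
  "nilcox_act_symbol n x = (\<lambda>(i, j). \<Sum>w\<in>Poly_Mapping.keys x.
     if affine_length n w = affine_length n (w \<circ> affine_refl n i j) + 1
     then Poly_Mapping.single (w \<circ> affine_refl n i j) (Poly_Mapping.lookup x w) else 0)"

definition nilcox_act_word ::
    "nat \<Rightarrow> ((int \<Rightarrow> int) \<Rightarrow>\<^sub>0 'k::comm_ring_1) \<Rightarrow> (int \<times> int) list \<Rightarrow> ((int \<Rightarrow> int) \<Rightarrow>\<^sub>0 'k)" where
  "nilcox_act_word n = foldl (nilcox_act_symbol n)"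

definition fk_E :: "nat \<Rightarrow> 'k::comm_ring_1 fk_series ring" where
  "fk_E n =
    \<lparr>carrier = {f \<in> fk_completion n. \<forall>w\<in>affine_perms n.
        finite {u. nilcox_act_word n (Poly_Mapping.single w (f u)) u \<noteq> 0}},
     monoid.mult = (\<star>), one = fk_word [], zero = (\<lambda>u. 0), add = (\<lambda>f g u. f u + g u)\<rparr>"


subsection \<open>The affine Fomin-Kirillov algebra\<close>

abbreviation distinct_residues :: "nat \<Rightarrow> int list \<Rightarrow> bool" where
  "distinct_residues n xs \<equiv> distinct (map (\<lambda>x. x mod int n) xs)"

text \<open>
  The last term of \<open>triple2\<close> is also found printed as \<open>[ik][ij]\<close>. That is a misprint: \<open>triple2\<close> is
  \<open>triple1\<close> with \<open>i\<close> and \<open>k\<close> exchanged, so the misprint would force \<open>[ij][ik] = [ik][ij]\<close>, which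
  fails for the action on the nilCoxeter algebra. The misprinted relations generate a larger ideal,
  so an equality in the quotient below implies the one in their quotient.
\<close>

inductive_set fk_relations :: "nat \<Rightarrow> 'k::comm_ring_1 fk_series set" for n where
  square: "distinct_residues n [i, j] \<Longrightarrow>
    fk_bracket i j \<star> fk_bracket i j \<in> fk_relations n"
| commute: "distinct_residues n [i, j, k, l] \<Longrightarrow>
    (\<lambda>u. (fk_bracket i j \<star> fk_bracket k l) u - (fk_bracket k l \<star> fk_bracket i j) u)
      \<in> fk_relations n"
| triple1: "distinct_residues n [i, j, k] \<Longrightarrow>
    (\<lambda>u. (fk_bracket i j \<star> fk_bracket j k) u
        - ((fk_bracket j k \<star> fk_bracket i k) u + (fk_bracket i k \<star> fk_bracket i j) u))
      \<in> fk_relations n"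
| triple2: "distinct_residues n [i, j, k] \<Longrightarrow>
    (\<lambda>u. (fk_bracket j k \<star> fk_bracket i j) u
        - ((fk_bracket i k \<star> fk_bracket j k) u + (fk_bracket i j \<star> fk_bracket i k) u))
      \<in> fk_relations n"
| infinite: "distinct_residues n [i, j] \<Longrightarrow>
    fk_sum {(i', j'). [i' = i] (mod int n) \<and> [j' = j] (mod int n)}
      (\<lambda>(i', j'). fk_bracket i j' \<star> fk_bracket j i') \<in> fk_relations n"
| shift: "distinct_residues n [i, j] \<Longrightarrow>
    (\<lambda>u. fk_bracket i j u - fk_bracket (i + int n) (j + int n) u) \<in> fk_relations n"

text \<open>
  Relations have to be applicable to infinitely many terms of a series at once (already
  \<open>(\<Sum>j. [ij])\<^sup>2\<close> contains infinitely many squares), so the quotient is by the closed ideal. Two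
  words are shift-equivalent if they agree up to shifting each symbol by a multiple of \<open>n\<close>, i.e.
  if they give the same sequence of reflections, and a net of series tends to \<open>0\<close> if the words of
  every shift class eventually do not occur in it at all. Only finitely many shift classes act
  nontrivially on a given \<open>A\<^sub>w\<close>, so the action is continuous. In the topology of the filtration, in
  contrast, \<open>[i + r n, j + r n]\<close> would tend to \<open>0\<close> as \<open>r\<close> grows, and the closed ideal would
  contain all symbols because of the last relation.
\<close>

definition shift_equivalent :: "nat \<Rightarrow> (int \<times> int) list \<Rightarrow> (int \<times> int) list \<Rightarrow> bool" where
  "shift_equivalent n =
    list_all2 (\<lambda>(i, j) (k, l). \<exists>r. k = i + r * int n \<and> l = j + r * int n)"

definition fk_ideal :: "nat \<Rightarrow> 'k::comm_ring_1 fk_series set" where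
  "fk_ideal n =
    {f \<in> carrier (fk_E n). \<forall>U. finite U \<longrightarrow>
      (\<exists>g \<in> Idl\<^bsub>fk_E n\<^esub> (fk_relations n). \<forall>u\<in>U. \<forall>v. shift_equivalent n u v \<longrightarrow> f v = g v)}"

definition affine_FK :: "nat \<Rightarrow> 'k::comm_ring_1 fk_series set ring" where
  "affine_FK n = fk_E n Quot fk_ideal n"

definition fk_class :: "nat \<Rightarrow> 'k::comm_ring_1 fk_series \<Rightarrow> 'k fk_series set" where
  "fk_class n f = fk_ideal n +>\<^bsub>fk_E n\<^esub> f"

definition fk_theta :: "nat \<Rightarrow> int \<Rightarrow> 'k::comm_ring_1 fk_series" where
  "fk_theta n i = fk_sum {j. \<not> [j = i] (mod int n)} (fk_bracket i)"


subsection \<open>Murnaghan-Nakayama elements\<close>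

definition box_vertices :: "(int \<times> int) set \<Rightarrow> int set" where
  "box_vertices D = fst ` D \<union> snd ` D"

definition box_adj :: "(int \<times> int) set \<Rightarrow> int \<Rightarrow> int \<Rightarrow> bool" where
  "box_adj D x y \<longleftrightarrow> (x, y) \<in> D \<or> (y, x) \<in> D"

definition box_cycle :: "(int \<times> int) set \<Rightarrow> int list \<Rightarrow> bool" where
  "box_cycle D xs \<longleftrightarrow> length xs \<ge> 3 \<and> distinct xs \<and>
    (\<forall>k<length xs. box_adj D (xs ! k) (xs ! (Suc k mod length xs)))"

definition connected_tree :: "nat \<Rightarrow> int \<Rightarrow> (int \<times> int) set \<Rightarrow> bool" where
  "connected_tree n a D \<longleftrightarrow> finite D \<and> D \<noteq> {} \<and> (\<forall>(i, j)\<in>D. i \<le> a \<and> a < j) \<and>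
    (\<forall>x\<in>box_vertices D. \<forall>y\<in>box_vertices D. (box_adj D)\<^sup>*\<^sup>* x y) \<and>
    (\<nexists>xs. box_cycle D xs) \<and>
    inj_on (\<lambda>x. x mod int n) (box_vertices D)"

definition lower_vertices :: "int \<Rightarrow> (int \<times> int) set \<Rightarrow> nat" where
  "lower_vertices a D = card {x \<in> box_vertices D. x \<le> a}"

text \<open>
  A labeling \<open>L\<close> of \<open>D\<close> is represented by the list \<open>[L 1, \<dots>, L |D|]\<close>, that is, by an element
  of \<open>permutations_of_set D\<close>.
\<close>

inductive swap_step :: "(int \<times> int) list \<Rightarrow> (int \<times> int) list \<Rightarrow> bool" where
  "{i, j} \<inter> {k, l} = {} \<Longrightarrow>
    swap_step (us @ [(i, j), (k, l)] @ vs) (us @ [(k, l), (i, j)] @ vs)"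

text \<open>
  Here \<open>l\<close> has to be the number of distinct first coordinates of the boxes (with second
  coordinates instead, already \<open>{(i, j), (i', j)}\<close> would have no admissible labeling, as
  \<open>j\<^sub>1, j\<^sub>2\<close> would have to be distinct, and the identity for the Murnaghan-Nakayama elements
  would fail for \<open>m = 2\<close>, \<open>n = 3\<close>).
\<close>

definition hook_labeling :: "(int \<times> int) set \<Rightarrow> (int \<times> int) list \<Rightarrow> bool" where
  "hook_labeling D u \<longleftrightarrow> u \<in> permutations_of_set D \<and>
    (let l = card (fst ` D) in
      distinct (map fst (take (l - 1) u)) \<and> sorted (map snd (take (l - 1) u)) \<and>
      distinct (map snd (drop (l - 1) u)) \<and> sorted (map fst (drop (l - 1) u)))"

definition mn_representatives :: "(int \<times> int) set \<Rightarrow> (int \<times> int) list set \<Rightarrow> bool" where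
  "mn_representatives D R \<longleftrightarrow> R \<subseteq> permutations_of_set D \<and>
    (\<forall>u\<in>R. \<exists>v. hook_labeling D v \<and> swap_step\<^sup>*\<^sup>* u v) \<and>
    (\<forall>v. hook_labeling D v \<longrightarrow> (\<exists>!u. u \<in> R \<and> swap_step\<^sup>*\<^sup>* u v))"

definition mn_element ::
    "nat \<Rightarrow> ((int \<times> int) set \<Rightarrow> (int \<times> int) list set) \<Rightarrow> nat \<Rightarrow> int \<Rightarrow> 'k::comm_ring_1 fk_series" where
  "mn_element n M m a =
    fk_sum {(D, u). connected_tree n a D \<and> card D = m \<and> u \<in> M D}
      (\<lambda>(D, u) v. (- 1) ^ (lower_vertices a D - 1) * fk_word u v)"

end

theory Submission
  imports Defs "HOL-Library.Function_Algebras"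
begin

text \<open>
  Put \<open>a = i + 1\<close>. By the relations \<open>(d)\<close> and \<open>(e)\<close>, the partial sums of \<open>\<theta>\<^sub>a\<close> over the residue
  classes square to zero, and together with their analogues for other pairs of residues they satisfy
  the finite Fomin-Kirillov relations. The cyclic relation of that algebra then removes from
  \<open>\<theta>\<^sub>a\<^sup>m\<close> all words with a repeated residue. What is left, and the trees of both Murnaghan-Nakayama
  elements that contain \<open>a\<close>, is sorted by vertex set; trees that avoid \<open>a\<close> cancel.

  A word on a tree, up to swaps of disjoint letters, is a linear order on the edges at each vertex,
  i.e. a plane forest rooted at \<open>a\<close>, and it has a hook labeling iff every edge \<open>(i, j)\<close> is the first
  one at \<open>i\<close> or the last one at \<open>j\<close>. Let \<open>X\<close>, \<open>Y\<close> and \<open>Z\<close> denote the sums over the branches at \<open>a\<close>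
  that are single edges, that satisfy the hook condition and meet \<open>a\<close> in an edge that is extremal at
  its other end, and that satisfy the hook condition, each split into the branches to the left (\<open>L\<close>)
  and to the right (\<open>R\<close>) of \<open>a\<close>; products run over branches with disjoint vertices. The two triple relations read \<open>Y\<^sub>R Y\<^sub>L = (Y\<^sub>R - X\<^sub>R) + (Y\<^sub>L - X\<^sub>L)\<close> and
  \<open>Y\<^sub>L Z\<^sub>R + (Z\<^sub>L - Y\<^sub>L) Y\<^sub>R = (Z\<^sub>R - Y\<^sub>R) + (Z\<^sub>L - Y\<^sub>L)\<close>, so that \<open>1 - X = (1 - Y\<^sub>R) (1 - Y\<^sub>L)\<close>, and the
  sum over all stars is \<open>(1 - X)\<^sup>-\<^sup>1 = (1 - Y\<^sub>L)\<^sup>-\<^sup>1 (1 - Y\<^sub>R)\<^sup>-\<^sup>1 = 1 + Z\<^sub>R (1 - Y\<^sub>R)\<^sup>-\<^sup>1 + (1 - Y\<^sub>L)\<^sup>-\<^sup>1 Z\<^sub>L\<close>.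
\<close>

section \<open>Words up to swaps of disjoint letters\<close>

text \<open>The series on both sides are infinite, and a relation may be applied to infinitely many
  of their words at once only because the ideal is closed, where closeness is tested on shift
  classes. This stays manageable because all words involved have bounded length and each of their
  letters starts before one fixed bound and ends after another, so a shift class meets them in
  finitely many words. Splitting the difference of the two sides by vertex set then leaves finite
  identities, each with one overall sign. They use only commutations and the two triple relations in
  which \<open>a\<close> lies between the other two vertices; relations (d) and (e) enter only in
  the reduction of the power of theta. The hook condition speaks of positions in a labeling, while
  the relations act on words up to swaps. Both become statements about the orders of the edges at
  the vertices, and rooting at \<open>a\<close> turns these orders into a recursive datatype, on
  which a triple relation grafts one branch onto another.\<close>

definition touches :: "int \<Rightarrow> int \<times> int \<Rightarrow> bool" where
  "touches x e \<longleftrightarrow> x = fst e \<or> x = snd e"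

text \<open>Words up to swaps of disjoint letters form a partially commutative monoid in which
  letters are dependent iff they share a vertex. The subwords at single vertices are its projections
  to sets of pairwise dependent letters; together they are a complete invariant
  (\<open>swaps_local_word\<close>, \<open>local_word_swaps\<close>).\<close>

definition local_word :: "int \<Rightarrow> (int \<times> int) list \<Rightarrow> (int \<times> int) list" where
  "local_word x u = filter (touches x) u"

lemma local_word_simps [simp]:
  "local_word x [] = []"
  "local_word x (e # u) = (if touches x e then e # local_word x u else local_word x u)"
  "local_word x (u @ v) = local_word x u @ local_word x v"
  by (auto simp: local_word_def)

lemma set_local_word: "set (local_word x u) = {e \<in> set u. touches x e}"
  by (auto simp: local_word_def)

lemma box_vertices_touches: "x \<in> box_vertices D \<longleftrightarrow> (\<exists>e\<in>D. touches x e)"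
  by (force simp: box_vertices_def touches_def)

lemma box_vertices_simps [simp]:
  "box_vertices {} = {}"
  "box_vertices (insert (x, y) D) = insert x (insert y (box_vertices D))"
  "box_vertices (D \<union> D') = box_vertices D \<union> box_vertices D'"
  by (auto simp: box_vertices_def)

lemma swap_stepI:
  assumes "\<And>x. touches x e \<Longrightarrow> \<not> touches x f"
  shows "swap_step (us @ [e, f] @ vs) (us @ [f, e] @ vs)"
proof -
  obtain i j k l where ef: "e = (i, j)" "f = (k, l)"
    by (cases e, cases f) auto
  have "{i, j} \<inter> {k, l} = {}"
    using assms ef by (auto simp: touches_def)
  then show ?thesis
    unfolding ef by (rule swap_step.intros)
qed

lemma swap_step_sym: "swap_step u v \<Longrightarrow> swap_step v u"
  by (induction rule: swap_step.induct) (metis Int_commute swap_step.intros)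

lemma swaps_sym: "swap_step\<^sup>*\<^sup>* u v \<Longrightarrow> swap_step\<^sup>*\<^sup>* v u"
  by (induction rule: rtranclp_induct) (auto intro: converse_rtranclp_into_rtranclp swap_step_sym)

lemma swaps_trans: "swap_step\<^sup>*\<^sup>* u v \<Longrightarrow> swap_step\<^sup>*\<^sup>* v w \<Longrightarrow> swap_step\<^sup>*\<^sup>* u w"
  by (rule rtranclp_trans)

lemma swap_step_context: "swap_step u v \<Longrightarrow> swap_step (p @ u @ q) (p @ v @ q)"
proof (induction rule: swap_step.induct)
  case (1 i j k l us vs)
  from swap_step.intros[OF this, of "p @ us" "vs @ q"] show ?case by simp
qed

lemma swaps_context: "swap_step\<^sup>*\<^sup>* u v \<Longrightarrow> swap_step\<^sup>*\<^sup>* (p @ u @ q) (p @ v @ q)"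
  by (induction rule: rtranclp_induct) (auto intro: rtranclp.rtrancl_into_rtrancl swap_step_context)

lemma swaps_append:
  "swap_step\<^sup>*\<^sup>* u u' \<Longrightarrow> swap_step\<^sup>*\<^sup>* v v' \<Longrightarrow> swap_step\<^sup>*\<^sup>* (u @ v) (u' @ v')"
  using swaps_trans[of "u @ v" "u' @ v" "u' @ v'"] swaps_context[of u u' "[]" v]
    swaps_context[of v v' u' "[]"] by simp

lemma swaps_move_letter:
  "(\<And>x. touches x e \<Longrightarrow> x \<notin> box_vertices (set u)) \<Longrightarrow> swap_step\<^sup>*\<^sup>* (u @ [e]) (e # u)"
proof (induction u)
  case (Cons f u)
  have "swap_step\<^sup>*\<^sup>* (u @ [e]) (e # u)"
    using Cons by (auto simp: box_vertices_touches)
  from swaps_context[OF this, of "[f]" "[]"] have "swap_step\<^sup>*\<^sup>* (f # u @ [e]) (f # e # u)"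
    by simp
  moreover have "swap_step (f # e # u) (e # f # u)"
    using swap_stepI[of f e "[]" u] Cons.prems by (auto simp: box_vertices_touches)
  ultimately show ?case by simp
qed simp

lemma swaps_commute:
  "box_vertices (set u) \<inter> box_vertices (set v) = {} \<Longrightarrow> swap_step\<^sup>*\<^sup>* (u @ v) (v @ u)"
proof (induction v arbitrary: u)
  case (Cons e v)
  have "swap_step\<^sup>*\<^sup>* (u @ [e]) (e # u)"
    using Cons.prems by (intro swaps_move_letter) (fastforce simp: box_vertices_touches disjoint_iff)
  from swaps_context[OF this, of "[]" v]
  have 1: "swap_step\<^sup>*\<^sup>* (u @ e # v) (e # u @ v)" by simp
  have "swap_step\<^sup>*\<^sup>* (u @ v) (v @ u)"
    using Cons.prems by (intro Cons.IH) (fastforce simp: box_vertices_touches disjoint_iff)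
  from swaps_context[OF this, of "[e]" "[]"] swaps_trans[OF 1] show ?case by simp
qed simp

text \<open>Disjoint letters do not both touch \<open>x\<close>, so filtering keeps at most one of
  the two exchanged letters.\<close>

lemma swap_step_local_word: "swap_step u v \<Longrightarrow> local_word x u = local_word x v"
proof (induction rule: swap_step.induct)
  case (1 i j k l us vs)
  then have "\<not> (touches x (i, j) \<and> touches x (k, l))"
    by (auto simp: touches_def)
  then show ?case
    by (cases "touches x (i, j)") simp_all
qed

lemma swaps_local_word: "swap_step\<^sup>*\<^sup>* u v \<Longrightarrow> local_word x u = local_word x v"
  by (induction rule: rtranclp_induct) (auto dest: swap_step_local_word)

lemma swap_step_mset: "swap_step u v \<Longrightarrow> mset u = mset v"
  by (induction rule: swap_step.induct) simp

lemma swaps_mset: "swap_step\<^sup>*\<^sup>* u v \<Longrightarrow> mset u = mset v"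
  by (induction rule: rtranclp_induct) (simp_all add: swap_step_mset)

lemma swaps_set: "swap_step\<^sup>*\<^sup>* u v \<Longrightarrow> set u = set v"
  by (metis swaps_mset set_mset_mset)

lemma swaps_length: "swap_step\<^sup>*\<^sup>* u v \<Longrightarrow> length u = length v"
  by (metis swaps_mset size_mset)

lemma swaps_distinct: "swap_step\<^sup>*\<^sup>* u v \<Longrightarrow> distinct u = distinct v"
  by (metis swaps_mset mset_eq_imp_distinct_iff)

text \<open>The first letter \<open>e\<close> of \<open>u\<close> heads the local words of
  \<open>v\<close> at both its ends. Hence nothing before the first \<open>e\<close> in
  \<open>v\<close> shares a vertex with it, \<open>e\<close> can be moved to the front, and
  induction handles the rest.\<close>

lemma local_word_swaps: "(\<And>x. local_word x u = local_word x v) \<Longrightarrow> swap_step\<^sup>*\<^sup>* u v"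
proof (induction u arbitrary: v)
  case Nil
  have "v = []"
  proof (cases v)
    case (Cons e v')
    then show ?thesis using Nil[of "fst e"] by (auto simp: touches_def)
  qed
  then show ?case by simp
next
  case (Cons e u)
  have "e \<in> set (local_word (fst e) v)"
    unfolding Cons.prems[of "fst e", symmetric] by (simp add: touches_def)
  then have "e \<in> set v" by (simp add: set_local_word)
  then obtain p q where v: "v = p @ e # q" and e: "e \<notin> set p"
    by (meson split_list_first)
  \<comment> \<open>A letter of \<open>p\<close> at \<open>x\<close> would head the local word of
    \<open>v\<close> there and so be equal to \<open>e\<close>, but \<open>p\<close> ends before the
    first \<open>e\<close>.\<close>
  have p: "local_word x p = []" if "touches x e" for x
  proof (cases "local_word x p")
    case (Cons f r)
    then have "f = e"
      using Cons.prems[of x] that by (simp add: v)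
    moreover have "f \<in> set p" 
      using set_local_word[of x p] Cons by auto
    ultimately show ?thesis using e by simp
  qed
  then have "swap_step\<^sup>*\<^sup>* (p @ [e]) (e # p)"
    by (intro swaps_move_letter) (auto simp: box_vertices_touches local_word_def filter_empty_conv)
  from swaps_context[OF this, of "[]" q] have 1: "swap_step\<^sup>*\<^sup>* v (e # p @ q)"
    by (simp add: v)
  have "local_word x u = local_word x (p @ q)" for x
    using Cons.prems[of x] p[of x] by (auto simp: v split: if_splits)
  from swaps_context[OF Cons.IH[OF this], of "[e]" "[]"] have "swap_step\<^sup>*\<^sup>* (e # u) (e # p @ q)"
    by simp
  from swaps_trans[OF this swaps_sym[OF 1]] show ?case .
qed

section \<open>Plane forests\<close>

text \<open>A box has its smaller coordinate first, while a tree walked from its root meets its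
  edges in either direction.\<close>

definition edge :: "int \<Rightarrow> int \<Rightarrow> int \<times> int" where
  "edge x y = (min x y, max x y)"

lemma edge_commute: "edge x y = edge y x"
  by (simp add: edge_def min.commute max.commute)

lemma touches_edge [simp]: "touches x (edge p v) \<longleftrightarrow> x = p \<or> x = v"
  by (auto simp: touches_def edge_def)

lemma edge_eq_iff [simp]: "edge v x = edge v y \<longleftrightarrow> x = y"
  by (auto simp: edge_def min_def max_def)

lemma box_vertices_edge [simp]:
  "box_vertices (insert (edge x y) D) = insert x (insert y (box_vertices D))"
  by (auto simp: box_vertices_touches)

lemma local_word_empty: "x \<notin> box_vertices (set u) \<Longrightarrow> local_word x u = []"
  by (auto simp: box_vertices_touches local_word_def filter_empty_conv)

text \<open>
  The root of a branch comes with the branches that hang on edges before (\<open>pre\<close>) and after (\<open>post\<close>)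
  the edge to its parent, in the linear order of the edges at that root.
\<close>

datatype plane_tree = Node (root: int) (pre: "plane_tree list") (post: "plane_tree list")

text \<open>An in-order traversal: one linear extension of the orders of the edges at all nodes of
  the branch.\<close>

fun branch_word :: "int \<Rightarrow> plane_tree \<Rightarrow> (int \<times> int) list" where
  "branch_word p (Node v bs cs) =
    concat (map (branch_word v) bs) @ [edge p v] @ concat (map (branch_word v) cs)"

definition forest_word :: "int \<Rightarrow> plane_tree list \<Rightarrow> (int \<times> int) list" where
  "forest_word p ts = concat (map (branch_word p) ts)"

fun nodes :: "plane_tree \<Rightarrow> int list" where
  "nodes (Node v bs cs) = v # concat (map nodes bs) @ concat (map nodes cs)"

definition forest_nodes :: "plane_tree list \<Rightarrow> int list" where
  "forest_nodes ts = concat (map nodes ts)"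

lemma branch_word_Node [simp]:
  "branch_word p (Node v bs cs) = forest_word v bs @ edge p v # forest_word v cs"
  by (simp add: forest_word_def)

lemma nodes_Node [simp]: "nodes (Node v bs cs) = v # forest_nodes bs @ forest_nodes cs"
  by (simp add: forest_nodes_def)

declare branch_word.simps [simp del] nodes.simps [simp del]

lemma forest_word_simps [simp]:
  "forest_word p [] = []"
  "forest_word p (t # ts) = branch_word p t @ forest_word p ts"
  "forest_word p (ts @ ts') = forest_word p ts @ forest_word p ts'"
  by (simp_all add: forest_word_def)

lemma forest_nodes_simps [simp]:
  "forest_nodes [] = []"
  "forest_nodes (t # ts) = nodes t @ forest_nodes ts"
  "forest_nodes (ts @ ts') = forest_nodes ts @ forest_nodes ts'"
  by (simp_all add: forest_nodes_def)

lemma set_forest_nodes: "set (forest_nodes ts) = (\<Union>t\<in>set ts. set (nodes t))"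
  by (simp add: forest_nodes_def)

lemma set_forest_word: "set (forest_word p ts) = (\<Union>t\<in>set ts. set (branch_word p t))"
  by (simp add: forest_word_def)

lemma root_in_nodes [simp]: "root t \<in> set (nodes t)"
  by (cases t) simp

lemma nodes_not_Nil [simp]: "nodes t \<noteq> []"
  by (cases t) simp

lemma forest_nodes_Nil_iff [simp]: "forest_nodes ts = [] \<longleftrightarrow> ts = []"
  by (cases ts) auto

lemma distinct_nodes_subtree:
  "distinct (forest_nodes ts) \<Longrightarrow> t \<in> set ts \<Longrightarrow> distinct (nodes t)"
  by (induction ts) auto

lemma box_vertices_UN: "box_vertices (\<Union>x\<in>A. D x) = (\<Union>x\<in>A. box_vertices (D x))"
  by (auto simp: box_vertices_def)

lemma box_vertices_branch_word:
  "box_vertices (set (branch_word p t)) = insert p (set (nodes t))"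
proof (induction p t rule: branch_word.induct)
  case (1 p v bs cs)
  have "box_vertices (set (forest_word v ts)) \<subseteq> insert v (set (forest_nodes ts))"
    and "set (forest_nodes ts) \<subseteq> box_vertices (set (forest_word v ts))"
    if "ts = bs \<or> ts = cs" for ts
    using 1 that by (auto simp: set_forest_nodes set_forest_word box_vertices_UN)
  from this[of bs] this[of cs] show ?case by auto
qed

lemma box_vertices_forest_word:
  "box_vertices (set (forest_word p ts)) = (if ts = [] then {} else insert p (set (forest_nodes ts)))"
  by (auto simp: set_forest_nodes set_forest_word box_vertices_UN box_vertices_branch_word)

text \<open>Every node contributes exactly the edge to its parent.\<close>

lemma length_branch_word: "length (branch_word p t) = length (nodes t)"
proof (induction p t rule: branch_word.induct)
  case (1 p v bs cs)
  then show ?case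
    by (simp add: forest_word_def forest_nodes_def length_concat o_def cong: map_cong)
qed

lemma length_forest_word: "length (forest_word p ts) = length (forest_nodes ts)"
  by (induction ts) (auto simp: length_branch_word)

text \<open>The child end of every edge lies inside the branch. This keeps apart the letters of
  branches that share only their parent.\<close>

lemma branch_letter_touches:
  "e \<in> set (branch_word p t) \<Longrightarrow> \<exists>x\<in>set (nodes t). touches x e"
proof (induction p t rule: branch_word.induct)
  case (1 p v bs cs)
  then consider "e = edge p v" | t where "t \<in> set bs \<union> set cs" "e \<in> set (branch_word v t)"
    by (auto simp: set_forest_word)
  then show ?case
    using 1(1,2) by cases (fastforce simp: set_forest_nodes)+
qed

lemma forest_letter_touches:
  "e \<in> set (forest_word p ts) \<Longrightarrow> \<exists>x\<in>set (forest_nodes ts). touches x e"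
  using branch_letter_touches by (fastforce simp: set_forest_nodes set_forest_word)

lemma forest_words_disjoint:
  assumes "set (forest_nodes ts) \<inter> insert q (set (forest_nodes ts')) = {}"
  shows "set (forest_word p ts) \<inter> set (forest_word q ts') = {}"
proof -
  have False if "e \<in> set (forest_word p ts)" "e \<in> set (forest_word q ts')" for e
  proof -
    obtain x where "x \<in> set (forest_nodes ts)" "touches x e"
      using forest_letter_touches \<open>e \<in> set (forest_word p ts)\<close> by blast
    moreover from this have "x \<in> box_vertices (set (forest_word q ts'))"
      using that by (auto simp: box_vertices_touches)
    ultimately show False
      using assms by (auto simp: box_vertices_forest_word split: if_splits)
  qed
  then show ?thesis by blast
qed

lemma distinct_forest_wordI:
  assumes "\<And>t. t \<in> set ts \<Longrightarrow> distinct (branch_word p t)" "distinct (p # forest_nodes ts)"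
  shows "distinct (forest_word p ts)"
  using assms
proof (induction ts)
  case (Cons t ts)
  have "set (forest_word p [t]) \<inter> set (forest_word p ts) = {}"
    using Cons.prems(2) by (intro forest_words_disjoint) auto
  then show ?case using Cons by simp
qed simp

lemma distinct_branch_word: "distinct (p # nodes t) \<Longrightarrow> distinct (branch_word p t)"
proof (induction p t rule: branch_word.induct)
  case (1 p v bs cs)
  have bs: "distinct (forest_word v bs)" and cs: "distinct (forest_word v cs)"
    using 1 by (auto intro!: distinct_forest_wordI dest: distinct_nodes_subtree
        simp: set_forest_nodes)
  have "set (forest_word v bs) \<inter> set (forest_word v cs) = {}"
    using 1 by (intro forest_words_disjoint) auto
  moreover have "edge p v \<notin> set (forest_word v ts)" if "p \<notin> set (forest_nodes ts)" "p \<noteq> v" for ts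
    using that box_vertices_forest_word[of v ts] box_vertices_touches[of p "set (forest_word v ts)"]
    by (auto split: if_splits)
  ultimately show ?case
    using bs cs 1 by auto
qed

lemma distinct_forest_word: "distinct (p # forest_nodes ts) \<Longrightarrow> distinct (forest_word p ts)"
  by (rule distinct_forest_wordI)
    (auto intro!: distinct_branch_word dest: distinct_nodes_subtree simp: set_forest_nodes)

section \<open>Recovering a plane forest from the orders of the edges at its vertices\<close>

lemma local_word_parent: "p \<notin> set (nodes t) \<Longrightarrow> local_word p (branch_word p t) = [edge p (root t)]"
  by (cases t) (auto simp: local_word_empty box_vertices_forest_word)

lemma local_word_forest_root:
  "p \<notin> set (forest_nodes ts) \<Longrightarrow> local_word p (forest_word p ts) = map (\<lambda>t. edge p (root t)) ts"
  by (induction ts) (auto simp: local_word_parent)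

lemma local_word_forest_subtree:
  assumes "distinct (p # forest_nodes ts)" "t \<in> set ts" "x \<in> set (nodes t)"
  shows "local_word x (forest_word p ts) = local_word x (branch_word p t)"
proof -
  obtain us vs where ts: "ts = us @ t # vs" using assms(2) by (meson split_list)
  have "x \<notin> box_vertices (set (forest_word p us))" "x \<notin> box_vertices (set (forest_word p vs))"
    using assms by (auto simp: ts box_vertices_forest_word)
  then show ?thesis by (simp add: ts local_word_empty)
qed

text \<open>The orders \<open>lo\<close> are a parameter, so that two trees can be compared with the
  same family of orders, and a branch with the orders of a larger forest.\<close>

fun local_orders :: "(int \<Rightarrow> (int \<times> int) list) \<Rightarrow> int \<Rightarrow> plane_tree \<Rightarrow> bool" where
  "local_orders lo p (Node v bs cs) \<longleftrightarrow>
    lo v = map (\<lambda>t. edge v (root t)) bs @ edge p v # map (\<lambda>t. edge v (root t)) cs \<and>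
    (\<forall>t\<in>set bs. local_orders lo v t) \<and> (\<forall>t\<in>set cs. local_orders lo v t)"

lemma local_orders_branch_word:
  assumes "distinct (p # nodes t)"
    and "\<And>x. x \<in> set (nodes t) \<Longrightarrow> lo x = local_word x (branch_word p t)"
  shows "local_orders lo p t"
  using assms
proof (induction p t rule: branch_word.induct)
  case (1 p v bs cs)
  have v: "lo v = map (\<lambda>t. edge v (root t)) bs @ edge p v # map (\<lambda>t. edge v (root t)) cs"
    using 1 by (simp add: local_word_forest_root)
  have "local_orders lo v t" if t: "t \<in> set bs" for t
  proof (rule 1(1)[OF t])
    show "distinct (v # nodes t)"
      using 1 t by (auto dest: distinct_nodes_subtree simp: set_forest_nodes)
    show "lo x = local_word x (branch_word v t)" if x: "x \<in> set (nodes t)" for x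
    proof -
      have xs: "x \<in> set (forest_nodes bs)"
        using t x by (auto simp: set_forest_nodes)
      then have "x \<noteq> p" "x \<noteq> v" "x \<notin> box_vertices (set (forest_word v cs))"
        using 1(3) by (auto simp: box_vertices_forest_word split: if_splits)
      then show ?thesis
        using 1(3) 1(4)[of x] xs local_word_forest_subtree[of v bs t x] t x
        by (simp add: local_word_empty)
    qed
  qed
  moreover have "local_orders lo v t" if t: "t \<in> set cs" for t
  proof (rule 1(2)[OF t])
    show "distinct (v # nodes t)"
      using 1 t by (auto dest: distinct_nodes_subtree simp: set_forest_nodes)
    show "lo x = local_word x (branch_word v t)" if x: "x \<in> set (nodes t)" for x
    proof -
      have xs: "x \<in> set (forest_nodes cs)"
        using t x by (auto simp: set_forest_nodes)
      then have "x \<noteq> p" "x \<noteq> v" "x \<notin> box_vertices (set (forest_word v bs))"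
        using 1(3) by (auto simp: box_vertices_forest_word split: if_splits)
      then show ?thesis
        using 1(3) 1(4)[of x] xs local_word_forest_subtree[of v cs t x] t x
        by (simp add: local_word_empty)
    qed
  qed
  ultimately show ?case using v by simp
qed

lemma local_orders_forest_word:
  assumes "distinct (p # forest_nodes ts)" "t \<in> set ts"
  shows "local_orders (\<lambda>x. local_word x (forest_word p ts)) p t"
  using assms
  by (intro local_orders_branch_word local_word_forest_subtree)
    (auto dest: distinct_nodes_subtree simp: set_forest_nodes)

lemma map_root_eqI:
  assumes "map (\<lambda>t. edge v (root t)) ts = map (\<lambda>t. edge v (root t)) ts'"
    and "\<And>t t'. t \<in> set ts \<Longrightarrow> t' \<in> set ts' \<Longrightarrow> root t = root t' \<Longrightarrow> t = t'"
  shows "ts = ts'"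
proof (rule nth_equalityI)
  show len: "length ts = length ts'"
    using assms(1) by (metis length_map)
  fix k assume "k < length ts"
  then show "ts ! k = ts' ! k"
    using assms(2)[of "ts ! k" "ts' ! k"] len arg_cong[OF assms(1), of "\<lambda>xs. xs ! k"] by simp
qed

text \<open>The edge to the parent differs from all edges to children, so it splits the order at a
  node into the \<open>pre\<close> and the \<open>post\<close> part. This gives the roots of all
  subtrees in order, and the subtrees follow by induction.\<close>

lemma local_orders_unique:
  assumes "local_orders lo p t" "local_orders lo p t'" "root t = root t'"
    and "distinct (p # nodes t)" "distinct (p # nodes t')"
  shows "t = t'"
  using assms
proof (induction t arbitrary: p t')
  case (Node v bs cs)
  obtain bs' cs' where t': "t' = Node v bs' cs'"
    using Node.prems(3) by (cases t') auto
  have notin: "edge p v \<notin> set (map (\<lambda>t. edge v (root t)) ts)"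
    if "p \<notin> set (forest_nodes ts)" for ts
    using that by (auto simp: edge_commute[of p v] set_forest_nodes)
  have "map (\<lambda>t. edge v (root t)) bs @ edge p v # map (\<lambda>t. edge v (root t)) cs =
      map (\<lambda>t. edge v (root t)) bs' @ edge p v # map (\<lambda>t. edge v (root t)) cs'"
    using Node.prems(1,2) by (simp add: t')
  then have "map (\<lambda>t. edge v (root t)) bs = map (\<lambda>t. edge v (root t)) bs' \<and>
      map (\<lambda>t. edge v (root t)) cs = map (\<lambda>t. edge v (root t)) cs'"
    using Node.prems(4,5) notin[of bs] notin[of cs] notin[of bs']
    by (subst (asm) append_Cons_eq_iff) (auto simp: t')
  moreover have "t = s" if "t \<in> set bs" "s \<in> set bs'" "root t = root s" for t s
    using that Node.prems
    by (intro Node.IH(1)[of t v]) (auto simp: t' set_forest_nodes dest: distinct_nodes_subtree)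
  moreover have "t = s" if "t \<in> set cs" "s \<in> set cs'" "root t = root s" for t s
    using that Node.prems
    by (intro Node.IH(2)[of t v]) (auto simp: t' set_forest_nodes dest: distinct_nodes_subtree)
  ultimately show ?case
    using map_root_eqI[of v bs bs'] map_root_eqI[of v cs cs'] by (auto simp: t')
qed

text \<open>Swaps preserve local words, and these determine the forest. So a swap class contains at
  most one plane forest word for a given root.\<close>

lemma forest_word_swaps_unique:
  assumes "swap_step\<^sup>*\<^sup>* (forest_word p ts) (forest_word p ts')"
    and "distinct (p # forest_nodes ts)" "distinct (p # forest_nodes ts')"
  shows "ts = ts'"
proof (rule map_root_eqI)
  have lo: "local_word x (forest_word p ts) = local_word x (forest_word p ts')" for x
    using swaps_local_word[OF assms(1)] .
  show "map (\<lambda>t. edge p (root t)) ts = map (\<lambda>t. edge p (root t)) ts'"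
    using lo[of p] assms(2,3) by (simp add: local_word_forest_root)
  fix t t' assume "t \<in> set ts" "t' \<in> set ts'" "root t = root t'"
  with assms local_orders_forest_word[of p ts t] local_orders_forest_word[of p ts' t']
  show "t = t'"
    by (intro local_orders_unique[of "\<lambda>x. local_word x (forest_word p ts)" p])
      (auto simp: lo set_forest_nodes dest: distinct_nodes_subtree)
qed

section \<open>Every labeling of a tree is equivalent to a plane forest word\<close>

lemma reroot_branch:
  assumes "t \<in> set ts" "y \<in> set (nodes t)" "distinct (x # forest_nodes ts)"
  shows "\<exists>ts'. swap_step\<^sup>*\<^sup>* (forest_word x ts) (forest_word y ts') \<and>
    distinct (y # forest_nodes ts') \<and> set (y # forest_nodes ts') = set (x # forest_nodes ts)"
  using assms
proof (induction t arbitrary: x ts)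
  case (Node v b c)
  obtain bs cs where ts: "ts = bs @ Node v b c # cs"
    using Node.prems(1) by (meson split_list)
  \<comment> \<open>The edge between \<open>x\<close> and \<open>v\<close> is reversed. The word
    runs through \<open>bs\<close>, \<open>b\<close>, this edge, \<open>c\<close>,
    \<open>cs\<close>; branches at \<open>x\<close> are disjoint from branches at \<open>v\<close>,
    so it can be reordered as \<open>b\<close>, \<open>bs\<close>, edge, \<open>cs\<close>,
    \<open>c\<close>, the word of a forest at \<open>v\<close> with \<open>x\<close> as a
    child.\<close>
  define ts' where "ts' = b @ Node x bs cs # c"
  have "box_vertices (set (forest_word x bs)) \<inter> box_vertices (set (forest_word v b)) = {}"
    "box_vertices (set (forest_word v c)) \<inter> box_vertices (set (forest_word x cs)) = {}"
    using Node.prems(3) by (auto simp: ts box_vertices_forest_word)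
  from swaps_append[OF swaps_commute[OF this(1)]
      swaps_append[OF rtranclp.rtrancl_refl[of _ "[edge x v]"] swaps_commute[OF this(2)]]]
  have sw: "swap_step\<^sup>*\<^sup>* (forest_word x ts) (forest_word v ts')"
    by (simp add: ts ts'_def edge_commute)
  have d: "distinct (v # forest_nodes ts')" "set (v # forest_nodes ts') = set (x # forest_nodes ts)"
    using Node.prems(3) by (auto simp: ts ts'_def)
  show ?case
  proof (cases "y = v")
    case False
    then consider s where "s \<in> set b" "y \<in> set (nodes s)" | s where "s \<in> set c" "y \<in> set (nodes s)"
      using Node.prems(2) by (auto simp: set_forest_nodes)
    then obtain ts'' where "swap_step\<^sup>*\<^sup>* (forest_word v ts') (forest_word y ts'')"
      "distinct (y # forest_nodes ts'')" "set (y # forest_nodes ts'') = set (v # forest_nodes ts')"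
    proof cases
      case 1
      have "s \<in> set ts'" using 1 by (simp add: ts'_def)
      from Node.IH(1)[OF 1(1) this 1(2) d(1)] that show ?thesis by blast
    next
      case 2
      have "s \<in> set ts'" using 2 by (simp add: ts'_def)
      from Node.IH(2)[OF 2(1) this 2(2) d(1)] that show ?thesis by blast
    qed
    then show ?thesis
      using swaps_trans[OF sw] unfolding d(2) by blast
  qed (use sw d in blast)
qed

lemma reroot:
  assumes "y \<in> set (x # forest_nodes ts)" "distinct (x # forest_nodes ts)"
  shows "\<exists>ts'. swap_step\<^sup>*\<^sup>* (forest_word x ts) (forest_word y ts') \<and>
    distinct (y # forest_nodes ts') \<and> set (y # forest_nodes ts') = set (x # forest_nodes ts)"
proof (cases "y = x")
  case False
  then obtain t where "t \<in> set ts" "y \<in> set (nodes t)"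
    using assms(1) by (auto simp: set_forest_nodes)
  then show ?thesis using assms(2) by (rule reroot_branch)
next
  case True
  then show ?thesis
    using assms(2) by (intro exI[of _ ts]) simp
qed

lemma edge_box_adj: "edge x y \<in> D \<Longrightarrow> box_adj D x y"
  by (auto simp: box_adj_def edge_def min_def max_def split: if_splits)

lemma branch_path:
  assumes "y \<in> set (nodes t)" "distinct (nodes t)" "set (branch_word p t) \<subseteq> D"
  shows "\<exists>xs. xs \<noteq> [] \<and> hd xs = root t \<and> last xs = y \<and> distinct xs \<and> set xs \<subseteq> set (nodes t) \<and>
    successively (box_adj D) xs"
  using assms
proof (induction t arbitrary: p)
  case (Node v bs cs)
  show ?case
  proof (cases "y = v")
    case True
    then show ?thesis by (intro exI[of _ "[v]"]) auto
  next
    case False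
    then obtain t where t: "t \<in> set bs \<or> t \<in> set cs" "y \<in> set (nodes t)"
      using Node.prems(1) by (auto simp: set_forest_nodes)
    then have sub: "set (branch_word v t) \<subseteq> D" "set (nodes t) \<subseteq> set (nodes (Node v bs cs))"
      "v \<notin> set (nodes t)" "distinct (nodes t)"
      using Node.prems(2,3) by (auto simp: set_forest_word set_forest_nodes dest: distinct_nodes_subtree)
    then obtain xs where xs: "xs \<noteq> []" "hd xs = root t" "last xs = y" "distinct xs"
      "set xs \<subseteq> set (nodes t)" "successively (box_adj D) xs"
      using t(1) Node.IH(1)[of t, OF _ t(2) sub(4,1)] Node.IH(2)[of t, OF _ t(2) sub(4,1)] by auto
    have "edge v (root t) \<in> D"
      using sub(1) by (cases t) auto
    then have "successively (box_adj D) (v # xs)"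
      using xs by (cases xs) (auto intro: edge_box_adj)
    then show ?thesis
      using xs sub by (intro exI[of _ "v # xs"]) auto
  qed
qed

lemma box_cycleI:
  assumes "successively (box_adj D) xs" "box_adj D (last xs) (hd xs)" "distinct xs" "length xs \<ge> 3"
  shows "box_cycle D xs"
  unfolding box_cycle_def
proof (intro conjI allI impI)
  fix k assume k: "k < length xs"
  show "box_adj D (xs ! k) (xs ! (Suc k mod length xs))"
  proof (cases "Suc k < length xs")
    case True
    then show ?thesis using assms(1) by (simp add: successively_conv_nth)
  next
    case False
    then have "Suc k = length xs" using k by simp
    then have "k = length xs - 1" "Suc k mod length xs = 0" "xs \<noteq> []"
      using k by auto
    then have "xs ! k = last xs" "xs ! (Suc k mod length xs) = hd xs"
      by (simp_all add: last_conv_nth hd_conv_nth)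
    then show ?thesis using assms(2) by simp
  qed
qed (use assms in auto)

text \<open>Inside the branch containing \<open>y\<close> a path leads from a child of
  \<open>x\<close> to \<open>y\<close>. As \<open>edge x y\<close> is no letter, \<open>y\<close> is
  not that child, so path, \<open>x\<close> and chord form a cycle with at least three
  vertices.\<close>

lemma forest_chord_cycle:
  assumes "distinct (x # forest_nodes ts)" "y \<in> set (forest_nodes ts)"
    and "edge x y \<notin> set (forest_word x ts)"
  shows "\<exists>xs. box_cycle (insert (edge x y) (set (forest_word x ts))) xs"
proof -
  let ?D = "insert (edge x y) (set (forest_word x ts))"
  obtain t where t: "t \<in> set ts" "y \<in> set (nodes t)"
    using assms(2) by (auto simp: set_forest_nodes)
  have "set (branch_word x t) \<subseteq> ?D"
    using t by (auto simp: set_forest_word)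
  then obtain xs where xs: "xs \<noteq> []" "hd xs = root t" "last xs = y" "distinct xs"
      "set xs \<subseteq> set (nodes t)" "successively (box_adj ?D) xs"
    using branch_path[of y t x ?D] t assms(1) distinct_nodes_subtree[of ts t] by auto
  have "edge x (root t) \<in> set (branch_word x t)"
    by (cases t) simp
  then have rt: "edge x (root t) \<in> set (forest_word x ts)"
    using t(1) unfolding set_forest_word by blast
  then have "y \<noteq> root t" using assms(3) by auto
  then have "length xs \<ge> 2"
    using xs by (cases xs; cases "tl xs") auto
  moreover have "successively (box_adj ?D) (x # xs)"
    using xs rt by (cases xs) (auto intro: edge_box_adj)
  moreover have "box_adj ?D y x"
    by (rule edge_box_adj) (simp add: edge_commute)
  moreover have "x \<notin> set xs"
    using xs(5) t(1) assms(1) by (auto simp: set_forest_nodes)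
  ultimately show ?thesis
    using xs by (intro exI[of _ "x # xs"] box_cycleI) auto
qed

lemma box_cycle_mono: "box_cycle D xs \<Longrightarrow> D \<subseteq> D' \<Longrightarrow> box_cycle D' xs"
  unfolding box_cycle_def box_adj_def by blast

text \<open>The last letter is removed and the components of its two ends are joined. Removing a
  letter destroys connectedness, so the induction is run for the component of an arbitrary
  \<open>x\<close>, with a disjoint remainder \<open>r\<close>.\<close>

lemma forest_component:
  assumes "\<And>e. e \<in> set u \<Longrightarrow> fst e < snd e" "distinct u" "\<nexists>xs. box_cycle (set u) xs"
  shows "\<exists>ts r. swap_step\<^sup>*\<^sup>* u (forest_word x ts @ r) \<and> distinct (x # forest_nodes ts) \<and>
    box_vertices (set r) \<inter> set (x # forest_nodes ts) = {}"
  using assms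
proof (induction u arbitrary: x rule: measure_induct_rule[of length])
  case (less u)
  have IH: "\<exists>ts r. swap_step\<^sup>*\<^sup>* v (forest_word x ts @ r) \<and> distinct (x # forest_nodes ts) \<and>
    box_vertices (set r) \<inter> set (x # forest_nodes ts) = {}"
    if v: "length v < length u" "set v \<subseteq> set u" "distinct v" for v x
  proof (rule less.IH[OF v(1) _ v(3)])
    show "fst e < snd e" if "e \<in> set v" for e
      using less.prems(1) v(2) that by blast
    show "\<nexists>xs. box_cycle (set v) xs"
      using less.prems(3) box_cycle_mono[OF _ v(2)] by blast
  qed
  show ?case
  proof (cases u rule: rev_cases)
    case Nil
    then show ?thesis by (intro exI[of _ "[]"]) simp
  next
    case (snoc u0 e)
    obtain y z where e: "e = edge y z" "y \<noteq> z"
      using less.prems(1)[of e] snoc that[of "fst e" "snd e"] by (simp add: edge_def)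
    obtain ts1 r1 where 1: "swap_step\<^sup>*\<^sup>* u0 (forest_word y ts1 @ r1)" "distinct (y # forest_nodes ts1)"
      "box_vertices (set r1) \<inter> set (y # forest_nodes ts1) = {}"
      using IH[of u0 y] snoc less.prems(2) by auto
    have set_u0: "set u0 = set (forest_word y ts1) \<union> set r1"
      using swaps_set[OF 1(1)] by simp
    have z: "z \<notin> set (forest_nodes ts1)"
    proof
      assume "z \<in> set (forest_nodes ts1)"
      moreover have "edge y z \<notin> set (forest_word y ts1)"
        using \<open>distinct u\<close> set_u0 snoc e by auto
      ultimately obtain xs where "box_cycle (insert e (set (forest_word y ts1))) xs"
        using forest_chord_cycle[OF 1(2)] unfolding e by blast
      then have "box_cycle (set u) xs"
        by (rule box_cycle_mono) (use set_u0 snoc in auto)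
      then show False using \<open>\<nexists>xs. box_cycle (set u) xs\<close> by blast
    qed
    obtain ts2 r2 where 2: "swap_step\<^sup>*\<^sup>* r1 (forest_word z ts2 @ r2)" "distinct (z # forest_nodes ts2)"
      "box_vertices (set r2) \<inter> set (z # forest_nodes ts2) = {}"
      using IH[of r1 z] snoc swaps_length[OF 1(1)] set_u0 swaps_distinct[OF 1(1)] \<open>distinct u\<close> by auto
    have bv1: "box_vertices (set r1) = box_vertices (set (forest_word z ts2)) \<union> box_vertices (set r2)"
      using swaps_set[OF 2(1)] by simp
    \<comment> \<open>The joining letter ends \<open>u\<close> and so comes after all other edges at
      \<open>y\<close> and at \<open>z\<close>: the branch of \<open>z\<close> is the last one at
      \<open>y\<close>, and its \<open>post\<close> list is empty.\<close>
    define T where "T = ts1 @ [Node z ts2 []]"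
    have disj: "set (forest_nodes ts2) \<inter> set (y # forest_nodes ts1) = {}"
      using 1(3) bv1 by (auto simp: box_vertices_forest_word split: if_splits)
    have T: "distinct (y # forest_nodes T)" "box_vertices (set r2) \<inter> set (y # forest_nodes T) = {}"
      using 1(2,3) 2(2,3) z e(2) disj bv1 by (auto simp: T_def)
    have "swap_step\<^sup>*\<^sup>* (r2 @ [e]) ([e] @ r2)"
      by (rule swaps_commute) (use T(2) in \<open>auto simp: T_def e\<close>)
    from swaps_append[OF rtranclp.rtrancl_refl[of _ "forest_word y ts1 @ forest_word z ts2"] this]
      swaps_append[OF 1(1) rtranclp.rtrancl_refl[of _ "[e]"]]
      swaps_context[OF 2(1), of "forest_word y ts1" "[e]"]
    have u: "swap_step\<^sup>*\<^sup>* u (forest_word y T @ r2)"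
      by (simp add: T_def snoc e)
    \<comment> \<open>Either \<open>x\<close> lies in the joined component, which is then rerooted,
      or the induction hypothesis applies to the remaining letters.\<close>
    show ?thesis
    proof (cases "x \<in> set (y # forest_nodes T)")
      case True
      then obtain ts' where "swap_step\<^sup>*\<^sup>* (forest_word y T) (forest_word x ts')"
        "distinct (x # forest_nodes ts')" "set (x # forest_nodes ts') = set (y # forest_nodes T)"
        using reroot[OF True T(1)] by blast
      with T(2) swaps_trans[OF u swaps_append[OF this(1) rtranclp.rtrancl_refl[of _ r2]]]
      show ?thesis by (intro exI[of _ ts'] exI[of _ r2]) simp
    next
      case False
      have "length r2 < length u" "set r2 \<subseteq> set u" "distinct r2"
        using swaps_length[OF u] swaps_set[OF u] swaps_distinct[OF u] \<open>distinct u\<close>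
        by (auto simp: T_def)
      from IH[OF this] obtain ts3 r3 where
        3: "swap_step\<^sup>*\<^sup>* r2 (forest_word x ts3 @ r3)" "distinct (x # forest_nodes ts3)"
        "box_vertices (set r3) \<inter> set (x # forest_nodes ts3) = {}" by blast
      have bv2: "box_vertices (set r2) = box_vertices (set (forest_word x ts3)) \<union> box_vertices (set r3)"
        using swaps_set[OF 3(1)] by simp
      have "box_vertices (set (forest_word y T)) \<inter> box_vertices (set (forest_word x ts3)) = {}"
        using T(2) bv2 box_vertices_forest_word[of y T] by (auto split: if_splits)
      from swaps_append[OF swaps_commute[OF this] rtranclp.rtrancl_refl[of _ r3]]
        swaps_append[OF rtranclp.rtrancl_refl[of _ "forest_word y T"] 3(1)] u
      have "swap_step\<^sup>*\<^sup>* u (forest_word x ts3 @ (forest_word y T @ r3))"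
        by simp
      moreover have "set (y # forest_nodes T) \<inter> set (x # forest_nodes ts3) = {}"
        using T(2) bv2 False box_vertices_forest_word[of x ts3] by (auto split: if_splits)
      then have "box_vertices (set (forest_word y T @ r3)) \<inter> set (x # forest_nodes ts3) = {}"
        using 3(3) box_vertices_forest_word[of y T] by (auto split: if_splits)
      ultimately show ?thesis using 3(2) by blast
    qed
  qed
qed

lemma box_vertices_eq_empty_iff: "box_vertices D = {} \<longleftrightarrow> D = {}"
  by (auto simp: box_vertices_def)

text \<open>Adjacency never leads out of the component found by \<open>forest_component\<close>, so
  connectedness makes the remainder empty.\<close>

lemma connected_tree_forest:
  assumes "connected_tree n c D" "x \<in> box_vertices D" "u \<in> permutations_of_set D"
  shows "\<exists>ts. swap_step\<^sup>*\<^sup>* u (forest_word x ts) \<and> distinct (x # forest_nodes ts)"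
proof -
  have u: "set u = D" "distinct u"
    using assms(3) by (auto simp: permutations_of_set_def)
  have "fst e < snd e" if "e \<in> set u" for e
    using assms(1) that u by (fastforce simp: connected_tree_def)
  with u assms(1) obtain ts r where ts: "swap_step\<^sup>*\<^sup>* u (forest_word x ts @ r)"
    "distinct (x # forest_nodes ts)" "box_vertices (set r) \<inter> set (x # forest_nodes ts) = {}"
    using forest_component[of u x] unfolding connected_tree_def by blast
  have D: "D = set (forest_word x ts) \<union> set r"
    using swaps_set[OF ts(1)] u by simp
  have step: "z \<in> set (x # forest_nodes ts)"
    if "y \<in> set (x # forest_nodes ts)" "box_adj D y z" for y z
  proof -
    have "(y, z) \<notin> set r" "(z, y) \<notin> set r"
      using that(1) ts(3) by (force simp: box_vertices_def)+
    then have "z \<in> box_vertices (set (forest_word x ts))"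
      using that(2) by (force simp: box_adj_def D box_vertices_def)
    then show ?thesis by (auto simp: box_vertices_forest_word split: if_splits)
  qed
  have "y \<in> set (x # forest_nodes ts)" if "y \<in> box_vertices D" for y
  proof -
    have "(box_adj D)\<^sup>*\<^sup>* x y"
      using assms(1,2) that by (auto simp: connected_tree_def)
    then show ?thesis
      by (induction rule: rtranclp_induct) (use step in auto)
  qed
  then have "box_vertices (set r) = {}"
    using ts(3) D by auto
  then have "r = []"
    by (simp add: box_vertices_eq_empty_iff)
  then show ?thesis using ts by auto
qed

text \<open>A cycle through the new vertex \<open>x\<close> would enter and leave it through its
  only neighbour \<open>v\<close>, but in a cycle of length at least three the two neighbours of a
  vertex differ. A cycle that avoids \<open>x\<close> lies in \<open>D\<close>.\<close>

lemma acyclic_insert_leaf: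
  assumes "\<nexists>xs. box_cycle D xs" "x \<notin> box_vertices D" "x \<noteq> v"
  shows "\<nexists>xs. box_cycle (insert (edge v x) D) xs"
proof
  let ?D = "insert (edge v x) D"
  assume "\<exists>xs. box_cycle ?D xs"
  then obtain xs where xs: "length xs \<ge> 3" "distinct xs"
    and adj: "\<And>k. k < length xs \<Longrightarrow> box_adj ?D (xs ! k) (xs ! (Suc k mod length xs))"
    by (auto simp: box_cycle_def)
  have old: "box_adj D y z" if "box_adj ?D y z" "y \<noteq> x" "z \<noteq> x" for y z
    using that by (auto simp: box_adj_def edge_def min_def max_def split: if_splits)
  have new: "y = v" if "box_adj ?D x y \<or> box_adj ?D y x" for y
    using that assms(2,3)
    by (force simp: box_adj_def box_vertices_def edge_def min_def max_def split: if_splits)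
  show False
  proof (cases "x \<in> set xs")
    case False
    have "box_adj D (xs ! k) (xs ! (Suc k mod length xs))" if "k < length xs" for k
    proof (rule old[OF adj[OF that]])
      show "xs ! k \<noteq> x" using that False by (metis nth_mem)
      have "Suc k mod length xs < length xs" using that by (intro mod_less_divisor) linarith
      then show "xs ! (Suc k mod length xs) \<noteq> x" using False by (metis nth_mem)
    qed
    with xs have "box_cycle D xs" unfolding box_cycle_def by blast
    then show False using assms(1) by blast
  next
    case True
    then obtain k where k: "k < length xs" "xs ! k = x" unfolding in_set_conv_nth by blast
    let ?s = "Suc k mod length xs" and ?p = "if k = 0 then length xs - 1 else k - 1"
    have p: "?p < length xs" "Suc ?p mod length xs = k"
      using k(1) by (cases k; simp)+
    have s: "?s < length xs" using k(1) by (intro mod_less_divisor) linarith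
    have "xs ! ?s = v"
      by (rule new) (use adj[OF k(1)] k(2) in simp)
    moreover have "xs ! ?p = v"
      by (rule new) (use adj[OF p(1)] in \<open>simp only: p(2) k(2), blast\<close>)
    ultimately have "?s = ?p"
      using nth_eq_iff_index_eq[OF xs(2) s p(1)] by simp
    moreover have "?s \<noteq> ?p"
      using xs(1) k(1) by (cases "Suc k = length xs") auto
    ultimately show False by blast
  qed
qed

text \<open>If the edge to the parent is added first, and only then the edges below it, every node
  arrives as a new leaf. This is not the order of the word, so the set \<open>D\<close> of edges
  already present has to vary in the induction.\<close>

lemma acyclic_branch:
  assumes "\<nexists>xs. box_cycle D xs" "set (nodes t) \<inter> insert p (box_vertices D) = {}" "distinct (nodes t)"
  shows "\<nexists>xs. box_cycle (D \<union> set (branch_word p t)) xs"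
  using assms
proof (induction t arbitrary: p D)
  case (Node v bs cs)
  have step: "\<nexists>xs. box_cycle (D \<union> set (forest_word v ts)) xs"
    if "\<nexists>xs. box_cycle D xs" "set (forest_nodes ts) \<inter> insert v (box_vertices D) = {}"
      "distinct (forest_nodes ts)" "set ts \<subseteq> set bs \<union> set cs" for D ts
    using that
  proof (induction ts arbitrary: D)
    case (Cons t ts)
    have "t \<in> set bs \<or> t \<in> set cs" "set (nodes t) \<inter> insert v (box_vertices D) = {}"
      "distinct (nodes t)"
      using Cons.prems(2-4) by auto
    then have 1: "\<nexists>xs. box_cycle (D \<union> set (branch_word v t)) xs"
      using Node.IH(1)[of t D v] Node.IH(2)[of t D v] Cons.prems(1) by blast
    have "\<nexists>xs. box_cycle ((D \<union> set (branch_word v t)) \<union> set (forest_word v ts)) xs"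
      by (rule Cons.IH[OF 1])
        (use Cons.prems(2-4) in \<open>auto simp: disjoint_iff box_vertices_branch_word\<close>)
    then show ?case by (simp add: Un_assoc)
  qed simp
  have 1: "\<nexists>xs. box_cycle (insert (edge p v) D) xs"
    by (rule acyclic_insert_leaf[OF Node.prems(1)]) (use Node.prems(2) in auto)
  have 2: "\<nexists>xs. box_cycle (insert (edge p v) D \<union> set (forest_word v bs)) xs"
    by (rule step[OF 1]) (use Node.prems(2,3) in \<open>auto simp: disjoint_iff\<close>)
  have "\<nexists>xs. box_cycle ((insert (edge p v) D \<union> set (forest_word v bs)) \<union> set (forest_word v cs)) xs"
    by (rule step[OF 2])
      (use Node.prems(2,3) in \<open>auto simp: disjoint_iff box_vertices_forest_word split: if_splits\<close>)
  then show ?case by (simp add: Un_assoc)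
qed

lemma acyclic_forest: "distinct (x # forest_nodes ts) \<Longrightarrow> \<nexists>xs. box_cycle (set (forest_word x ts)) xs"
proof -
  assume d: "distinct (x # forest_nodes ts)"
  have e: "\<nexists>xs. box_cycle {} xs"
  proof
    assume "\<exists>xs. box_cycle {} xs"
    then obtain xs :: "int list" where "3 \<le> length xs" "\<forall>k<length xs. False"
      by (auto simp: box_cycle_def box_adj_def)
    then show False by (metis gr_zeroI le_zero_eq zero_neq_numeral)
  qed
  \<comment> \<open>A fresh parent \<open>y\<close> turns the whole forest into one branch, to which
    \<open>acyclic_branch\<close> applies with no edges present.\<close>
  have "set (nodes (Node x ts [])) \<inter> insert y (box_vertices {}) = {}"
    if "y \<notin> set (x # forest_nodes ts)" for y
    using that by simp
  moreover obtain y where "y \<notin> set (x # forest_nodes ts)"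
    using ex_new_if_finite[OF infinite_UNIV_int] by blast
  ultimately have "\<nexists>xs. box_cycle ({} \<union> set (branch_word y (Node x ts []))) xs"
    using d by (intro acyclic_branch e) (simp_all del: nodes_Node, simp)
  moreover have "set (forest_word x ts) \<subseteq> {} \<union> set (branch_word y (Node x ts []))"
    by auto
  ultimately show ?thesis
    using box_cycle_mono by blast
qed

lemma connected_branch:
  "y \<in> set (nodes t) \<Longrightarrow> set (branch_word p t) \<subseteq> D \<Longrightarrow> (box_adj D)\<^sup>*\<^sup>* p y"
proof (induction t arbitrary: p)
  case (Node v bs cs)
  have "edge p v \<in> D" using Node.prems(2) by simp
  from edge_box_adj[OF this] have pv: "(box_adj D)\<^sup>*\<^sup>* p v"
    by (rule r_into_rtranclp)
  show ?case
  proof (cases "y = v")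
    case False
    then obtain t where t: "t \<in> set bs \<or> t \<in> set cs" "y \<in> set (nodes t)"
      using Node.prems(1) by (auto simp: set_forest_nodes)
    then have "set (branch_word v t) \<subseteq> D"
      using Node.prems(2) by (auto simp: set_forest_word)
    then have "(box_adj D)\<^sup>*\<^sup>* v y"
      using Node.IH t by blast
    with pv show ?thesis by (rule rtranclp_trans)
  qed (use pv in simp)
qed

lemma connected_tree_forest_word:
  assumes "ts \<noteq> []" "distinct_residues n (x # forest_nodes ts)"
    and "\<And>i j. (i, j) \<in> set (forest_word x ts) \<Longrightarrow> i \<le> c \<and> c < j"
  shows "connected_tree n c (set (forest_word x ts))"
proof -
  let ?D = "set (forest_word x ts)"
  have V: "box_vertices ?D = set (x # forest_nodes ts)"
    using assms(1) by (simp add: box_vertices_forest_word)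
  have xy: "(box_adj ?D)\<^sup>*\<^sup>* x y" if y: "y \<in> box_vertices ?D" for y
  proof (cases "y = x")
    case False
    then obtain t where t: "t \<in> set ts" "y \<in> set (nodes t)"
      using y unfolding V by (auto simp: set_forest_nodes)
    then show ?thesis
      by (intro connected_branch[of y t]) (auto simp: set_forest_word)
  qed simp
  have "symp (box_adj ?D)\<^sup>*\<^sup>*"
    by (rule symp_rtranclp) (auto simp: symp_def box_adj_def)
  then have "(box_adj ?D)\<^sup>*\<^sup>* y z" if "y \<in> box_vertices ?D" "z \<in> box_vertices ?D" for y z
    using xy[OF that(1)] xy[OF that(2)] by (meson rtranclp_trans sympD)
  moreover have "?D \<noteq> {}"
    using V box_vertices_eq_empty_iff[of ?D] by auto
  moreover have "distinct (x # forest_nodes ts)" "inj_on (\<lambda>x. x mod int n) (box_vertices ?D)"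
    using assms(2) unfolding V by (auto simp: distinct_map)
  ultimately show ?thesis
    using assms(3) acyclic_forest[of x ts] unfolding connected_tree_def by auto
qed

section \<open>Hook labelings\<close>

definition crosses :: "int \<Rightarrow> int \<times> int \<Rightarrow> bool" where
  "crosses c e \<longleftrightarrow> fst e \<le> c \<and> c < snd e"

text \<open>Only local words occur, so the condition is invariant under swaps, unlike being a hook
  labeling. By \<open>hook_labeling_hook_word\<close> and \<open>hook_word_hook_labeling\<close> it
  singles out the classes of words on a tree that contain a hook labeling.\<close>

definition hook_word :: "(int \<times> int) list \<Rightarrow> bool" where
  "hook_word u \<longleftrightarrow>
    (\<forall>e\<in>set u. hd (local_word (fst e) u) = e \<or> last (local_word (snd e) u) = e)"

lemma hook_word_swaps: "swap_step\<^sup>*\<^sup>* u v \<Longrightarrow> hook_word u \<longleftrightarrow> hook_word v"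
  by (simp add: hook_word_def swaps_local_word swaps_set)

lemma local_word_lower:
  assumes "\<And>e. e \<in> set u \<Longrightarrow> crosses c e" "x \<le> c"
  shows "local_word x u = filter (\<lambda>e. fst e = x) u"
  unfolding local_word_def using assms
  by (intro filter_cong) (force simp: crosses_def touches_def)+

lemma local_word_upper:
  assumes "\<And>e. e \<in> set u \<Longrightarrow> crosses c e" "c < x"
  shows "local_word x u = filter (\<lambda>e. snd e = x) u"
  unfolding local_word_def using assms
  by (intro filter_cong) (force simp: crosses_def touches_def)+

text \<open>First coordinates do not repeat in the initial part of a hook labeling, so its letters
  are the first ones at their lower ends. Second coordinates do not repeat in the final part, so its
  letters are the last ones at their upper ends. The cut \<open>c\<close> prevents a vertex from
  being a lower end of one letter and an upper end of another.\<close>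

lemma hook_labeling_hook_word:
  assumes "hook_labeling D v" "\<And>e. e \<in> D \<Longrightarrow> crosses c e"
  shows "hook_word v"
  unfolding hook_word_def
proof
  fix e assume e: "e \<in> set v"
  define l where "l = card (fst ` D)"
  define p q where "p = take (l - 1) v" and "q = drop (l - 1) v"
  have v: "v = p @ q" by (simp add: p_def q_def)
  have D: "set v = D" and p: "distinct (map fst p)" and q: "distinct (map snd q)"
    using assms(1) by (auto simp: hook_labeling_def permutations_of_set_def Let_def p_def q_def l_def)
  have cr: "crosses c f" if "f \<in> set v" for f using assms(2) that D by simp
  consider "e \<in> set p" | "e \<in> set q" using e v by auto
  then show "hd (local_word (fst e) v) = e \<or> last (local_word (snd e) v) = e"
  proof cases
    case 1
    then obtain p1 p2 where p12: "p = p1 @ e # p2" by (meson split_list)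
    have "crosses c f" if "f \<in> set p1" for f
      using cr that by (simp add: v p12)
    then have "local_word (fst e) p1 = filter (\<lambda>f. fst f = fst e) p1"
      using cr[OF e] by (intro local_word_lower) (auto simp: crosses_def)
    also have "\<dots> = []"
    proof -
      have "fst e \<notin> fst ` set p1" using p by (simp add: p12)
      then show ?thesis unfolding filter_empty_conv by (metis image_eqI)
    qed
    finally have "local_word (fst e) p1 = []" .
    then show ?thesis by (simp add: v p12 touches_def)
  next
    case 2
    then obtain q1 q2 where q12: "q = q1 @ e # q2" by (meson split_list)
    have "crosses c f" if "f \<in> set q2" for f
      using cr that by (simp add: v q12)
    then have "local_word (snd e) q2 = filter (\<lambda>f. snd f = snd e) q2"
      using cr[OF e] by (intro local_word_upper) (auto simp: crosses_def)
    also have "\<dots> = []"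
    proof -
      have "snd e \<notin> snd ` set q2" using q by (simp add: q12)
      then show ?thesis unfolding filter_empty_conv by (metis image_eqI)
    qed
    finally have "local_word (snd e) q2 = []" .
    then show ?thesis by (simp add: v q12 touches_def)
  qed
qed

lemma filter_split_hd:
  assumes "distinct W" "\<And>e. e \<in> set W \<Longrightarrow> \<not> P e \<Longrightarrow> e = hd W"
  shows "filter (\<lambda>e. \<not> P e) W @ filter P W = W \<and> length (filter (\<lambda>e. \<not> P e) W) \<le> 1"
proof (cases W)
  case (Cons e W')
  have "P f" if "f \<in> set W'" for f
    using assms that Cons by fastforce
  then have "filter (\<lambda>e. \<not> P e) W' = []" "filter P W' = W'"
    by (auto simp: filter_empty_conv filter_id_conv)
  then show ?thesis by (simp add: Cons)
qed simp

lemma filter_split_last: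
  assumes "distinct W" "\<And>e. e \<in> set W \<Longrightarrow> P e \<longleftrightarrow> e = last W"
  shows "filter (\<lambda>e. \<not> P e) W @ filter P W = W \<and> length (filter P W) \<le> 1"
proof (cases W rule: rev_cases)
  case (snoc W' e)
  have "\<not> P f" if "f \<in> set W'" for f
    using assms that snoc by fastforce
  then have "filter P W' = []" "filter (\<lambda>e. \<not> P e) W' = W'"
    by (auto simp: filter_empty_conv filter_id_conv)
  then show ?thesis using assms(2)[of e] by (simp add: snoc)
qed simp

lemma sort_key_short: "length xs \<le> 1 \<Longrightarrow> sort_key f xs = xs"
  by (cases xs; cases "tl xs") auto

text \<open>Letters that are last at their upper end go to the second part, all others to the first.
  The second part then has one letter for each upper vertex, and the vertex count of a tree leaves
  \<open>l - 1\<close> letters for the first. Sorting the parts preserves local words: at a lower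
  vertex the first part has at most one letter and those of the second have equal sort keys; at an
  upper vertex the roles are exchanged.\<close>

lemma hook_word_hook_labeling:
  assumes "hook_word u" "distinct u" "set u = D" "\<And>e. e \<in> D \<Longrightarrow> crosses c e"
    and card: "card D + 1 = card (fst ` D) + card (snd ` D)"
  shows "\<exists>v. hook_labeling D v \<and> swap_step\<^sup>*\<^sup>* u v"
proof -
  define E where "E = (\<lambda>e. last (local_word (snd e) u) = e)"
  define p q where "p = filter (\<lambda>e. \<not> E e) u" and "q = filter E u"
  define p' q' where "p' = sort_key snd p" and "q' = sort_key fst q"
  have first: "hd (local_word (fst e) u) = e" if "e \<in> set u" "\<not> E e" for e
    using assms(1) that by (auto simp: hook_word_def E_def)
  have cr: "crosses c e" if "e \<in> set u" for e using assms(3,4) that by simp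
  have cr': "crosses c e" if "e \<in> set (p' @ q')" for e
    by (rule cr) (use that in \<open>auto simp: p'_def q'_def p_def q_def\<close>)
  have "local_word x (p' @ q') = local_word x u" for x
  proof (cases "x \<le> c")
    case True
    define W where "W = filter (\<lambda>e. fst e = x) u"
    have Wu: "local_word x u = W"
      unfolding W_def by (rule local_word_lower[OF cr True])
    have "filter (\<lambda>e. \<not> E e) W @ filter E W = W \<and> length (filter (\<lambda>e. \<not> E e) W) \<le> 1"
    proof (rule filter_split_hd)
      show "e = hd W" if "e \<in> set W" "\<not> E e" for e
      proof -
        have "e \<in> set u" "fst e = x" using that(1) by (simp_all add: W_def)
        then show ?thesis using first[of e] that(2) Wu by simp
      qed
    qed (simp add: W_def assms(2))
    moreover have "filter (\<lambda>e. fst e = x) p = filter (\<lambda>e. \<not> E e) W"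
      "filter (\<lambda>e. fst e = x) q = filter E W"
      by (simp_all add: p_def q_def W_def conj_commute)
    ultimately have "filter (\<lambda>e. fst e = x) (p' @ q') = W"
      by (simp add: p'_def q'_def sort_key_stable) (simp add: filter_sort sort_key_short)
    then show ?thesis
      using local_word_lower[OF cr' True] Wu by simp
  next
    case False
    define W where "W = filter (\<lambda>e. snd e = x) u"
    have x: "c < x" using False by simp
    have Wu: "local_word x u = W"
      unfolding W_def by (rule local_word_upper[OF cr x])
    have "filter (\<lambda>e. \<not> E e) W @ filter E W = W \<and> length (filter E W) \<le> 1"
    proof (rule filter_split_last)
      show "E e \<longleftrightarrow> e = last W" if "e \<in> set W" for e
      proof -
        have "snd e = x" using that(1) by (simp add: W_def)
        then show ?thesis unfolding E_def using Wu by auto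
      qed
    qed (simp add: W_def assms(2))
    moreover have "filter (\<lambda>e. snd e = x) p = filter (\<lambda>e. \<not> E e) W"
      "filter (\<lambda>e. snd e = x) q = filter E W"
      by (simp_all add: p_def q_def W_def conj_commute)
    ultimately have "filter (\<lambda>e. snd e = x) (p' @ q') = W"
      by (simp add: p'_def q'_def sort_key_stable) (simp add: filter_sort sort_key_short)
    then show ?thesis
      using local_word_upper[OF cr' x] Wu by simp
  qed
  then have sw: "swap_step\<^sup>*\<^sup>* u (p' @ q')"
    by (intro local_word_swaps) simp
  have "inj_on snd (set q)"
  proof (rule inj_onI)
    fix e f assume "e \<in> set q" "f \<in> set q" and eq: "snd e = snd f"
    then have "last (local_word (snd e) u) = e" "last (local_word (snd f) u) = f"
      by (simp_all add: q_def E_def)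
    then show "e = f" unfolding eq by simp
  qed
  \<comment> \<open>The last letter of \<open>u\<close> at an upper vertex satisfies
    \<open>E\<close>, so no upper vertex is missed.\<close>
  moreover have "snd ` set q = snd ` D"
  proof -
    have "snd e \<in> snd ` set q" if "e \<in> set u" for e
    proof -
      define W where "W = local_word (snd e) u"
      have W: "W = filter (\<lambda>f. snd f = snd e) u"
        unfolding W_def using cr[OF that] by (intro local_word_upper[OF cr]) (auto simp: crosses_def)
      then have "W \<noteq> []" using that by (auto simp: filter_empty_conv)
      then have "last W \<in> set W" by simp
      then have last: "last W \<in> set u" "snd (last W) = snd e" using W by auto
      then have "E (last W)" unfolding E_def by (simp add: W_def)
      with last have "last W \<in> set q" by (simp add: q_def)
      then show ?thesis unfolding last(2)[symmetric] by (rule imageI)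
    qed
    then have "snd ` set u \<subseteq> snd ` set q" by (rule image_subsetI)
    moreover have "snd ` set q \<subseteq> snd ` set u" by (rule image_mono) (simp add: q_def)
    ultimately show ?thesis unfolding assms(3)[symmetric] by (rule subset_antisym[rotated])
  qed
  ultimately have "length q = card (snd ` D)"
    using assms(2) by (metis card_image distinct_card distinct_filter q_def)
  moreover have "length p + length q = card D"
    using assms(2,3) distinct_card[of u] sum_length_filter_compl[of E u] by (simp add: p_def q_def)
  ultimately have len: "length p' = card (fst ` D) - 1"
    using card by (simp add: p'_def)
  have "inj_on fst (set p)"
  proof (rule inj_onI)
    fix e f assume ef: "e \<in> set p" "f \<in> set p" and eq: "fst e = fst f"
    have "hd (local_word (fst e) u) = e"
      by (rule first) (use ef(1) in \<open>simp_all add: p_def\<close>)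
    moreover have "hd (local_word (fst f) u) = f"
      by (rule first) (use ef(2) in \<open>simp_all add: p_def\<close>)
    ultimately show "e = f" unfolding eq by simp
  qed
  then have "distinct (map fst p')" "distinct (map snd q')"
    using assms(2) \<open>inj_on snd (set q)\<close> by (auto simp: distinct_map p'_def q'_def p_def q_def)
  moreover have "p' @ q' \<in> permutations_of_set D"
    using assms(2,3) swaps_set[OF sw] swaps_distinct[OF sw] by (auto simp: permutations_of_set_def)
  ultimately have "hook_labeling D (p' @ q')"
    unfolding hook_labeling_def Let_def len[symmetric] by (simp add: p'_def q'_def)
  with sw show ?thesis by blast
qed

section \<open>Representatives of the Murnaghan-Nakayama classes as plane forests\<close>

definition spanning_forest :: "int \<Rightarrow> int set \<Rightarrow> plane_tree list \<Rightarrow> bool" where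
  "spanning_forest a S ts \<longleftrightarrow> distinct (a # forest_nodes ts) \<and> set (forest_nodes ts) = S"

text \<open>A tree has one edge fewer than vertices, and the cut \<open>c\<close> separates lower
  from upper ends.\<close>

lemma card_forest_word:
  assumes "ts \<noteq> []" "distinct (a # forest_nodes ts)" "\<And>e. e \<in> set (forest_word a ts) \<Longrightarrow> crosses c e"
  shows "card (set (forest_word a ts)) + 1 =
    card (fst ` set (forest_word a ts)) + card (snd ` set (forest_word a ts))"
proof -
  let ?D = "set (forest_word a ts)"
  have "card ?D + 1 = card (box_vertices ?D)"
    using assms(1,2) distinct_card[OF distinct_forest_word[OF assms(2)]]
      distinct_card[of "a # forest_nodes ts"]
    by (simp add: box_vertices_forest_word length_forest_word)
  also have "\<dots> = card (fst ` ?D) + card (snd ` ?D)"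
    unfolding box_vertices_def
  proof (rule card_Un_disjoint)
    have "x \<le> c" if "x \<in> fst ` ?D" for x using assms(3) that by (auto simp: crosses_def)
    moreover have "c < x" if "x \<in> snd ` ?D" for x using assms(3) that by (auto simp: crosses_def)
    ultimately show "fst ` ?D \<inter> snd ` ?D = {}" by (meson disjoint_iff not_le)
  qed simp_all
  finally show ?thesis .
qed

text \<open>A swap class of words on a tree with vertices \<open>insert a S\<close> contains exactly
  one plane forest word rooted at \<open>a\<close>, and if it has a hook labeling, exactly one word
  chosen by \<open>M\<close>. Matching the two gives \<open>\<rho>\<close>, whatever the choice of
  representatives.\<close>

lemma hook_forests_representatives:
  assumes M: "\<And>D. connected_tree n c D \<Longrightarrow> mn_representatives D (M D)"
    and inj: "inj_on (\<lambda>x. x mod int n) (insert a S)" and S: "S \<noteq> {}" "a \<notin> S"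
  defines "F \<equiv> {ts. spanning_forest a S ts \<and> hook_word (forest_word a ts) \<and>
      (\<forall>e\<in>set (forest_word a ts). crosses c e)}"
    and "R \<equiv> {u. connected_tree n c (set u) \<and> u \<in> M (set u) \<and> box_vertices (set u) = insert a S}"
  shows "\<exists>\<rho>. bij_betw \<rho> F R \<and> (\<forall>ts\<in>F. swap_step\<^sup>*\<^sup>* (forest_word a ts) (\<rho> ts))"
proof -
  have "\<exists>u. u \<in> R \<and> swap_step\<^sup>*\<^sup>* (forest_word a ts) u" if ts: "ts \<in> F" for ts
  proof -
    let ?D = "set (forest_word a ts)"
    have sp: "distinct (a # forest_nodes ts)" "set (forest_nodes ts) = S" "hook_word (forest_word a ts)"
      "\<And>e. e \<in> ?D \<Longrightarrow> crosses c e"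
      using ts by (auto simp: F_def spanning_forest_def)
    have ne: "ts \<noteq> []" using sp(2) S(1) by auto
    have "distinct_residues n (a # forest_nodes ts)"
      using sp(1,2) inj unfolding distinct_map by simp
    then have conn: "connected_tree n c ?D"
      using ne sp(4) by (intro connected_tree_forest_word) (auto simp: crosses_def)
    obtain v where v: "hook_labeling ?D v" "swap_step\<^sup>*\<^sup>* (forest_word a ts) v"
      using hook_word_hook_labeling[OF sp(3) distinct_forest_word[OF sp(1)] refl sp(4)
          card_forest_word[OF ne sp(1) sp(4)]] by blast
    then obtain u where u: "u \<in> M ?D" "swap_step\<^sup>*\<^sup>* u v"
      using M[OF conn] unfolding mn_representatives_def by blast
    have "set u = ?D" using swaps_set[OF u(2)] swaps_set[OF v(2)] by simp
    moreover have "box_vertices ?D = insert a S"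
      using ne sp(2) by (simp add: box_vertices_forest_word)
    ultimately have "u \<in> R" using u conn by (simp add: R_def)
    moreover have "swap_step\<^sup>*\<^sup>* (forest_word a ts) u"
      using swaps_trans[OF v(2) swaps_sym[OF u(2)]] .
    ultimately show ?thesis by blast
  qed
  then obtain \<rho> where \<rho>: "\<And>ts. ts \<in> F \<Longrightarrow> \<rho> ts \<in> R"
    "\<And>ts. ts \<in> F \<Longrightarrow> swap_step\<^sup>*\<^sup>* (forest_word a ts) (\<rho> ts)"
    by metis
  have "inj_on \<rho> F"
  proof (rule inj_onI)
    fix ts ts' assume ts: "ts \<in> F" "ts' \<in> F" and eq: "\<rho> ts = \<rho> ts'"
    have "swap_step\<^sup>*\<^sup>* (forest_word a ts) (forest_word a ts')"
      using swaps_trans[OF \<rho>(2)[OF ts(1)] swaps_sym[OF \<rho>(2)[OF ts(2), folded eq]]] .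
    then show "ts = ts'"
      using ts by (intro forest_word_swaps_unique[of a]) (auto simp: F_def spanning_forest_def)
  qed
  moreover have "u \<in> \<rho> ` F" if u: "u \<in> R" for u
  proof -
    let ?D = "set u"
    have conn: "connected_tree n c ?D" and uM: "u \<in> M ?D" and bv: "box_vertices ?D = insert a S"
      using u by (auto simp: R_def)
    have rep: "mn_representatives ?D (M ?D)" using M[OF conn] .
    then have perm: "u \<in> permutations_of_set ?D" using uM by (auto simp: mn_representatives_def)
    have cr: "crosses c e" if "e \<in> ?D" for e
      using conn that by (cases e) (auto simp: connected_tree_def crosses_def)
    obtain ts where ts: "swap_step\<^sup>*\<^sup>* u (forest_word a ts)" "distinct (a # forest_nodes ts)"
      using connected_tree_forest[OF conn _ perm, of a] bv by auto
    have setw: "set (forest_word a ts) = ?D" using swaps_set[OF ts(1)] by simp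
    obtain v where v: "hook_labeling ?D v" "swap_step\<^sup>*\<^sup>* u v"
      using rep uM by (auto simp: mn_representatives_def)
    have "hook_word v" using hook_labeling_hook_word[OF v(1) cr] .
    then have "hook_word (forest_word a ts)"
      using hook_word_swaps[OF v(2)] hook_word_swaps[OF ts(1)] by simp
    moreover have "set (forest_nodes ts) = S"
    proof -
      have "insert a (set (forest_nodes ts)) = insert a S \<or> insert a S = {}"
        using bv setw box_vertices_forest_word[of a ts] by (auto split: if_splits)
      then show ?thesis using ts(2) S(2) by auto
    qed
    ultimately have F: "ts \<in> F"
      using ts(2) cr setw by (auto simp: F_def spanning_forest_def)
    have "swap_step\<^sup>*\<^sup>* (\<rho> ts) v"
      using swaps_trans[OF swaps_sym[OF \<rho>(2)[OF F]] swaps_trans[OF swaps_sym[OF ts(1)] v(2)]] .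
    moreover have "\<rho> ts \<in> M ?D"
      using \<rho>(1)[OF F] swaps_set[OF \<rho>(2)[OF F]] setw by (auto simp: R_def)
    ultimately have "\<rho> ts = u"
      using rep v uM unfolding mn_representatives_def by blast
    then show ?thesis using F by blast
  qed
  ultimately have "bij_betw \<rho> F R"
    using \<rho>(1) by (auto simp: bij_betw_def)
  then show ?thesis using \<rho>(2) by blast
qed

text \<open>The edge from \<open>v\<close> to its parent is left out, as it also depends on the
  position of the branch at the parent. If \<open>v\<close> is above \<open>a\<close>, the edge to a
  child \<open>t\<close> is first at its lower end iff \<open>pre t = []\<close>, and last at
  \<open>v\<close> iff \<open>t\<close> ends \<open>cs\<close>. If \<open>v\<close> is below
  \<open>a\<close>, the edge is last at its upper end iff \<open>post t = []\<close>, and first at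
  \<open>v\<close> iff \<open>t\<close> heads \<open>bs\<close>. The uses of \<open>butlast\<close>
  and \<open>tl\<close> exempt just these two extremal children.\<close>

fun hook_tree :: "int \<Rightarrow> plane_tree \<Rightarrow> bool" where
  "hook_tree a (Node v bs cs) \<longleftrightarrow>
    (\<forall>t\<in>set bs. hook_tree a t \<and> (root t < a \<longleftrightarrow> a < v)) \<and>
    (\<forall>t\<in>set cs. hook_tree a t \<and> (root t < a \<longleftrightarrow> a < v)) \<and>
    (if a < v then \<forall>t\<in>set bs \<union> set (butlast cs). pre t = []
     else \<forall>t\<in>set (tl bs) \<union> set cs. post t = [])"

definition inner_letters :: "plane_tree \<Rightarrow> (int \<times> int) set" where
  "inner_letters t = set (forest_word (root t) (pre t)) \<union> set (forest_word (root t) (post t))"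

lemma set_branch_word: "set (branch_word p t) = insert (edge p (root t)) (inner_letters t)"
  by (cases t) (auto simp: inner_letters_def)

lemma inner_letters_Node:
  "inner_letters (Node v bs cs) =
    (\<Union>t\<in>set bs \<union> set cs. insert (edge v (root t)) (inner_letters t))"
  unfolding inner_letters_def[of "Node v bs cs"] by (auto simp: set_forest_word set_branch_word)

lemma distinct_roots: "distinct (forest_nodes ts) \<Longrightarrow> distinct (map root ts)"
proof (induction ts)
  case (Cons t ts)
  have "root t \<notin> root ` set ts"
  proof
    assume "root t \<in> root ` set ts"
    then obtain s where "s \<in> set ts" "root t = root s" by auto
    then have "root t \<in> set (forest_nodes ts)"
      unfolding set_forest_nodes using root_in_nodes[of s] by (intro UN_I[of s]) simp_all
    moreover have "set (nodes t) \<inter> set (forest_nodes ts) = {}" using Cons.prems by simp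
    ultimately show False using root_in_nodes[of t] by blast
  qed
  then show ?case using Cons by simp
qed simp

lemma edge_less: "x < y \<Longrightarrow> edge x y = (x, y)" "y < x \<Longrightarrow> edge x y = (y, x)"
  by (auto simp: edge_def)

text \<open>The cuts \<open>a\<close> and \<open>a - 1\<close> are separated by no vertex other than
  \<open>a\<close>; on edges avoiding \<open>a\<close> both ask for ends on opposite sides of
  \<open>a\<close>. So one notion of \<open>hook_tree\<close> serves both Murnaghan-Nakayama
  elements.\<close>

lemma crosses_edge_iff:
  assumes "c = a \<or> c = a - 1" "v \<noteq> a" "r \<noteq> a"
  shows "crosses c (edge v r) \<longleftrightarrow> (r < a \<longleftrightarrow> a < v)"
  using assms by (auto simp: crosses_def edge_def min_def max_def)

lemma hd_local_order:
  assumes "p \<notin> set (map root bs)"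
  shows "hd (map (\<lambda>t. edge v (root t)) bs @ edge p v # es) = edge p v \<longleftrightarrow> bs = []"
  using assms by (cases bs) (auto simp: edge_commute[of p v])

lemma last_local_order:
  assumes "p \<notin> set (map root cs)"
  shows "last (es @ edge p v # map (\<lambda>t. edge v (root t)) cs) = edge p v \<longleftrightarrow> cs = []"
  using assms by (cases cs rule: rev_cases) (auto simp: edge_commute[of p v])

lemma last_local_order_child:
  assumes "p \<noteq> r"
  shows "last (es @ edge p v # map (\<lambda>t. edge v (root t)) cs) = edge v r \<longleftrightarrow>
    cs \<noteq> [] \<and> root (last cs) = r"
  using assms by (cases cs rule: rev_cases) (auto simp: edge_commute[of p v])

lemma hd_local_order_child:
  assumes "p \<noteq> r"
  shows "hd (map (\<lambda>t. edge v (root t)) bs @ edge p v # es) = edge v r \<longleftrightarrow>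
    bs \<noteq> [] \<and> root (hd bs) = r"
  using assms by (cases bs) (auto simp: edge_commute[of p v])

text \<open>Different branches have different roots, so the exception for the last root exempts a
  single branch.\<close>

lemma butlast_free_iff:
  assumes "distinct (map root (bs @ cs))"
  shows "(\<forall>s\<in>set bs \<union> set cs. P s \<or> cs \<noteq> [] \<and> root (last cs) = root s) \<longleftrightarrow>
    (\<forall>s\<in>set bs \<union> set (butlast cs). P s)"
  using assms by (cases cs rule: rev_cases) (auto simp: image_iff)

lemma tl_free_iff:
  assumes "distinct (map root (bs @ cs))"
  shows "(\<forall>s\<in>set bs \<union> set cs. P s \<or> bs \<noteq> [] \<and> root (hd bs) = root s) \<longleftrightarrow>
    (\<forall>s\<in>set (tl bs) \<union> set cs. P s)"
  using assms by (cases bs) (auto simp: image_iff)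

definition hooked :: "(int \<Rightarrow> (int \<times> int) list) \<Rightarrow> int \<times> int \<Rightarrow> bool" where
  "hooked lo e \<longleftrightarrow> hd (lo (fst e)) = e \<or> last (lo (snd e)) = e"

lemma hook_tree_iff:
  assumes "local_orders lo p t" "distinct (p # nodes t)" "a \<notin> set (nodes t)" "c = a \<or> c = a - 1"
  shows "hook_tree a t \<longleftrightarrow> (\<forall>e\<in>inner_letters t. crosses c e \<and> hooked lo e)"
  using assms(1-3)
proof (induction t arbitrary: p)
  case (Node v bs cs)
  let ?f = "\<lambda>t. edge v (root t)"
  have lo: "lo v = map ?f bs @ edge p v # map ?f cs"
    using Node.prems(1) by simp
  have dr: "distinct (map root (bs @ cs))"
    using Node.prems(2) distinct_roots[of "bs @ cs"] by simp
  have v: "v \<noteq> a" "v \<noteq> p" using Node.prems by auto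
  have IH: "hook_tree a s \<longleftrightarrow> (\<forall>e\<in>inner_letters s. crosses c e \<and> hooked lo e)"
    if "s \<in> set bs \<union> set cs" for s
  proof -
    have "local_orders lo v s" "distinct (v # nodes s)" "a \<notin> set (nodes s)"
      using that Node.prems by (auto simp: set_forest_nodes dest: distinct_nodes_subtree)
    then show ?thesis using Node.IH(1)[of s v] Node.IH(2)[of s v] that by blast
  qed
  have child: "root s \<noteq> a" "root s \<noteq> v" "p \<noteq> root s" "v \<notin> set (map root (pre s))"
    "v \<notin> set (map root (post s))"
    "lo (root s) = map (\<lambda>t. edge (root s) (root t)) (pre s) @
      edge v (root s) # map (\<lambda>t. edge (root s) (root t)) (post s)"
    if "s \<in> set bs \<union> set cs" for s
  proof -
    have sub: "set (nodes s) \<subseteq> set (forest_nodes bs) \<union> set (forest_nodes cs)"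
      using that by (auto simp: set_forest_nodes)
    then have "root s \<in> set (forest_nodes bs) \<union> set (forest_nodes cs)"
      using root_in_nodes by blast
    then show "root s \<noteq> a" "root s \<noteq> v" "p \<noteq> root s" using Node.prems by auto
    have "root ` (set (pre s) \<union> set (post s)) \<subseteq> set (nodes s)"
      using root_in_nodes by (cases s) (fastforce simp: set_forest_nodes)
    then show "v \<notin> set (map root (pre s))" "v \<notin> set (map root (post s))"
      using sub Node.prems(2) by auto
    show "lo (root s) = map (\<lambda>t. edge (root s) (root t)) (pre s) @
      edge v (root s) # map (\<lambda>t. edge (root s) (root t)) (post s)"
      using that Node.prems(1) by (cases s) auto
  qed
  have up: "hooked lo (edge v (root s)) \<longleftrightarrow> pre s = [] \<or> cs \<noteq> [] \<and> root (last cs) = root s"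
    if s: "s \<in> set bs \<union> set cs" "root s < a" "a < v" for s
  proof -
    have e: "fst (edge v (root s)) = root s" "snd (edge v (root s)) = v"
      using s(2,3) by (simp_all add: edge_less)
    have "hd (lo (root s)) = edge v (root s) \<longleftrightarrow> pre s = []"
      unfolding child(6)[OF s(1)] by (rule hd_local_order[OF child(4)[OF s(1)]])
    moreover have "last (lo v) = edge v (root s) \<longleftrightarrow> cs \<noteq> [] \<and> root (last cs) = root s"
      unfolding lo by (rule last_local_order_child[OF child(3)[OF s(1)]])
    ultimately show ?thesis unfolding hooked_def e by blast
  qed
  have down: "hooked lo (edge v (root s)) \<longleftrightarrow> post s = [] \<or> bs \<noteq> [] \<and> root (hd bs) = root s"
    if s: "s \<in> set bs \<union> set cs" "a < root s" "v < a" for s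
  proof -
    have e: "fst (edge v (root s)) = v" "snd (edge v (root s)) = root s"
      using s(2,3) by (simp_all add: edge_less)
    have "last (lo (root s)) = edge v (root s) \<longleftrightarrow> post s = []"
      unfolding child(6)[OF s(1)] by (rule last_local_order[OF child(5)[OF s(1)]])
    moreover have "hd (lo v) = edge v (root s) \<longleftrightarrow> bs \<noteq> [] \<and> root (hd bs) = root s"
      unfolding lo by (rule hd_local_order_child[OF child(3)[OF s(1)]])
    ultimately show ?thesis unfolding hooked_def e by blast
  qed
  let ?A = "\<forall>s\<in>set bs \<union> set cs. hook_tree a s \<and> (root s < a \<longleftrightarrow> a < v)"
  have "(\<forall>e\<in>inner_letters (Node v bs cs). crosses c e \<and> hooked lo e) \<longleftrightarrow>
    (\<forall>s\<in>set bs \<union> set cs. crosses c (edge v (root s)) \<and> hooked lo (edge v (root s)) \<and> hook_tree a s)"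
    unfolding inner_letters_Node using IH by auto
  also have "\<dots> \<longleftrightarrow> ?A \<and> (\<forall>s\<in>set bs \<union> set cs. hooked lo (edge v (root s)))"
    using crosses_edge_iff[OF assms(4) v(1) child(1)] by blast
  also have "\<dots> \<longleftrightarrow> ?A \<and> (if a < v then \<forall>s\<in>set bs \<union> set (butlast cs). pre s = []
      else \<forall>s\<in>set (tl bs) \<union> set cs. post s = [])"
  proof (rule conj_cong[OF refl])
    assume A: ?A
    show "(\<forall>s\<in>set bs \<union> set cs. hooked lo (edge v (root s))) \<longleftrightarrow>
      (if a < v then \<forall>s\<in>set bs \<union> set (butlast cs). pre s = []
      else \<forall>s\<in>set (tl bs) \<union> set cs. post s = [])"
    proof (cases "a < v")
      case True
      have "(\<forall>s\<in>set bs \<union> set cs. hooked lo (edge v (root s))) \<longleftrightarrow>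
        (\<forall>s\<in>set bs \<union> set cs. pre s = [] \<or> cs \<noteq> [] \<and> root (last cs) = root s)"
        by (rule ball_cong[OF refl], rule up) (use A True in auto)
      then show ?thesis using True butlast_free_iff[OF dr] by simp
    next
      case False
      then have va: "v < a" using v by simp
      have "a < root s" if "s \<in> set bs \<union> set cs" for s
        using A that False child(1)[OF that] by (meson linorder_less_linear)
      then have "(\<forall>s\<in>set bs \<union> set cs. hooked lo (edge v (root s))) \<longleftrightarrow>
        (\<forall>s\<in>set bs \<union> set cs. post s = [] \<or> bs \<noteq> [] \<and> root (hd bs) = root s)"
        by (intro ball_cong[OF refl] down va)
      then show ?thesis using False tl_free_iff[OF dr] by simp
    qed
  qed
  finally show ?case by (simp only: hook_tree.simps) blast
qed

text \<open>Lower and upper trees are the branches counted by \<open>Z\<^sub>L\<close> and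
  \<open>Z\<^sub>R\<close>. The branches of \<open>Y\<^sub>L\<close> satisfy
  \<open>pre t = []\<close> in addition, those of \<open>Y\<^sub>R\<close> satisfy
  \<open>post t = []\<close>; such branches are called free below.\<close>

definition lower_tree :: "int \<Rightarrow> plane_tree \<Rightarrow> bool" where
  "lower_tree a t \<longleftrightarrow> root t < a \<and> hook_tree a t"

definition upper_tree :: "int \<Rightarrow> plane_tree \<Rightarrow> bool" where
  "upper_tree a t \<longleftrightarrow> a < root t \<and> hook_tree a t"

lemma set_forest_word_inner:
  "set (forest_word a ts) = (\<Union>t\<in>set ts. insert (edge a (root t)) (inner_letters t))"
  by (simp add: set_forest_word set_branch_word)

lemma forest_child_orders:
  assumes "distinct (a # forest_nodes ts)" "t \<in> set ts"
  shows "local_word (root t) (forest_word a ts) = map (\<lambda>s. edge (root t) (root s)) (pre t) @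
      edge a (root t) # map (\<lambda>s. edge (root t) (root s)) (post t)"
    and "a \<notin> set (nodes t)" "a \<notin> set (map root (pre t))" "a \<notin> set (map root (post t))"
    and "hook_tree a t \<longleftrightarrow> (\<forall>e\<in>inner_letters t. crosses a e \<and>
      hooked (\<lambda>x. local_word x (forest_word a ts)) e)"
    and "hook_tree a t \<longleftrightarrow> (\<forall>e\<in>inner_letters t. crosses (a - 1) e \<and>
      hooked (\<lambda>x. local_word x (forest_word a ts)) e)"
proof -
  have lo: "local_orders (\<lambda>x. local_word x (forest_word a ts)) a t"
    using local_orders_forest_word[OF assms] .
  then show "local_word (root t) (forest_word a ts) = map (\<lambda>s. edge (root t) (root s)) (pre t) @
      edge a (root t) # map (\<lambda>s. edge (root t) (root s)) (post t)"
    by (cases t) auto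
  show a: "a \<notin> set (nodes t)"
    using assms by (auto simp: set_forest_nodes)
  have "root ` (set (pre t) \<union> set (post t)) \<subseteq> set (nodes t)"
    using root_in_nodes by (cases t) (fastforce simp: set_forest_nodes)
  then show "a \<notin> set (map root (pre t))" "a \<notin> set (map root (post t))"
    using a by auto
  have "distinct (a # nodes t)"
    using a assms by (auto dest: distinct_nodes_subtree)
  from hook_tree_iff[OF lo this a] show
    "hook_tree a t \<longleftrightarrow> (\<forall>e\<in>inner_letters t. crosses a e \<and>
      hooked (\<lambda>x. local_word x (forest_word a ts)) e)"
    "hook_tree a t \<longleftrightarrow> (\<forall>e\<in>inner_letters t. crosses (a - 1) e \<and>
      hooked (\<lambda>x. local_word x (forest_word a ts)) e)"
    by auto
qed

lemma hook_word_hooked: "hook_word u \<longleftrightarrow> (\<forall>e\<in>set u. hooked (\<lambda>x. local_word x u) e)"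
  by (simp add: hook_word_def hooked_def)

text \<open>For the cut \<open>a\<close> the vertex \<open>a\<close> is a lower end, so all branches
  are upper, and only the edge of the first branch is first at \<open>a\<close>. The remaining
  branches must be free, which is the product
  \<open>Z\<^sub>R (1 - Y\<^sub>R)\<^sup>-\<^sup>1\<close>.\<close>

lemma upper_forest_iff:
  assumes "distinct (a # forest_nodes ts)"
  shows "hook_word (forest_word a ts) \<and> (\<forall>e\<in>set (forest_word a ts). crosses a e) \<longleftrightarrow>
    (\<forall>t\<in>set ts. upper_tree a t) \<and> (\<forall>t\<in>set (tl ts). post t = [])"
proof -
  let ?lo = "\<lambda>x. local_word x (forest_word a ts)"
  have lo: "?lo a = map (\<lambda>t. edge a (root t)) ts"
    using assms by (simp add: local_word_forest_root)
  have dr: "distinct (map root ts)"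
    using assms distinct_roots[of ts] by simp
  have hk: "hooked ?lo (edge a (root t)) \<longleftrightarrow> post t = [] \<or> ts \<noteq> [] \<and> root (hd ts) = root t"
    if t: "t \<in> set ts" "a < root t" for t
  proof -
    have e: "fst (edge a (root t)) = a" "snd (edge a (root t)) = root t"
      using t(2) by (simp_all add: edge_less)
    have "hd (?lo a) = edge a (root t) \<longleftrightarrow> root (hd ts) = root t"
      using t(1) unfolding lo by (cases ts) auto
    moreover have "last (?lo (root t)) = edge a (root t) \<longleftrightarrow> post t = []"
      unfolding forest_child_orders(1)[OF assms t(1)]
      by (rule last_local_order[OF forest_child_orders(4)[OF assms t(1)]])
    moreover have "ts \<noteq> []" using t(1) by auto
    ultimately show ?thesis unfolding hooked_def e by blast
  qed
  have cr: "crosses a (edge a r) \<longleftrightarrow> a < r" for r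
    by (auto simp: crosses_def edge_def)
  have "hook_word (forest_word a ts) \<and> (\<forall>e\<in>set (forest_word a ts). crosses a e) \<longleftrightarrow>
    (\<forall>t\<in>set ts. (a < root t \<and> hook_tree a t) \<and> hooked ?lo (edge a (root t)))"
    unfolding hook_word_hooked set_forest_word_inner using forest_child_orders(5)[OF assms] cr by auto
  also have "\<dots> \<longleftrightarrow> (\<forall>t\<in>set ts. upper_tree a t) \<and>
      (\<forall>t\<in>set ts \<union> set []. post t = [] \<or> ts \<noteq> [] \<and> root (hd ts) = root t)"
    using hk unfolding upper_tree_def by auto
  also have "(\<forall>t\<in>set ts \<union> set []. post t = [] \<or> ts \<noteq> [] \<and> root (hd ts) = root t) \<longleftrightarrow>
      (\<forall>t\<in>set (tl ts) \<union> set []. post t = [])"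
    by (rule tl_free_iff) (use dr in simp)
  finally show ?thesis by simp
qed

text \<open>For the cut \<open>a - 1\<close> the vertex \<open>a\<close> is an upper end, and only
  the edge of the last branch is last at \<open>a\<close>. This is the product
  \<open>(1 - Y\<^sub>L)\<^sup>-\<^sup>1 Z\<^sub>L\<close>.\<close>

lemma lower_forest_iff:
  assumes "distinct (a # forest_nodes ts)"
  shows "hook_word (forest_word a ts) \<and> (\<forall>e\<in>set (forest_word a ts). crosses (a - 1) e) \<longleftrightarrow>
    (\<forall>t\<in>set ts. lower_tree a t) \<and> (\<forall>t\<in>set (butlast ts). pre t = [])"
proof -
  let ?lo = "\<lambda>x. local_word x (forest_word a ts)"
  have lo: "?lo a = map (\<lambda>t. edge a (root t)) ts"
    using assms by (simp add: local_word_forest_root)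
  have dr: "distinct (map root ts)"
    using assms distinct_roots[of ts] by simp
  have hk: "hooked ?lo (edge a (root t)) \<longleftrightarrow> pre t = [] \<or> ts \<noteq> [] \<and> root (last ts) = root t"
    if t: "t \<in> set ts" "root t < a" for t
  proof -
    have e: "fst (edge a (root t)) = root t" "snd (edge a (root t)) = a"
      using t(2) by (simp_all add: edge_less)
    have "last (?lo a) = edge a (root t) \<longleftrightarrow> root (last ts) = root t"
      using t(1) unfolding lo by (cases ts rule: rev_cases) auto
    moreover have "hd (?lo (root t)) = edge a (root t) \<longleftrightarrow> pre t = []"
      unfolding forest_child_orders(1)[OF assms t(1)]
      by (rule hd_local_order[OF forest_child_orders(3)[OF assms t(1)]])
    moreover have "ts \<noteq> []" using t(1) by auto
    ultimately show ?thesis unfolding hooked_def e by blast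
  qed
  have cr: "crosses (a - 1) (edge a r) \<longleftrightarrow> r < a" for r
    by (auto simp: crosses_def edge_def)
  have "hook_word (forest_word a ts) \<and> (\<forall>e\<in>set (forest_word a ts). crosses (a - 1) e) \<longleftrightarrow>
    (\<forall>t\<in>set ts. (root t < a \<and> hook_tree a t) \<and> hooked ?lo (edge a (root t)))"
    unfolding hook_word_hooked set_forest_word_inner using forest_child_orders(6)[OF assms] cr by auto
  also have "\<dots> \<longleftrightarrow> (\<forall>t\<in>set ts. lower_tree a t) \<and>
      (\<forall>t\<in>set [] \<union> set ts. pre t = [] \<or> ts \<noteq> [] \<and> root (last ts) = root t)"
    using hk unfolding lower_tree_def by auto
  also have "(\<forall>t\<in>set [] \<union> set ts. pre t = [] \<or> ts \<noteq> [] \<and> root (last ts) = root t) \<longleftrightarrow>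
      (\<forall>t\<in>set [] \<union> set (butlast ts). pre t = [])"
    by (rule butlast_free_iff) (use dr in simp)
  finally show ?thesis by simp
qed

section \<open>The identity for plane forests\<close>

text \<open>The map to words is injective, and the words have \<open>card S\<close> letters from a
  finite alphabet.\<close>

lemma finite_spanning_forests: "finite {ts. spanning_forest a S ts}"
proof (cases "finite S")
  case True
  let ?F = "{ts. spanning_forest a S ts}"
  have "inj_on (forest_word a) ?F"
    by (rule inj_onI, rule forest_word_swaps_unique[of a]) (auto simp: spanning_forest_def)
  moreover have "forest_word a ` ?F \<subseteq> {u. set u \<subseteq> insert a S \<times> insert a S \<and> length u = card S}"
  proof (intro image_subsetI CollectI conjI)
    fix ts assume ts: "ts \<in> ?F"
    have "box_vertices (set (forest_word a ts)) \<subseteq> insert a S"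
      using ts by (auto simp: box_vertices_forest_word spanning_forest_def split: if_splits)
    then show "set (forest_word a ts) \<subseteq> insert a S \<times> insert a S"
      by (force simp: box_vertices_def)
    show "length (forest_word a ts) = card S"
      using ts distinct_card[of "forest_nodes ts"]
      by (auto simp: spanning_forest_def length_forest_word)
  qed
  ultimately show ?thesis
    using finite_lists_length_eq[of "insert a S \<times> insert a S" "card S"] True
    by (meson finite_SigmaI finite_imageD finite_insert finite_subset)
next
  case False
  then have "{ts. spanning_forest a S ts} = {}"
    by (auto simp: spanning_forest_def)
  then show ?thesis by simp
qed

lemma finite_spanning_forest_pairs: "finite {(ls, us). spanning_forest a S (ls @ us)}"
proof (rule finite_subset)
  show "{(ls, us). spanning_forest a S (ls @ us)} \<subseteq>
    (\<Union>ts\<in>{ts. spanning_forest a S ts}. (\<lambda>k. (take k ts, drop k ts)) ` {..length ts})"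
  proof safe
    fix ls us assume "spanning_forest a S (ls @ us)"
    then show "(ls, us) \<in> (\<Union>ts\<in>{ts. spanning_forest a S ts}. (\<lambda>k. (take k ts, drop k ts)) ` {..length ts})"
      by (intro UN_I[of "ls @ us"] image_eqI[of _ _ "length ls"]) auto
  qed
qed (use finite_spanning_forests in auto)

lemma branch_word_less:
  "distinct (p # nodes t) \<Longrightarrow> e \<in> set (branch_word p t) \<Longrightarrow> fst e < snd e"
proof (induction p t rule: branch_word.induct)
  case (1 p v bs cs)
  consider "e = edge p v" | t where "t \<in> set bs" "e \<in> set (branch_word v t)"
    | t where "t \<in> set cs" "e \<in> set (branch_word v t)"
    using 1(4) by (auto simp: set_forest_word)
  then show ?case
  proof cases
    case 1
    then show ?thesis using \<open>distinct (p # nodes (Node v bs cs))\<close> by (auto simp: edge_def)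
  next
    case (2 t)
    then show ?thesis using 1 by (auto simp: set_forest_nodes dest: distinct_nodes_subtree)
  next
    case (3 t)
    then show ?thesis using 1 by (auto simp: set_forest_nodes dest: distinct_nodes_subtree)
  qed
qed

lemma forest_word_less:
  "distinct (p # forest_nodes ts) \<Longrightarrow> e \<in> set (forest_word p ts) \<Longrightarrow> fst e < snd e"
  using branch_word_less
  by (fastforce simp: set_forest_word set_forest_nodes dest: distinct_nodes_subtree)

section \<open>Grafting branches by the triple relations at the root\<close>

definition edge_word :: "int set \<Rightarrow> (int \<times> int) list \<Rightarrow> bool" where
  "edge_word V u \<longleftrightarrow> box_vertices (set u) \<subseteq> V \<and> (\<forall>e\<in>set u. fst e < snd e)"

lemma edge_word_append [simp]: "edge_word V (u @ v) \<longleftrightarrow> edge_word V u \<and> edge_word V v"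
  by (auto simp: edge_word_def)

lemma edge_word_Cons [simp]:
  "edge_word V (e # u) \<longleftrightarrow> fst e \<in> V \<and> snd e \<in> V \<and> fst e < snd e \<and> edge_word V u"
  by (cases e) (auto simp: edge_word_def)

lemma edge_word_Nil [simp]: "edge_word V []"
  by (simp add: edge_word_def)

lemma edge_word_forest:
  "distinct (p # forest_nodes ts) \<Longrightarrow> set (p # forest_nodes ts) \<subseteq> V \<Longrightarrow> edge_word V (forest_word p ts)"
  using forest_word_less by (auto simp: edge_word_def box_vertices_forest_word split: if_splits)

text \<open>Everything the combinatorics takes from the algebra: words have values
  \<open>\<phi>\<close> in an abelian group, and a subgroup \<open>J\<close> contains, in every
  context \<open>p\<close>, \<open>q\<close>, the commutations and the two triple relations whose
  middle vertex is \<open>a\<close>. All letters have their smaller coordinate first, so no signs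
  arise.\<close>

locale tree_relations =
  fixes a :: int and V :: "int set" and \<phi> :: "(int \<times> int) list \<Rightarrow> 'g::ab_group_add" and J :: "'g set"
  assumes a_in_V: "a \<in> V"
    and J_zero: "0 \<in> J" and J_diff: "\<And>x y. x \<in> J \<Longrightarrow> y \<in> J \<Longrightarrow> x - y \<in> J"
    and swap: "\<And>p q i j k l. \<lbrakk>i \<in> V; j \<in> V; k \<in> V; l \<in> V; i < j; k < l; {i, j} \<inter> {k, l} = {}\<rbrakk> \<Longrightarrow>
      \<phi> (p @ [(i, j), (k, l)] @ q) - \<phi> (p @ [(k, l), (i, j)] @ q) \<in> J"
    and triple_lower: "\<And>p q l u. \<lbrakk>l \<in> V; u \<in> V; l < a; a < u\<rbrakk> \<Longrightarrow>
      \<phi> (p @ [(l, a), (a, u)] @ q) - (\<phi> (p @ [(a, u), (l, u)] @ q) + \<phi> (p @ [(l, u), (l, a)] @ q)) \<in> J"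
    and triple_upper: "\<And>p q l u. \<lbrakk>l \<in> V; u \<in> V; l < a; a < u\<rbrakk> \<Longrightarrow>
      \<phi> (p @ [(a, u), (l, a)] @ q) - (\<phi> (p @ [(l, u), (a, u)] @ q) + \<phi> (p @ [(l, a), (l, u)] @ q)) \<in> J"
begin

definition eqv :: "'g \<Rightarrow> 'g \<Rightarrow> bool" (infix \<open>\<asymp>\<close> 50) where
  "x \<asymp> y \<longleftrightarrow> x - y \<in> J"

lemma J_uminus: "x \<in> J \<Longrightarrow> - x \<in> J"
  using J_diff[OF J_zero] by simp

lemma J_add: "x \<in> J \<Longrightarrow> y \<in> J \<Longrightarrow> x + y \<in> J"
  using J_diff[of x "- y"] J_uminus by simp

lemma eqv_refl [simp]: "x \<asymp> x"
  by (simp add: eqv_def J_zero)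

lemma eqv_sym: "x \<asymp> y \<Longrightarrow> y \<asymp> x"
  using J_uminus[of "x - y"] by (simp add: eqv_def)

lemma eqv_trans [trans]: "x \<asymp> y \<Longrightarrow> y \<asymp> z \<Longrightarrow> x \<asymp> z"
  using J_add[of "x - y" "y - z"] by (simp add: eqv_def)

lemma eqv_add: "x \<asymp> y \<Longrightarrow> x' \<asymp> y' \<Longrightarrow> x + x' \<asymp> y + y'"
  using J_add[of "x - y" "x' - y'"] by (simp add: eqv_def algebra_simps)

lemma eqv_diff: "x \<asymp> y \<Longrightarrow> x' \<asymp> y' \<Longrightarrow> x - x' \<asymp> y - y'"
  using J_diff[of "x - y" "x' - y'"] by (simp add: eqv_def algebra_simps)

lemma eqv_sum: "(\<And>x. x \<in> A \<Longrightarrow> f x \<asymp> g x) \<Longrightarrow> sum f A \<asymp> sum g A"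
  by (induction A rule: infinite_finite_induct) (auto intro: eqv_add)

lemma swaps_eqv:
  assumes "swap_step\<^sup>*\<^sup>* u v" "edge_word V u"
  shows "\<phi> (p @ u @ q) \<asymp> \<phi> (p @ v @ q)"
  using assms(1)
proof (induction rule: rtranclp_induct)
  case (step v w)
  have "edge_word V v"
    using assms(2) swaps_set[OF step(1)] by (simp add: edge_word_def)
  with step(2) have "\<phi> (p @ v @ q) \<asymp> \<phi> (p @ w @ q)"
  proof cases
    case (1 i j k l us vs)
    then show ?thesis
      using swap[of i j k l "p @ us" "vs @ q"] \<open>edge_word V v\<close> by (simp add: eqv_def)
  qed
  with step(3) show ?case by (rule eqv_trans)
qed simp

lemma commute_eqv:
  assumes "box_vertices (set u) \<inter> box_vertices (set v) = {}" "edge_word V u" "edge_word V v"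
  shows "\<phi> (p @ u @ v @ q) \<asymp> \<phi> (p @ v @ u @ q)"
  using swaps_eqv[OF swaps_commute[OF assms(1)], of p q] assms(2,3) by simp

text \<open>Nothing at \<open>u\<close> follows its edge to \<open>a\<close> and nothing at
  \<open>l\<close> precedes its own, so the two edges are adjacent and \<open>triple_upper\<close>
  applies directly. Each of its two results is, up to commutations, one branch grafted onto the
  other. This is the relation for \<open>Y\<^sub>R Y\<^sub>L\<close>.\<close>

lemma merge_upper_lower:
  assumes "distinct (a # nodes (Node u bs []) @ nodes (Node l [] cs))"
    and "set (nodes (Node u bs []) @ nodes (Node l [] cs)) \<subseteq> V" "l < a" "a < u"
  shows "\<phi> (p @ branch_word a (Node u bs []) @ branch_word a (Node l [] cs) @ q) \<asymp>
    \<phi> (p @ branch_word a (Node u (bs @ [Node l [] cs]) []) @ q) +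
    \<phi> (p @ branch_word a (Node l [] (Node u bs [] # cs)) @ q)"
proof -
  have V: "l \<in> V" "u \<in> V" using assms(2) by auto
  have e: "edge a u = (a, u)" "edge a l = (l, a)" "edge u l = (l, u)" "edge l u = (l, u)"
    using assms(3,4) by (auto simp: edge_def)
  have ew: "edge_word V (forest_word u bs)" "edge_word V (forest_word l cs)"
    using assms(1,2) by (auto intro!: edge_word_forest)
  have "\<phi> (p @ branch_word a (Node u bs []) @ branch_word a (Node l [] cs) @ q) =
    \<phi> ((p @ forest_word u bs) @ [(a, u), (l, a)] @ (forest_word l cs @ q))"
    by (simp add: e)
  also have "\<dots> \<asymp> \<phi> ((p @ forest_word u bs) @ [(l, u), (a, u)] @ (forest_word l cs @ q)) +
      \<phi> ((p @ forest_word u bs) @ [(l, a), (l, u)] @ (forest_word l cs @ q))"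
    unfolding eqv_def by (rule triple_upper) (use assms V in auto)
  also have "\<dots> \<asymp> \<phi> (p @ branch_word a (Node u (bs @ [Node l [] cs]) []) @ q) +
    \<phi> (p @ branch_word a (Node l [] (Node u bs [] # cs)) @ q)"
  proof (rule eqv_add)
    have "\<phi> ((p @ forest_word u bs @ [(l, u)]) @ [(a, u)] @ forest_word l cs @ q) \<asymp>
      \<phi> ((p @ forest_word u bs @ [(l, u)]) @ forest_word l cs @ [(a, u)] @ q)"
      using assms(1,4) ew V a_in_V by (intro commute_eqv) (auto simp: box_vertices_forest_word)
    then show "\<phi> ((p @ forest_word u bs) @ [(l, u), (a, u)] @ (forest_word l cs @ q)) \<asymp>
      \<phi> (p @ branch_word a (Node u (bs @ [Node l [] cs]) []) @ q)"
      by (simp add: e)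
    have "\<phi> (p @ forest_word u bs @ [(l, a)] @ ((l, u) # forest_word l cs @ q)) \<asymp>
      \<phi> (p @ [(l, a)] @ forest_word u bs @ ((l, u) # forest_word l cs @ q))"
      using assms(1,3,4) ew V a_in_V by (intro commute_eqv) (auto simp: box_vertices_forest_word)
    then show "\<phi> ((p @ forest_word u bs) @ [(l, a), (l, u)] @ (forest_word l cs @ q)) \<asymp>
      \<phi> (p @ branch_word a (Node l [] (Node u bs [] # cs)) @ q)"
      by (simp add: e)
  qed
  finally show ?thesis .
qed

text \<open>The words of \<open>cs\<close> and \<open>bs'\<close> stand between the two edges at
  \<open>a\<close>, but they can be moved out, being disjoint from what they have to pass. So
  \<open>triple_lower\<close> applies to arbitrary branches. This is the relation for
  \<open>Y\<^sub>L Z\<^sub>R + (Z\<^sub>L - Y\<^sub>L) Y\<^sub>R\<close>.\<close>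

lemma merge_lower_upper:
  assumes "distinct (a # nodes (Node l bs cs) @ nodes (Node u bs' cs'))"
    and "set (nodes (Node l bs cs) @ nodes (Node u bs' cs')) \<subseteq> V" "l < a" "a < u"
  shows "\<phi> (p @ branch_word a (Node l bs cs) @ branch_word a (Node u bs' cs') @ q) \<asymp>
    \<phi> (p @ branch_word a (Node u bs' (Node l bs cs # cs')) @ q) +
    \<phi> (p @ branch_word a (Node l (bs @ [Node u bs' cs']) cs) @ q)"
proof -
  have V: "l \<in> V" "u \<in> V" using assms(2) by auto
  have e: "edge a u = (a, u)" "edge a l = (l, a)" "edge u l = (l, u)" "edge l u = (l, u)"
    using assms(3,4) by (auto simp: edge_def)
  have ew: "edge_word V (forest_word l bs)" "edge_word V (forest_word l cs)"
    "edge_word V (forest_word u bs')" "edge_word V (forest_word u cs')"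
    using assms(1,2) by (auto intro!: edge_word_forest)
  let ?B = "forest_word l bs" and ?C = "forest_word l cs"
    and ?B' = "forest_word u bs'" and ?C' = "forest_word u cs'"
  have "\<phi> (p @ branch_word a (Node l bs cs) @ branch_word a (Node u bs' cs') @ q) =
    \<phi> ((p @ ?B) @ ((l, a) # ?C) @ ?B' @ ((a, u) # ?C' @ q))"
    by (simp add: e)
  also have "\<dots> \<asymp> \<phi> ((p @ ?B) @ ?B' @ ((l, a) # ?C) @ ((a, u) # ?C' @ q))"
    using assms(1,3,4) ew V a_in_V by (intro commute_eqv) (auto simp: box_vertices_forest_word)
  also have "\<dots> = \<phi> ((p @ ?B @ ?B' @ [(l, a)]) @ ?C @ [(a, u)] @ (?C' @ q))"
    by simp
  also have "\<dots> \<asymp> \<phi> ((p @ ?B @ ?B' @ [(l, a)]) @ [(a, u)] @ ?C @ (?C' @ q))"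
    using assms(1,3,4) ew V a_in_V by (intro commute_eqv) (auto simp: box_vertices_forest_word)
  also have "\<dots> = \<phi> ((p @ ?B @ ?B') @ [(l, a), (a, u)] @ (?C @ ?C' @ q))"
    by simp
  also have "\<dots> \<asymp> \<phi> ((p @ ?B @ ?B') @ [(a, u), (l, u)] @ (?C @ ?C' @ q)) +
      \<phi> ((p @ ?B @ ?B') @ [(l, u), (l, a)] @ (?C @ ?C' @ q))"
    unfolding eqv_def by (rule triple_lower) (use assms V in auto)
  also have "\<dots> \<asymp> \<phi> (p @ branch_word a (Node u bs' (Node l bs cs # cs')) @ q) +
    \<phi> (p @ branch_word a (Node l (bs @ [Node u bs' cs']) cs) @ q)"
  proof (rule eqv_add)
    have "\<phi> (p @ ?B @ (?B' @ [(a, u)]) @ ((l, u) # ?C @ ?C' @ q)) \<asymp>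
      \<phi> (p @ (?B' @ [(a, u)]) @ ?B @ ((l, u) # ?C @ ?C' @ q))"
      using assms(1,3,4) ew V a_in_V by (intro commute_eqv) (auto simp: box_vertices_forest_word)
    then show "\<phi> ((p @ ?B @ ?B') @ [(a, u), (l, u)] @ (?C @ ?C' @ q)) \<asymp>
      \<phi> (p @ branch_word a (Node u bs' (Node l bs cs # cs')) @ q)"
      by (simp add: e)
    have "\<phi> ((p @ ?B @ ?B' @ [(l, u)]) @ ((l, a) # ?C) @ ?C' @ q) \<asymp>
      \<phi> ((p @ ?B @ ?B' @ [(l, u)]) @ ?C' @ ((l, a) # ?C) @ q)"
      using assms(1,3,4) ew V a_in_V by (intro commute_eqv) (auto simp: box_vertices_forest_word)
    then show "\<phi> ((p @ ?B @ ?B') @ [(l, u), (l, a)] @ (?C @ ?C' @ q)) \<asymp>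
      \<phi> (p @ branch_word a (Node l (bs @ [Node u bs' cs']) cs) @ q)"
      by (simp add: e)
  qed
  finally show ?thesis .
qed

end

text \<open>The part of \<open>(1 - Y\<^sub>L)\<^sup>-\<^sup>1 (1 -
  Y\<^sub>R)\<^sup>-\<^sup>1\<close> with vertex set \<open>S\<close>.\<close>

definition free_pairs :: "int \<Rightarrow> int set \<Rightarrow> (plane_tree list \<times> plane_tree list) set" where
  "free_pairs a S = {(ls, us). spanning_forest a S (ls @ us) \<and>
    (\<forall>t\<in>set ls. lower_tree a t \<and> pre t = []) \<and> (\<forall>t\<in>set us. upper_tree a t \<and> post t = [])}"

definition upper_forests :: "int \<Rightarrow> int set \<Rightarrow> plane_tree list set" where
  "upper_forests a S = {us. spanning_forest a S us \<and>
    (\<forall>t\<in>set us. upper_tree a t) \<and> (\<forall>t\<in>set (tl us). post t = [])}"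

definition lower_forests :: "int \<Rightarrow> int set \<Rightarrow> plane_tree list set" where
  "lower_forests a S = {ls. spanning_forest a S ls \<and>
    (\<forall>t\<in>set ls. lower_tree a t) \<and> (\<forall>t\<in>set (butlast ls). pre t = [])}"

lemma in_set_tlD: "x \<in> set (tl xs) \<Longrightarrow> x \<in> set xs"
  by (cases xs) auto

lemma finite_free_pairs: "finite (free_pairs a S)"
  by (rule finite_subset[OF _ finite_spanning_forest_pairs[of a S]]) (auto simp: free_pairs_def)

text \<open>The new child \<open>s\<close> directly follows the edge to the parent. It is the exempt
  last child if \<open>post t\<close> is empty; otherwise it has to be free.\<close>

lemma upper_tree_merge:
  assumes "lower_tree a s" "upper_tree a t" "pre s = [] \<or> post t = []"
  shows "upper_tree a (Node (root t) (pre t) (s # post t))"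
  using assms by (cases t) (auto simp: upper_tree_def lower_tree_def)

text \<open>The new child \<open>t\<close> directly precedes the edge to the parent. It is the
  exempt first child if \<open>pre s\<close> is empty; otherwise it has to be free.\<close>

lemma lower_tree_merge:
  assumes "lower_tree a s" "upper_tree a t" "pre s = [] \<or> post t = []"
  shows "lower_tree a (Node (root s) (pre s @ [t]) (post s))"
  using assms by (cases s; cases "pre s") (auto simp: upper_tree_def lower_tree_def)

lemma upper_tree_split:
  assumes "upper_tree a (Node u bs (s # cs))"
  shows "lower_tree a s" "upper_tree a (Node u bs cs)" "pre s = [] \<or> cs = []"
  using assms by (auto simp: upper_tree_def lower_tree_def split: if_splits)

lemma lower_tree_split:
  assumes "lower_tree a (Node l (bs @ [t]) cs)" "root t \<noteq> a"
  shows "upper_tree a t" "lower_tree a (Node l bs cs)" "bs = [] \<or> post t = []"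
  using assms by (cases bs; force simp: upper_tree_def lower_tree_def)+

context tree_relations
begin

text \<open>
  Inclusion-exclusion for \<open>(1 - Y\<^sub>L) Z\<^sub>R + Z\<^sub>L (1 - Y\<^sub>R) = Y\<^sub>L + Y\<^sub>R - Y\<^sub>L Y\<^sub>R\<close>, multiplied by the inverses of
  \<open>1 - Y\<^sub>L\<close> and \<open>1 - Y\<^sub>R\<close>.
\<close>

lemma free_pairs_eqv_forests:
  assumes "S \<subseteq> V" "S \<noteq> {}"
  shows "(\<Sum>(ls, us)\<in>free_pairs a S. \<phi> (forest_word a (ls @ us))) \<asymp>
    (\<Sum>us\<in>upper_forests a S. \<phi> (forest_word a us)) + (\<Sum>ls\<in>lower_forests a S. \<phi> (forest_word a ls))"
proof -
  define T where "T = (\<lambda>(ls, us). \<phi> (forest_word a (ls @ us)))"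
  \<comment> \<open>All branches are free except possibly the two that meet in the middle, the last
    lower and the first upper one.\<close>
  define Sp where "Sp = {(ls, us). spanning_forest a S (ls @ us) \<and>
    (\<forall>t\<in>set ls. lower_tree a t) \<and> (\<forall>t\<in>set us. upper_tree a t) \<and>
    (\<forall>t\<in>set (butlast ls). pre t = []) \<and> (\<forall>t\<in>set (tl us). post t = [])}"
  define LF where "LF = {(ls, us :: plane_tree list). \<forall>t\<in>set ls. pre t = []}"
  define UF where "UF = {(ls :: plane_tree list, us). \<forall>t\<in>set us. post t = []}"
  define NL where "NL = {(ls :: plane_tree list, us :: plane_tree list). ls \<noteq> []}"
  define NU where "NU = {(ls :: plane_tree list, us :: plane_tree list). us \<noteq> []}"
  \<comment> \<open>\<open>B\<close> stands for \<open>(1 - Y\<^sub>L)\<^sup>-\<^sup>1 Z\<^sub>R (1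
    - Y\<^sub>R)\<^sup>-\<^sup>1\<close> and \<open>C\<close> for the same product with
    \<open>Z\<^sub>L\<close> in the middle. In \<open>P\<close> both middle branches exist and at
    least one is free, which is what the merged branches need to satisfy the hook condition
    again.\<close>
  define B where "B = Sp \<inter> NU \<inter> LF"
  define C where "C = Sp \<inter> NL \<inter> UF"
  define P where "P = (B \<inter> NL) \<union> (C \<inter> NU)"
  have fin: "finite Sp"
    by (rule finite_subset[OF _ finite_spanning_forest_pairs[of a S]]) (auto simp: Sp_def)
  then have finB: "finite B" and finC: "finite C" by (auto simp: B_def C_def)
  \<comment> \<open>\<open>f1\<close> grafts the middle lower branch onto the middle upper one,
    \<open>f2\<close> the upper onto the lower; \<open>g1\<close> and \<open>g2\<close> cut the
    graft off again.\<close>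
  define f1 where "f1 = (\<lambda>(ls, us). (butlast ls, Node (root (hd us)) (pre (hd us)) (last ls # post (hd us)) # tl us))"
  define g1 where "g1 = (\<lambda>(ls, us). (ls @ [hd (post (hd us))], Node (root (hd us)) (pre (hd us)) (tl (post (hd us))) # tl us))"
  define f2 where "f2 = (\<lambda>(ls, us). (butlast ls @ [Node (root (last ls)) (pre (last ls) @ [hd us]) (post (last ls))], tl us))"
  define g2 where "g2 = (\<lambda>(ls, us). (butlast ls @ [Node (root (last ls)) (butlast (pre (last ls))) (post (last ls))], last (pre (last ls)) # us))"
  have P_iff: "(ls @ [s], t # us) \<in> P \<longleftrightarrow> spanning_forest a S (ls @ s # t # us) \<and>
    (\<forall>t\<in>set ls. lower_tree a t \<and> pre t = []) \<and> lower_tree a s \<and> upper_tree a t \<and>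
    (\<forall>t\<in>set us. upper_tree a t \<and> post t = []) \<and> (pre s = [] \<or> post t = [])" for ls s t us
    unfolding P_def B_def C_def Sp_def NU_def NL_def LF_def UF_def by auto
  have P_cases: "\<exists>ls s t us. x = (ls @ [s], t # us)" if "x \<in> P" for x
  proof -
    have "fst x \<noteq> []" "snd x \<noteq> []"
      using that by (auto simp: P_def B_def C_def NU_def NL_def)
    then show ?thesis by (metis append_butlast_last_id list.exhaust prod.collapse)
  qed
  have B_iff: "(ls, us) \<in> B - UF \<longleftrightarrow> (\<exists>u bs s cs us'. us = Node u bs (s # cs) # us' \<and>
    spanning_forest a S (ls @ us) \<and> (\<forall>t\<in>set ls. lower_tree a t \<and> pre t = []) \<and>
    upper_tree a (Node u bs (s # cs)) \<and> (\<forall>t\<in>set us'. upper_tree a t \<and> post t = []))" for ls us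
    unfolding B_def Sp_def NU_def LF_def UF_def
    by (cases us; cases "hd us"; cases "post (hd us)") (auto dest: in_set_butlastD)
  have C_iff: "(ls, us) \<in> C - LF \<longleftrightarrow> (\<exists>ls' l bs t cs. ls = ls' @ [Node l (bs @ [t]) cs] \<and>
    spanning_forest a S (ls @ us) \<and> (\<forall>t\<in>set ls'. lower_tree a t \<and> pre t = []) \<and>
    lower_tree a (Node l (bs @ [t]) cs) \<and> (\<forall>t\<in>set us. upper_tree a t \<and> post t = []))" for ls us
    unfolding C_def Sp_def NL_def LF_def UF_def
    by (cases ls rule: rev_cases; cases "last ls"; cases "pre (last ls)" rule: rev_cases)
      (auto dest: in_set_tlD)
  have split: "T x \<asymp> T (f1 x) + T (f2 x)" if x: "x \<in> P" for x
  proof -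
    obtain ls s t us where x': "x = (ls @ [s], t # us)" using P_cases[OF x] by blast
    obtain l bs cs where s: "s = Node l bs cs" by (cases s)
    obtain u bs' cs' where t: "t = Node u bs' cs'" by (cases t)
    have sp: "spanning_forest a S (ls @ Node l bs cs # Node u bs' cs' # us)" "l < a" "a < u"
      using x[unfolded x' P_iff] by (simp_all add: s t lower_tree_def upper_tree_def)
    have "\<phi> (forest_word a ls @ branch_word a (Node l bs cs) @ branch_word a (Node u bs' cs') @ forest_word a us) \<asymp>
      \<phi> (forest_word a ls @ branch_word a (Node u bs' (Node l bs cs # cs')) @ forest_word a us) +
      \<phi> (forest_word a ls @ branch_word a (Node l (bs @ [Node u bs' cs']) cs) @ forest_word a us)"
      by (rule merge_lower_upper) (use sp assms(1) in \<open>auto simp: spanning_forest_def\<close>)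
    then show ?thesis by (simp add: T_def f1_def f2_def x' s t)
  qed
  \<comment> \<open>Grafting makes \<open>post\<close> of the first upper branch nonempty, so the
    results are the elements of \<open>B\<close> in which this branch is not free.\<close>
  have sum1: "(\<Sum>x\<in>P. T (f1 x)) = sum T (B - UF)"
  proof (rule sum.reindex_bij_witness[of _ g1 f1])
    fix x assume x: "x \<in> P"
    obtain ls s t us where x': "x = (ls @ [s], t # us)" using P_cases[OF x] by blast
    note p = x[unfolded x' P_iff]
    show "g1 (f1 x) = x" by (simp add: f1_def g1_def x')
    have "spanning_forest a S (ls @ Node (root t) (pre t) (s # post t) # us)"
      using p by (cases t) (auto simp: spanning_forest_def)
    then show "f1 x \<in> B - UF"
      using p upper_tree_merge[of a s t] by (simp add: f1_def x' B_iff del: Diff_iff)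
  next
    fix y assume "y \<in> B - UF"
    then obtain ls u bs s cs us where y: "y = (ls, Node u bs (s # cs) # us)"
      "spanning_forest a S (ls @ Node u bs (s # cs) # us)" "\<forall>t\<in>set ls. lower_tree a t \<and> pre t = []"
      "upper_tree a (Node u bs (s # cs))" "\<forall>t\<in>set us. upper_tree a t \<and> post t = []"
      using B_iff by (cases y) auto
    show "f1 (g1 y) = y" by (simp add: f1_def g1_def y(1))
    have "spanning_forest a S (ls @ s # Node u bs cs # us)"
      using y(2) by (auto simp: spanning_forest_def)
    then show "g1 y \<in> P"
      using y upper_tree_split[OF y(4)] by (simp add: g1_def P_iff)
  qed simp
  have sum2: "(\<Sum>x\<in>P. T (f2 x)) = sum T (C - LF)"
  proof (rule sum.reindex_bij_witness[of _ g2 f2])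
    fix x assume x: "x \<in> P"
    obtain ls s t us where x': "x = (ls @ [s], t # us)" using P_cases[OF x] by blast
    note p = x[unfolded x' P_iff]
    show "g2 (f2 x) = x" by (simp add: f2_def g2_def x')
    have "spanning_forest a S (ls @ Node (root s) (pre s @ [t]) (post s) # us)"
      using p by (cases s) (auto simp: spanning_forest_def)
    then show "f2 x \<in> C - LF"
      using p lower_tree_merge[of a s t] by (simp add: f2_def x' C_iff del: Diff_iff)
  next
    fix y assume "y \<in> C - LF"
    then obtain ls l bs t cs us where y: "y = (ls @ [Node l (bs @ [t]) cs], us)"
      "spanning_forest a S (ls @ Node l (bs @ [t]) cs # us)" "\<forall>t\<in>set ls. lower_tree a t \<and> pre t = []"
      "lower_tree a (Node l (bs @ [t]) cs)" "\<forall>t\<in>set us. upper_tree a t \<and> post t = []"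
      using C_iff by (cases y) auto
    show "f2 (g2 y) = y" by (simp add: f2_def g2_def y(1))
    have sp: "spanning_forest a S (ls @ Node l bs cs # t # us)"
      using y(2) by (auto simp: spanning_forest_def)
    have "root t \<noteq> a"
      using y(2) root_in_nodes[of t] by (auto simp: spanning_forest_def)
    then show "g2 y \<in> P"
      using sp y lower_tree_split[OF y(4)] by (simp add: g2_def P_iff)
  qed simp
  have "sum T P \<asymp> (\<Sum>x\<in>P. T (f1 x) + T (f2 x))"
    by (rule eqv_sum) (rule split)
  also have "\<dots> = sum T (B - UF) + sum T (C - LF)"
    by (simp add: sum.distrib sum1 sum2)
  finally have merge: "sum T P \<asymp> sum T (B - UF) + sum T (C - LF)" .
  let ?I = "sum T (B \<inter> UF \<inter> (C \<inter> LF))"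
  have BU: "sum T (B \<inter> UF) = sum T (B \<inter> NL) + sum T (B - NL) - sum T (B - UF)"
    using sum.Int_Diff[OF finB, of T UF] sum.Int_Diff[OF finB, of T NL] by (simp add: algebra_simps)
  have CL: "sum T (C \<inter> LF) = sum T (C \<inter> NU) + sum T (C - NU) - sum T (C - LF)"
    using sum.Int_Diff[OF finC, of T LF] sum.Int_Diff[OF finC, of T NU] by (simp add: algebra_simps)
  \<comment> \<open>Both overlaps consist of the pairs of nonempty lists in which all branches are
    free.\<close>
  have "(B \<inter> NL) \<inter> (C \<inter> NU) = B \<inter> UF \<inter> (C \<inter> LF)"
    by (auto simp: B_def C_def)
  then have "sum T P + ?I = sum T (B \<inter> NL) + sum T (C \<inter> NU)"
    unfolding P_def using finB finC sum.union_inter[of "B \<inter> NL" "C \<inter> NU" T] by simp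
  then have I: "?I = sum T (B \<inter> NL) + sum T (C \<inter> NU) - sum T P"
    by (simp add: algebra_simps)
  \<comment> \<open>As \<open>S\<close> is nonempty, one of the two lists is nonempty, so every free
    pair belongs to \<open>B\<close> or to \<open>C\<close>.\<close>
  have free: "(B \<inter> UF) \<union> (C \<inter> LF) = free_pairs a S"
  proof -
    have "ls \<noteq> [] \<or> us \<noteq> []" if "spanning_forest a S (ls @ us)" for ls us
      using that assms(2) by (auto simp: spanning_forest_def)
    then show ?thesis
      by (auto simp: B_def C_def free_pairs_def Sp_def NU_def NL_def LF_def UF_def
          dest: in_set_butlastD in_set_tlD)
  qed
  have "sum T (free_pairs a S) + ?I = sum T (B \<inter> UF) + sum T (C \<inter> LF)"
    unfolding free[symmetric] using finB finC by (intro sum.union_inter) auto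
  then have "sum T (free_pairs a S) = sum T (B \<inter> UF) + sum T (C \<inter> LF) - ?I"
    by (simp add: algebra_simps)
  \<comment> \<open>The last bracket vanishes by \<open>merge\<close>. What remains are the pairs
    with one empty list, that is, the two kinds of hook forests.\<close>
  also have "\<dots> = sum T (B - NL) + sum T (C - NU) + (sum T P - (sum T (B - UF) + sum T (C - LF)))"
    unfolding BU CL I by (simp add: algebra_simps)
  also have "\<dots> \<asymp> sum T (B - NL) + sum T (C - NU) + 0"
    by (intro eqv_add eqv_refl) (use merge in \<open>simp add: eqv_def\<close>)
  also have "sum T (B - NL) = (\<Sum>us\<in>upper_forests a S. \<phi> (forest_word a us))"
  proof (rule sum.reindex_bij_witness[of _ "\<lambda>us. ([], us)" snd])
    fix us assume us: "us \<in> upper_forests a S"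
    then have "us \<noteq> []" using assms(2) by (auto simp: upper_forests_def spanning_forest_def)
    then show "([], us) \<in> B - NL"
      using us by (simp add: upper_forests_def B_def Sp_def NU_def NL_def LF_def)
  qed (auto simp: B_def Sp_def NU_def NL_def LF_def T_def upper_forests_def)
  also have "sum T (C - NU) = (\<Sum>ls\<in>lower_forests a S. \<phi> (forest_word a ls))"
  proof (rule sum.reindex_bij_witness[of _ "\<lambda>ls. (ls, [])" fst])
    fix ls assume ls: "ls \<in> lower_forests a S"
    then have "ls \<noteq> []" using assms(2) by (auto simp: lower_forests_def spanning_forest_def)
    then show "(ls, []) \<in> C - NU"
      using ls by (simp add: lower_forests_def C_def Sp_def NU_def NL_def UF_def)
  qed (auto simp: C_def Sp_def NU_def NL_def UF_def T_def lower_forests_def)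
  finally show ?thesis by (simp add: T_def)
qed

end

text \<open>With an empty \<open>post\<close> the edge to the parent is last at \<open>u\<close>, so
  no child is exempt and all children have to be free.\<close>

lemma upper_free_tree_snoc:
  "upper_tree a (Node u (bs @ [s]) []) \<longleftrightarrow> upper_tree a (Node u bs []) \<and> lower_tree a s \<and> pre s = []"
  by (auto simp: upper_tree_def lower_tree_def)

lemma lower_free_tree_Cons:
  assumes "root t \<noteq> a"
  shows "lower_tree a (Node l [] (t # cs)) \<longleftrightarrow>
    lower_tree a (Node l [] cs) \<and> upper_tree a t \<and> post t = []"
  using assms by (force simp: upper_tree_def lower_tree_def)

lemma spanning_forest_leaf:
  assumes "x \<in> S" "x \<noteq> a"
  shows "spanning_forest a S (Node x [] [] # ts) \<longleftrightarrow> spanning_forest a (S - {x}) ts"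
  using assms by (auto simp: spanning_forest_def)

lemma free_pairs_empty: "free_pairs a {} = {([], [])}"
  by (auto simp: free_pairs_def spanning_forest_def)

context tree_relations
begin

text \<open>With \<open>G\<close> for \<open>(1 - Y\<^sub>L)\<^sup>-\<^sup>1 (1 -
  Y\<^sub>R)\<^sup>-\<^sup>1\<close>, the identity \<open>(1 - X)\<^sup>-\<^sup>1 = G\<close> is
  obtained from \<open>G = 1 + X G\<close>, by induction on the number of vertices: the first letter
  of a star is split off and the hypothesis applied to the rest. The prefix \<open>p\<close> absorbs
  the letters already split off.\<close>

lemma star_eqv_free_pairs:
  assumes "finite S" "a \<notin> S" "S \<subseteq> V"
  shows "(\<Sum>js\<in>permutations_of_set S. \<phi> (p @ map (edge a) js)) \<asymp>
    (\<Sum>(ls, us)\<in>free_pairs a S. \<phi> (p @ forest_word a (ls @ us)))"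
  using assms
proof (induction "card S" arbitrary: S p)
  case 0
  then show ?case by (simp add: free_pairs_empty)
next
  case (Suc k)
  then have ne: "S \<noteq> {}" by auto
  define T where "T = (\<lambda>(ls, us). \<phi> (p @ forest_word a (ls @ us)))"
  define T' where "T' = (\<lambda>(t, ls, us). \<phi> (p @ forest_word a (t # ls @ us)))"
  define h where "h = (\<lambda>(x, ls, us). \<phi> ((p @ [edge a x]) @ forest_word a (ls @ us)))"
  \<comment> \<open>The terms of \<open>X G\<close>, a single edge followed by a free pair;
    \<open>Low\<close> separates \<open>X\<^sub>L G\<close> from \<open>X\<^sub>R G\<close>.\<close>
  define X where "X = Sigma S (\<lambda>x. free_pairs a (S - {x}))"
  define Low where "Low = {z :: int \<times> plane_tree list \<times> plane_tree list. fst z < a}"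
  \<comment> \<open>The terms of \<open>Y\<^sub>R G\<close>. Those in \<open>AX\<close>, where the
    leading branch is a single edge, are the terms of \<open>X\<^sub>R G\<close>.\<close>
  define A where "A = {(t, ls, us). spanning_forest a S (t # ls @ us) \<and> upper_tree a t \<and> post t = [] \<and>
    (\<forall>t\<in>set ls. lower_tree a t \<and> pre t = []) \<and> (\<forall>t\<in>set us. upper_tree a t \<and> post t = [])}"
  define AX where "AX = {(t, ls :: plane_tree list, us :: plane_tree list). pre t = []}"
  define AN where "AN = {(t :: plane_tree, ls :: plane_tree list, us :: plane_tree list). ls \<noteq> []}"
  define G where "G = free_pairs a S"
  define N where "N = {(ls :: plane_tree list, us :: plane_tree list). ls \<noteq> []}"
  define Q where "Q = {(ls, us :: plane_tree list). post (hd ls) = []}"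
  have finG: "finite G" by (simp add: G_def finite_free_pairs)
  have finX: "finite X" using Suc.prems(1) by (simp add: X_def finite_free_pairs)
  have "finite A"
  proof (rule finite_subset)
    show "A \<subseteq> (\<lambda>(ts, us). (hd ts, tl ts, us)) ` {(ls, us). spanning_forest a S (ls @ us)}"
    proof safe
      fix t ls us assume "(t, ls, us) \<in> A"
      then show "(t, ls, us) \<in> (\<lambda>(ts, us). (hd ts, tl ts, us)) ` {(ls, us). spanning_forest a S (ls @ us)}"
        by (intro image_eqI[of _ _ "(t # ls, us)"]) (auto simp: A_def)
    qed
  qed (simp add: finite_spanning_forest_pairs)
  have "(\<Sum>js\<in>permutations_of_set S. \<phi> (p @ map (edge a) js)) =
    (\<Sum>x\<in>S. \<Sum>js\<in>permutations_of_set (S - {x}). \<phi> ((p @ [edge a x]) @ map (edge a) js))"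
    unfolding permutations_of_set_nonempty[OF ne] using Suc.prems(1)
    by (subst sum.UNION_disjoint) (auto simp: sum.reindex)
  also have "\<dots> \<asymp> (\<Sum>x\<in>S. \<Sum>(ls, us)\<in>free_pairs a (S - {x}). \<phi> ((p @ [edge a x]) @ forest_word a (ls @ us)))"
    by (intro eqv_sum Suc.hyps(1)) (use Suc in auto)
  also have "\<dots> = sum h X"
    unfolding X_def h_def using Suc.prems(1) finite_free_pairs
    by (subst sum.Sigma) (auto simp: case_prod_unfold)
  also have "\<dots> = sum h (X \<inter> Low) + sum h (X - Low)"
    by (rule sum.Int_Diff[OF finX])
  \<comment> \<open>A lower edge in front of a free pair gives a free pair whose first lower branch
    is a single edge.\<close>
  also have "sum h (X \<inter> Low) = sum T (G \<inter> N \<inter> Q)"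
  proof (rule sum.reindex_bij_witness[of _ "\<lambda>(ls, us). (root (hd ls), tl ls, us)"
        "\<lambda>(x, ls, us). (Node x [] [] # ls, us)"])
    fix z assume "z \<in> X \<inter> Low"
    then obtain x ls us where z: "z = (x, ls, us)" "x \<in> S" "x < a" "(ls, us) \<in> free_pairs a (S - {x})"
      by (auto simp: X_def Low_def)
    show "(case case z of (x, ls, us) \<Rightarrow> (Node x [] [] # ls, us) of
        (ls, us) \<Rightarrow> (root (hd ls), tl ls, us)) = z" by (simp add: z)
    show "(case z of (x, ls, us) \<Rightarrow> (Node x [] [] # ls, us)) \<in> G \<inter> N \<inter> Q"
      using z Suc.prems(2) spanning_forest_leaf[of x S a "ls @ us"]
      by (auto simp: G_def N_def Q_def free_pairs_def lower_tree_def)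
    show "T (case z of (x, ls, us) \<Rightarrow> (Node x [] [] # ls, us)) = h z"
      by (simp add: z T_def h_def)
  next
    fix z assume "z \<in> G \<inter> N \<inter> Q"
    then obtain t ls us where z: "z = (t # ls, us)" "spanning_forest a S (t # ls @ us)"
      "lower_tree a t" "pre t = []" "post t = []"
      "\<forall>t\<in>set ls. lower_tree a t \<and> pre t = []" "\<forall>t\<in>set us. upper_tree a t \<and> post t = []"
      by (cases z; cases "fst z") (auto simp: G_def N_def Q_def free_pairs_def)
    then obtain x where t: "t = Node x [] []" by (cases t) auto
    have x: "x \<in> S" "x \<noteq> a" using z(2) t by (auto simp: spanning_forest_def)
    show "(case case z of (ls, us) \<Rightarrow> (root (hd ls), tl ls, us) of
        (x, ls, us) \<Rightarrow> (Node x [] [] # ls, us)) = z" by (simp add: z t)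
    show "(case z of (ls, us) \<Rightarrow> (root (hd ls), tl ls, us)) \<in> X \<inter> Low"
      using z t x spanning_forest_leaf[OF x, of "ls @ us"]
      by (auto simp: X_def Low_def free_pairs_def lower_tree_def)
  qed
  also have "sum h (X - Low) = sum T' (A \<inter> AX)"
  proof (rule sum.reindex_bij_witness[of _ "\<lambda>(t, ls, us). (root t, ls, us)"
        "\<lambda>(x, ls, us). (Node x [] [], ls, us)"])
    fix z assume "z \<in> X - Low"
    then obtain x ls us where z: "z = (x, ls, us)" "x \<in> S" "\<not> x < a" "(ls, us) \<in> free_pairs a (S - {x})"
      by (auto simp: X_def Low_def)
    then have "a < x" using Suc.prems(2) by (metis linorder_less_linear)
    show "(case case z of (x, ls, us) \<Rightarrow> (Node x [] [], ls, us) of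
        (t, ls, us) \<Rightarrow> (root t, ls, us)) = z" by (simp add: z)
    show "(case z of (x, ls, us) \<Rightarrow> (Node x [] [], ls, us)) \<in> A \<inter> AX"
      using z \<open>a < x\<close> spanning_forest_leaf[of x S a "ls @ us"]
      by (auto simp: A_def AX_def free_pairs_def upper_tree_def)
    show "T' (case z of (x, ls, us) \<Rightarrow> (Node x [] [], ls, us)) = h z"
      by (simp add: z T'_def h_def)
  next
    fix z assume "z \<in> A \<inter> AX"
    then obtain t ls us where z: "z = (t, ls, us)" "spanning_forest a S (t # ls @ us)"
      "upper_tree a t" "pre t = []" "post t = []"
      "\<forall>t\<in>set ls. lower_tree a t \<and> pre t = []" "\<forall>t\<in>set us. upper_tree a t \<and> post t = []"
      by (cases z) (auto simp: A_def AX_def)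
    then obtain x where t: "t = Node x [] []" by (cases t) auto
    have x: "x \<in> S" "x \<noteq> a" using z(2) t by (auto simp: spanning_forest_def)
    show "(case case z of (t, ls, us) \<Rightarrow> (root t, ls, us) of
        (x, ls, us) \<Rightarrow> (Node x [] [], ls, us)) = z" by (simp add: z t)
    show "(case z of (t, ls, us) \<Rightarrow> (root t, ls, us)) \<in> X - Low"
      using z t x spanning_forest_leaf[OF x, of "ls @ us"]
      by (auto simp: X_def Low_def free_pairs_def upper_tree_def)
  qed
  \<comment> \<open>An upper edge in front of lower branches is no free pair. Therefore
    \<open>X\<^sub>R G\<close> is written as \<open>Y\<^sub>R G - (Y\<^sub>R - X\<^sub>R) G\<close>,
    so that the leading branch can be merged.\<close>
  also have "sum T' (A \<inter> AX) = sum T' (A - AN) + (sum T' (A \<inter> AN) - sum T' (A - AX))"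
    using sum.Int_Diff[OF \<open>finite A\<close>, of T' AX] sum.Int_Diff[OF \<open>finite A\<close>, of T' AN]
    by (simp add: algebra_simps)
  also have "sum T' (A - AN) = sum T (G - N)"
  proof (rule sum.reindex_bij_witness[of _ "\<lambda>(ls, us). (hd us, ls, tl us)"
        "\<lambda>(t, ls, us). (ls, t # us)"])
    fix z assume z: "z \<in> G - N"
    obtain us where us: "z = ([], us)" "spanning_forest a S us" "\<forall>t\<in>set us. upper_tree a t \<and> post t = []"
      using z by (cases z) (auto simp: G_def N_def free_pairs_def)
    have "us \<noteq> []" using us(2) ne by (auto simp: spanning_forest_def)
    then obtain t us' where t: "us = t # us'" by (cases us) auto
    show "(case case z of (ls, us) \<Rightarrow> (hd us, ls, tl us) of (t, ls, us) \<Rightarrow> (ls, t # us)) = z"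
      by (simp add: us(1) t)
    show "(case z of (ls, us) \<Rightarrow> (hd us, ls, tl us)) \<in> A - AN"
      using us by (simp add: t A_def AN_def)
  qed (auto simp: A_def AN_def G_def N_def free_pairs_def T_def T'_def)
  finally have main: "(\<Sum>js\<in>permutations_of_set S. \<phi> (p @ map (edge a) js)) \<asymp>
    sum T (G \<inter> N \<inter> Q) + (sum T (G - N) + (sum T' (A \<inter> AN) - sum T' (A - AX)))" .
  \<comment> \<open>Merging the leading upper branch with the first lower one gives either a larger
    leading upper branch, which cancels \<open>A - AX\<close>, or a first lower branch that is not a
    single edge, which supplies the free pairs still missing.\<close>
  define h1 where "h1 = (\<lambda>(t, ls, us :: plane_tree list). (Node (root t) (pre t @ [hd ls]) [], tl ls, us))"
  define k1 where "k1 = (\<lambda>(t, ls, us :: plane_tree list). (Node (root t) (butlast (pre t)) [], last (pre t) # ls, us))"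
  define h2 where "h2 = (\<lambda>(t, ls, us :: plane_tree list). (Node (root (hd ls)) [] (t # post (hd ls)) # tl ls, us))"
  define k2 where "k2 = (\<lambda>(ls, us :: plane_tree list).
    (hd (post (hd ls)), Node (root (hd ls)) [] (tl (post (hd ls))) # tl ls, us))"
  have AN_iff: "(t, ls, us) \<in> A \<inter> AN \<longleftrightarrow> (\<exists>u bs l cs ls'. t = Node u bs [] \<and> ls = Node l [] cs # ls' \<and>
    spanning_forest a S (Node u bs [] # Node l [] cs # ls' @ us) \<and> upper_tree a (Node u bs []) \<and>
    lower_tree a (Node l [] cs) \<and> (\<forall>t\<in>set ls'. lower_tree a t \<and> pre t = []) \<and>
    (\<forall>t\<in>set us. upper_tree a t \<and> post t = []))" for t ls us
    unfolding A_def AN_def by (cases t; cases ls; cases "hd ls") auto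
  have split: "T' z \<asymp> T' (h1 z) + T (h2 z)" if z: "z \<in> A \<inter> AN" for z
  proof -
    obtain u bs l cs ls us where z': "z = (Node u bs [], Node l [] cs # ls, us)"
      "spanning_forest a S (Node u bs [] # Node l [] cs # ls @ us)" "a < u" "l < a"
      using z AN_iff by (cases z) (auto simp: upper_tree_def lower_tree_def)
    have "\<phi> (p @ branch_word a (Node u bs []) @ branch_word a (Node l [] cs) @ forest_word a (ls @ us)) \<asymp>
      \<phi> (p @ branch_word a (Node u (bs @ [Node l [] cs]) []) @ forest_word a (ls @ us)) +
      \<phi> (p @ branch_word a (Node l [] (Node u bs [] # cs)) @ forest_word a (ls @ us))"
      by (rule merge_upper_lower) (use z'(2-4) Suc.prems(3) in \<open>auto simp: spanning_forest_def\<close>)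
    then show ?thesis by (simp add: T_def T'_def h1_def h2_def z'(1))
  qed
  have sum1: "(\<Sum>z\<in>A \<inter> AN. T' (h1 z)) = sum T' (A - AX)"
  proof (rule sum.reindex_bij_witness[of _ k1 h1])
    fix z assume z: "z \<in> A \<inter> AN"
    obtain u bs l cs ls us where z': "z = (Node u bs [], Node l [] cs # ls, us)"
      "spanning_forest a S (Node u bs [] # Node l [] cs # ls @ us)" "upper_tree a (Node u bs [])"
      "lower_tree a (Node l [] cs)" "\<forall>t\<in>set ls. lower_tree a t \<and> pre t = []"
      "\<forall>t\<in>set us. upper_tree a t \<and> post t = []"
      using z AN_iff by (cases z) auto
    show "k1 (h1 z) = z" by (simp add: k1_def h1_def z'(1))
    show "h1 z \<in> A - AX"
      using z'(2-6) by (auto simp: h1_def z'(1) A_def AX_def upper_free_tree_snoc spanning_forest_def)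
  next
    fix z assume z: "z \<in> A - AX"
    obtain t ls us where z': "z = (t, ls, us)" by (cases z)
    obtain u bs s where t: "t = Node u (bs @ [s]) []"
      using z by (cases t; cases "pre t" rule: rev_cases) (auto simp: z' A_def AX_def)
    have ut: "upper_tree a (Node u bs [])" "lower_tree a s" "pre s = []"
      using z by (auto simp: z' t A_def upper_free_tree_snoc)
    obtain l cs where s: "s = Node l [] cs" using ut(3) by (cases s) auto
    show "h1 (k1 z) = z" by (simp add: k1_def h1_def z' t)
    show "k1 z \<in> A \<inter> AN"
      using z ut by (auto simp: k1_def z' t s A_def AN_def spanning_forest_def)
  qed simp
  have sum2: "(\<Sum>z\<in>A \<inter> AN. T (h2 z)) = sum T (G \<inter> N - Q)"
  proof (rule sum.reindex_bij_witness[of _ k2 h2])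
    fix z assume z: "z \<in> A \<inter> AN"
    obtain u bs l cs ls us where z': "z = (Node u bs [], Node l [] cs # ls, us)"
      "spanning_forest a S (Node u bs [] # Node l [] cs # ls @ us)" "upper_tree a (Node u bs [])"
      "lower_tree a (Node l [] cs)" "\<forall>t\<in>set ls. lower_tree a t \<and> pre t = []"
      "\<forall>t\<in>set us. upper_tree a t \<and> post t = []"
      using z AN_iff by (cases z) auto
    have "u \<noteq> a" using z'(3) by (simp add: upper_tree_def)
    show "k2 (h2 z) = z" by (simp add: k2_def h2_def z'(1))
    show "h2 z \<in> G \<inter> N - Q"
      using z'(2-6) lower_free_tree_Cons[of "Node u bs []" a l cs] \<open>u \<noteq> a\<close>
      by (auto simp: h2_def z'(1) G_def N_def Q_def free_pairs_def spanning_forest_def)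
  next
    fix z assume z: "z \<in> G \<inter> N - Q"
    obtain s ls us where z': "z = (s # ls, us)"
      using z by (cases z; cases "fst z") (auto simp: N_def)
    obtain l t cs where s: "s = Node l [] (t # cs)"
      using z by (cases s; cases "post s") (auto simp: z' G_def free_pairs_def Q_def)
    have sp: "spanning_forest a S (s # ls @ us)" "lower_tree a s"
      using z by (auto simp: z' G_def free_pairs_def)
    have "root t \<noteq> a"
      using sp(1) root_in_nodes[of t] by (auto simp: s spanning_forest_def)
    then have lt: "lower_tree a (Node l [] cs)" "upper_tree a t" "post t = []"
      using sp(2) lower_free_tree_Cons[of t a l cs] by (auto simp: s)
    show "h2 (k2 z) = z" by (simp add: k2_def h2_def z' s)
    show "k2 z \<in> A \<inter> AN"
      using z lt by (auto simp: k2_def z' s A_def AN_def G_def free_pairs_def spanning_forest_def)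
  qed simp
  have "sum T' (A \<inter> AN) \<asymp> (\<Sum>z\<in>A \<inter> AN. T' (h1 z) + T (h2 z))"
    by (rule eqv_sum) (rule split)
  also have "\<dots> = sum T' (A - AX) + sum T (G \<inter> N - Q)"
    by (simp add: sum.distrib sum1 sum2)
  finally have "sum T' (A \<inter> AN) \<asymp> sum T' (A - AX) + sum T (G \<inter> N - Q)" .
  from eqv_diff[OF this eqv_refl[of "sum T' (A - AX)"]]
  have merge: "sum T' (A \<inter> AN) - sum T' (A - AX) \<asymp> sum T (G \<inter> N - Q)" by simp
  note main
  also have "sum T (G \<inter> N \<inter> Q) + (sum T (G - N) + (sum T' (A \<inter> AN) - sum T' (A - AX))) \<asymp>
    sum T (G \<inter> N \<inter> Q) + (sum T (G - N) + sum T (G \<inter> N - Q))"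
    by (intro eqv_add eqv_refl merge)
  also have "\<dots> = sum T G"
    using sum.Int_Diff[OF finG, of T N] sum.Int_Diff[of "G \<inter> N" T Q] finG by (simp add: algebra_simps)
  finally show ?case by (simp add: T_def G_def)
qed

lemma star_eqv_forests:
  assumes "finite S" "a \<notin> S" "S \<subseteq> V" "S \<noteq> {}"
  shows "(\<Sum>js\<in>permutations_of_set S. \<phi> (map (edge a) js)) \<asymp>
    (\<Sum>us\<in>upper_forests a S. \<phi> (forest_word a us)) + (\<Sum>ls\<in>lower_forests a S. \<phi> (forest_word a ls))"
  using eqv_trans[OF star_eqv_free_pairs[OF assms(1-3), of "[]"] ] free_pairs_eqv_forests[OF assms(3,4)]
  by simp

end

section \<open>The ring of series and the closed ideal\<close>

lemma fk_mult_Nil: "(f \<star> g) [] = f [] * g []"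
  by (simp add: fk_mult_def)

text \<open>The series \<open>\<lambda>v. f (e # v)\<close> is the left quotient of \<open>f\<close>
  by the letter \<open>e\<close>. The recursion replaces the sum over all splittings of a word in
  the inductions below.\<close>

lemma fk_mult_Cons: "(f \<star> g) (e # u) = f [] * g (e # u) + ((\<lambda>v. f (e # v)) \<star> g) u"
  unfolding fk_mult_def by (simp add: sum.atMost_Suc_shift del: sum.atMost_Suc)

lemma fk_mult_add_left: "(f + g) \<star> h = f \<star> h + g \<star> h"
  by (auto simp: fk_mult_def fun_eq_iff sum.distrib algebra_simps)

lemma fk_mult_add_right: "h \<star> (f + g) = h \<star> f + h \<star> g"
  by (auto simp: fk_mult_def fun_eq_iff sum.distrib algebra_simps)

lemma fk_mult_minus_left: "(- f) \<star> h = - (f \<star> h)"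
  by (auto simp: fk_mult_def fun_eq_iff sum_negf)

lemma fk_mult_minus_right: "h \<star> (- f) = - (h \<star> f)"
  by (auto simp: fk_mult_def fun_eq_iff sum_negf)

lemma fk_mult_diff_left: "(f - g) \<star> h = f \<star> h - g \<star> h"
  using fk_mult_add_left[of f "- g" h] by (simp add: fk_mult_minus_left)

lemma fk_mult_diff_right: "h \<star> (f - g) = h \<star> f - h \<star> g"
  using fk_mult_add_right[of h f "- g"] by (simp add: fk_mult_minus_right)

lemma fk_mult_zero [simp]: "0 \<star> h = 0" "h \<star> 0 = 0"
  by (auto simp: fk_mult_def fun_eq_iff)

lemma fk_mult_sum_left: "sum f A \<star> h = (\<Sum>x\<in>A. f x \<star> h)"
  by (induction A rule: infinite_finite_induct)
    (simp_all add: fk_mult_add_left del: plus_fun_apply zero_fun_apply)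

lemma fk_mult_sum_right: "h \<star> sum f A = (\<Sum>x\<in>A. h \<star> f x)"
  by (induction A rule: infinite_finite_induct)
    (simp_all add: fk_mult_add_right del: plus_fun_apply zero_fun_apply)

lemma fk_mult_assoc: "(f \<star> g) \<star> h = f \<star> (g \<star> h)"
proof
  fix u show "((f \<star> g) \<star> h) u = (f \<star> (g \<star> h)) u"
  proof (induction u arbitrary: f)
    case (Cons e u)
    have "(\<lambda>v. (f \<star> g) (e # v)) = (\<lambda>v. f [] * g (e # v)) + (\<lambda>v. f (e # v)) \<star> g"
      by (simp add: fk_mult_Cons fun_eq_iff)
    moreover have "((\<lambda>v. f [] * g (e # v)) \<star> h) u = f [] * ((\<lambda>v. g (e # v)) \<star> h) u"
      by (simp add: fk_mult_def sum_distrib_left mult.assoc)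
    ultimately show ?case
      using Cons[of "\<lambda>v. f (e # v)"]
      by (simp add: fk_mult_Cons fk_mult_Nil fk_mult_add_left algebra_simps)
  qed (simp add: fk_mult_Nil mult.assoc)
qed

lemma fk_word_Nil_mult [simp]: "fk_word [] \<star> f = f"
proof
  fix u show "(fk_word [] \<star> f) u = f u"
  proof (cases u)
    case (Cons e v)
    have "(\<lambda>v. fk_word [] (e # v)) = (0 :: 'a fk_series)"
      by (simp add: fk_word_def fun_eq_iff)
    then show ?thesis by (simp add: Cons fk_mult_Cons) (simp add: fk_word_def)
  qed (simp add: fk_mult_Nil fk_word_def)
qed

lemma fk_word_Cons_mult:
  "(fk_word (e # u) \<star> f) v = (case v of [] \<Rightarrow> 0 | e' # v' \<Rightarrow> if e' = e then (fk_word u \<star> f) v' else 0)"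
proof (cases v)
  case (Cons e' v')
  have "(\<lambda>v. fk_word (e # u) (e' # v)) = (if e' = e then fk_word u else (0 :: 'a fk_series))"
    by (auto simp: fk_word_def fun_eq_iff)
  then show ?thesis by (simp add: Cons fk_mult_Cons) (simp add: fk_word_def)
qed (simp add: fk_mult_Nil fk_word_def)

lemma fk_word_mult: "fk_word u \<star> fk_word v = fk_word (u @ v)"
proof (induction u)
  case (Cons e u)
  show ?case
    by (rule ext, simp only: fk_word_Cons_mult Cons.IH) (auto simp: fk_word_def split: list.split)
qed simp

lemma fk_mult_word_Nil [simp]: "f \<star> fk_word [] = f"
proof
  fix u show "(f \<star> fk_word []) u = f u"
  proof (induction u arbitrary: f)
    case (Cons e u)
    then show ?case by (simp add: fk_mult_Cons) (simp add: fk_word_def)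
  qed (simp add: fk_mult_Nil fk_word_def)
qed

lemma fk_mult_nonzeroE:
  assumes "(f \<star> g) u \<noteq> 0"
  obtains x y where "u = x @ y" "f x \<noteq> 0" "g y \<noteq> 0"
proof -
  obtain k where "f (take k u) * g (drop k u) \<noteq> 0"
    using assms unfolding fk_mult_def by (meson sum.not_neutral_contains_not_neutral)
  then have "f (take k u) \<noteq> 0" "g (drop k u) \<noteq> 0" by (metis mult_zero_left mult_zero_right)+
  then show ?thesis using that[of "take k u" "drop k u"] by simp
qed

section \<open>The action on the nilCoxeter algebra and finiteness of descents\<close>

fun descent_word :: "nat \<Rightarrow> (int \<Rightarrow> int) \<Rightarrow> (int \<times> int) list \<Rightarrow> bool" where
  "descent_word n w [] \<longleftrightarrow> True"
| "descent_word n w ((i, j) # u) \<longleftrightarrow>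
    affine_length n w = affine_length n (w \<circ> affine_refl n i j) + 1 \<and>
    descent_word n (w \<circ> affine_refl n i j) u"

fun act_perm :: "nat \<Rightarrow> (int \<Rightarrow> int) \<Rightarrow> (int \<times> int) list \<Rightarrow> (int \<Rightarrow> int)" where
  "act_perm n w [] = w"
| "act_perm n w ((i, j) # u) = act_perm n (w \<circ> affine_refl n i j) u"

lemma descent_word_append:
  "descent_word n w (u @ v) \<longleftrightarrow> descent_word n w u \<and> descent_word n (act_perm n w u) v"
proof (induction u arbitrary: w)
  case (Cons e u)
  then show ?case by (cases e) (simp del: comp_apply)
qed simp

lemma nilcox_act_symbol_single:
  "nilcox_act_symbol n (Poly_Mapping.single w c) (i, j) =
    (if affine_length n w = affine_length n (w \<circ> affine_refl n i j) + 1
     then Poly_Mapping.single (w \<circ> affine_refl n i j) c else 0)"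
  by (cases "c = 0") (auto simp: nilcox_act_symbol_def)

lemma nilcox_act_word_zero: "nilcox_act_word n 0 u = 0"
  by (induction u) (auto simp: nilcox_act_word_def nilcox_act_symbol_def split: prod.split)

text \<open>A letter sends a basis element to a basis element or to zero, so acting by a word means
  following a chain along which the length drops by one at each step.\<close>

lemma nilcox_act_word_single:
  "nilcox_act_word n (Poly_Mapping.single w c) u =
    (if descent_word n w u then Poly_Mapping.single (act_perm n w u) c else 0)"
proof (induction u arbitrary: w)
  case (Cons e u)
  obtain i j where e: "e = (i, j)" by (cases e)
  have "nilcox_act_word n (Poly_Mapping.single w c) ((i, j) # u) =
    nilcox_act_word n (nilcox_act_symbol n (Poly_Mapping.single w c) (i, j)) u"
    by (simp add: nilcox_act_word_def)
  then show ?case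
    unfolding e nilcox_act_symbol_single by (simp add: Cons.IH nilcox_act_word_zero del: comp_apply)
qed (simp add: nilcox_act_word_def)

lemma nilcox_act_word_nonzero:
  "nilcox_act_word n (Poly_Mapping.single w c) u \<noteq> 0 \<longleftrightarrow> c \<noteq> 0 \<and> descent_word n w u"
proof -
  have "Poly_Mapping.single (act_perm n w u) c = 0 \<longleftrightarrow> c = 0"
    by (metis lookup_single_eq lookup_zero single_zero)
  then show ?thesis by (simp add: nilcox_act_word_single)
qed

lemma carrier_fk_E:
  "f \<in> carrier (fk_E n) \<longleftrightarrow> f \<in> fk_completion n \<and>
    (\<forall>w\<in>affine_perms n. finite {u. f u \<noteq> 0 \<and> descent_word n w u})"
  by (simp add: fk_E_def nilcox_act_word_nonzero)

lemma fk_E_simps [simp]: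
  "\<zero>\<^bsub>fk_E n\<^esub> = 0" "\<one>\<^bsub>fk_E n\<^esub> = fk_word []" "f \<oplus>\<^bsub>fk_E n\<^esub> g = f + g" "f \<otimes>\<^bsub>fk_E n\<^esub> g = f \<star> g"
  by (auto simp: fk_E_def fun_eq_iff)

lemma cong_period: "[k + m * int n = k] (mod int n)"
  by (simp add: cong_def)

lemma affine_refl_period: "affine_refl n i j (k + m * int n) = affine_refl n i j k + m * int n"
proof -
  have "[k + m * int n = x] (mod int n) \<longleftrightarrow> [k = x] (mod int n)" for x
    by (simp add: cong_def)
  then show ?thesis by (simp add: affine_refl_def)
qed

lemma affine_refl_lower: "[k = i] (mod int n) \<Longrightarrow> affine_refl n i j k = k + (j - i)"
  by (simp add: affine_refl_def)

lemma affine_refl_upper: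
  "\<not> [i = j] (mod int n) \<Longrightarrow> [k = j] (mod int n) \<Longrightarrow> affine_refl n i j k = k - (j - i)"
  using cong_trans[of i k "int n" j] cong_sym[of k i "int n"] by (auto simp: affine_refl_def)

lemma affine_refl_other:
  "\<not> [k = i] (mod int n) \<Longrightarrow> \<not> [k = j] (mod int n) \<Longrightarrow> affine_refl n i j k = k"
  by (simp add: affine_refl_def)

lemma affine_refl_involution:
  assumes "\<not> [i = j] (mod int n)"
  shows "affine_refl n i j (affine_refl n i j k) = k"
proof -
  consider "[k = i] (mod int n)" | "[k = j] (mod int n)"
    | "\<not> [k = i] (mod int n)" "\<not> [k = j] (mod int n)" by blast
  then show ?thesis
  proof cases
    case 1
    then have "[k + (j - i) = i + (j - i)] (mod int n)" by (intro cong_add) auto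
    then have "[k + (j - i) = j] (mod int n)" by simp
    then show ?thesis using 1 assms by (simp add: affine_refl_lower affine_refl_upper)
  next
    case 2
    then have "[k - (j - i) = j - (j - i)] (mod int n)" by (intro cong_diff) auto
    then have "[k - (j - i) = i] (mod int n)" by simp
    then show ?thesis using 2 assms by (simp add: affine_refl_lower affine_refl_upper)
  qed (simp add: affine_refl_other)
qed

lemma affine_refl_comp_self: "\<not> [i = j] (mod int n) \<Longrightarrow> affine_refl n i j \<circ> affine_refl n i j = id"
  by (auto simp: affine_refl_involution)

lemma bij_affine_refl: "\<not> [i = j] (mod int n) \<Longrightarrow> bij (affine_refl n i j)"
  by (rule o_bij[of "affine_refl n i j"]) (auto simp: affine_refl_comp_self)

lemma periodic_multiple:
  assumes "\<And>k. v (k + int n) = v k + int n"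
  shows "v (k + m * int n) = v k + m * int n"
proof (induction m rule: int_induct[where k = 0])
  case (step1 m)
  then show ?case using assms[of "k + m * int n"] by (simp add: algebra_simps)
next
  case (step2 m)
  then show ?case using assms[of "k + (m - 1) * int n"] by (simp add: algebra_simps)
qed simp

lemma cong_iff_shift: "[k = i] (mod int n) \<longleftrightarrow> (\<exists>m. k = i + m * int n)" for k i :: int
proof
  assume "[k = i] (mod int n)"
  then have "int n dvd k - i" by (simp add: cong_iff_dvd_diff)
  then obtain m where "k - i = int n * m" by (elim dvdE)
  then show "\<exists>m. k = i + m * int n" by (intro exI[of _ m]) (simp add: algebra_simps)
qed (auto simp: cong_period)

text \<open>A periodic injection carries the residue classes of \<open>i\<close> and
  \<open>j\<close> to those of \<open>v i\<close> and \<open>v j\<close>. The conjugation rule is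
  written as an intertwining relation to avoid the inverse of \<open>v\<close>.\<close>

lemma affine_refl_conj:
  assumes "inj v" "\<And>k m. v (k + m * int n) = v k + m * int n" "\<not> [i = j] (mod int n)"
  shows "affine_refl n (v i) (v j) \<circ> v = v \<circ> affine_refl n i j"
proof
  have cong_v: "[v k = v x] (mod int n) \<longleftrightarrow> [k = x] (mod int n)" for k x
    unfolding cong_iff_shift assms(2)[symmetric] using injD[OF assms(1)] by blast
  fix k
  consider m where "k = i + m * int n" | m where "k = j + m * int n"
    | "\<not> [k = i] (mod int n)" "\<not> [k = j] (mod int n)" unfolding cong_iff_shift by blast
  then show "(affine_refl n (v i) (v j) \<circ> v) k = (v \<circ> affine_refl n i j) k"
  proof cases
    case 1
    then have "[k = i] (mod int n)" by (simp add: cong_period)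
    then have "affine_refl n i j k = j + m * int n" using 1 by (simp add: affine_refl_lower)
    moreover have "affine_refl n (v i) (v j) (v k) = v k + (v j - v i)"
      using \<open>[k = i] (mod int n)\<close> cong_v by (simp add: affine_refl_lower)
    ultimately show ?thesis using assms(2) by (simp add: 1)
  next
    case 2
    then have "[k = j] (mod int n)" by (simp add: cong_period)
    then have "affine_refl n i j k = i + m * int n" using 2 assms(3) by (simp add: affine_refl_upper)
    moreover have "affine_refl n (v i) (v j) (v k) = v k - (v j - v i)"
      using \<open>[k = j] (mod int n)\<close> cong_v assms(3) by (simp add: affine_refl_upper)
    ultimately show ?thesis using assms(2) by (simp add: 2)
  next
    case 3
    then show ?thesis using cong_v by (simp add: affine_refl_other)
  qed
qed

definition simple_product :: "nat \<Rightarrow> int list \<Rightarrow> int \<Rightarrow> int" where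
  "simple_product n rs = foldr (\<lambda>r v. affine_refl n r (r + 1) \<circ> v) rs id"

lemma simple_product_Nil: "simple_product n [] = id"
  by (simp add: simple_product_def)

lemma simple_product_Cons: "simple_product n (r # rs) = affine_refl n r (r + 1) \<circ> simple_product n rs"
  unfolding simple_product_def by (simp only: foldr.simps comp_apply)

lemma simple_product_append: "simple_product n (rs @ rs') = simple_product n rs \<circ> simple_product n rs'"
  by (induction rs) (simp_all add: simple_product_Nil simple_product_Cons fun_eq_iff)

lemma not_cong_Suc: "2 \<le> n \<Longrightarrow> \<not> [r = r + 1] (mod int n)"
proof
  assume "2 \<le> n" "[r = r + 1] (mod int n)"
  then have "int n dvd 1" by (simp add: cong_iff_dvd_diff)
  then show False using \<open>2 \<le> n\<close> by simp
qed

text \<open>Conjugation by the simple reflection exchanging \<open>j - 1\<close> and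
  \<open>j\<close> shortens the distance \<open>j - i\<close>: by one in general, and by two if
  \<open>i\<close> is congruent to \<open>j - 1\<close>, when both ends move.\<close>

lemma affine_refl_generated:
  assumes "2 \<le> n" "i < j" "\<not> [i = j] (mod int n)"
  shows "\<exists>rs. affine_refl n i j = simple_product n rs"
  using assms(2,3)
proof (induction "nat (j - i)" arbitrary: i j rule: less_induct)
  case less
  show ?case
  proof (cases "j = i + 1")
    case True
    then show ?thesis by (intro exI[of _ "[i]"]) (simp add: simple_product_Cons simple_product_Nil)
  next
    case False
    define v where "v = affine_refl n (j - 1) j"
    have nc: "\<not> [j - 1 = j] (mod int n)" using not_cong_Suc[OF assms(1), of "j - 1"] by simp
    have vv: "v \<circ> v = id" unfolding v_def by (rule affine_refl_comp_self[OF nc])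
    have per: "v (k + m * int n) = v k + m * int n" for k m unfolding v_def by (rule affine_refl_period)
    have inj: "inj v" unfolding v_def using bij_affine_refl[OF nc] by (rule bij_is_inj)
    have vj: "v j = j - 1" unfolding v_def using nc by (simp add: affine_refl_upper)
    have vi: "v i < v j \<and> \<not> [v i = v j] (mod int n) \<and> v j - v i < j - i"
    proof (cases "[i = j - 1] (mod int n)")
      case True
      then obtain m where m: "i = j - 1 + m * int n" unfolding cong_iff_shift by blast
      have "m < 0"
      proof (rule ccontr)
        assume "\<not> m < 0"
        then have "0 \<le> m * int n" by simp
        then have "m * int n = 0" using m less.prems(1) by linarith
        then show False using m False by simp
      qed
      \<comment> \<open>So \<open>i\<close> and \<open>j - 1\<close> are at least \<open>n\<close>,
        hence at least two, apart, and the moved ends remain in strict order.\<close>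
      then have "m * int n \<le> - int n"
        using mult_right_mono[of m "- 1" "int n"] by simp
      then have "i + 1 < j - 1" using m assms(1) by linarith
      moreover have "v i = i + 1" unfolding v_def using True by (simp add: affine_refl_lower)
      moreover have "\<not> [i + 1 = j - 1] (mod int n)"
      proof
        assume "[i + 1 = j - 1] (mod int n)"
        then have "[i + 1 = i] (mod int n)" using True by (metis cong_sym cong_trans)
        then show False using not_cong_Suc[OF assms(1), of i] cong_sym by blast
      qed
      ultimately show ?thesis using vj by simp
    next
      case F: False
      then have "v i = i" unfolding v_def using less.prems(2) by (simp add: affine_refl_other)
      then show ?thesis using vj F False less.prems(1) by simp
    qed
    then obtain rs where rs: "affine_refl n (v i) (v j) = simple_product n rs"
      using less.hyps[of "v j" "v i"] by fastforce
    have "affine_refl n i j = v \<circ> (v \<circ> affine_refl n i j)" by (simp only: o_assoc vv id_o)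
    also have "\<dots> = v \<circ> (affine_refl n (v i) (v j) \<circ> v)"
      by (simp add: affine_refl_conj[OF inj per less.prems(2)])
    also have "\<dots> = simple_product n ([j - 1] @ rs @ [j - 1])"
      unfolding simple_product_append rs by (simp add: simple_product_Cons simple_product_Nil v_def)
    finally show ?thesis by blast
  qed
qed


lemma simple_product_bij: "2 \<le> n \<Longrightarrow> bij (simple_product n rs)"
proof (induction rs)
  case (Cons r rs)
  then show ?case
    using bij_comp[OF Cons.IH bij_affine_refl[OF not_cong_Suc, of n r]]
    by (simp add: simple_product_Cons del: comp_apply)
qed (simp add: simple_product_Nil)

text \<open>A simple reflection depends only on the residue of its index. With \<open>n\<close>
  generators there are finitely many products of each length.\<close>

lemma simple_product_mod:
  "simple_product n (map (\<lambda>r. r mod int n) rs) = simple_product n rs"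
proof (induction rs)
  case (Cons r rs)
  have "[k = r mod int n] (mod int n) \<longleftrightarrow> [k = r] (mod int n)"
    "[k = r mod int n + 1] (mod int n) \<longleftrightarrow> [k = r + 1] (mod int n)" for k
    by (simp_all add: cong_def mod_simps)
  then have "affine_refl n (r mod int n) (r mod int n + 1) = affine_refl n r (r + 1)"
    by (auto simp: affine_refl_def fun_eq_iff)
  then show ?case using Cons by (simp add: simple_product_Cons del: comp_apply)
qed simp

lemma affine_length_simple_product:
  "affine_length n w = (LEAST k. \<exists>rs. length rs = k \<and> w = simple_product n rs)"
  by (simp add: affine_length_def simple_product_def)

lemma finite_affine_length:
  assumes "2 \<le> n"
  shows "finite {w. (\<exists>rs. w = simple_product n rs) \<and> affine_length n w = k}"
proof (rule finite_subset)
  show "{w. (\<exists>rs. w = simple_product n rs) \<and> affine_length n w = k} \<subseteq>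
    simple_product n ` {rs. set rs \<subseteq> {0..<int n} \<and> length rs = k}"
  proof
    fix w assume w: "w \<in> {w. (\<exists>rs. w = simple_product n rs) \<and> affine_length n w = k}"
    then have "\<exists>k rs. length rs = k \<and> w = simple_product n rs" by auto
    then have "\<exists>rs. length rs = affine_length n w \<and> w = simple_product n rs"
      unfolding affine_length_simple_product by (rule LeastI_ex)
    then obtain rs where rs: "length rs = k" "w = simple_product n rs" using w by auto
    have "w = simple_product n (map (\<lambda>r. r mod int n) rs)"
      by (simp add: simple_product_mod rs(2))
    moreover have "set (map (\<lambda>r. r mod int n) rs) \<subseteq> {0..<int n}"
      using assms by auto
    ultimately show "w \<in> simple_product n ` {rs. set rs \<subseteq> {0..<int n} \<and> length rs = k}"
      using rs(1) by (intro image_eqI) auto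
  qed
qed (simp add: finite_lists_length_eq)

text \<open>Evaluated at \<open>i\<close>, the reflection moves it up to \<open>j\<close>. So
  \<open>i\<close> lies in the class of the smaller index \<open>k\<close>, and the distance is read
  off as well.\<close>

lemma affine_refl_eq_shift:
  assumes "(i, j) \<in> fk_symbols n" "(k, l) \<in> fk_symbols n" "affine_refl n i j = affine_refl n k l"
  shows "\<exists>r. k = i + r * int n \<and> l = j + r * int n"
proof -
  have ij: "i < j" and kl: "k < l" "\<not> [k = l] (mod int n)"
    using assms by (auto simp: fk_symbols_def)
  have "affine_refl n k l i = j"
    using fun_cong[OF assms(3), of i] by (simp add: affine_refl_lower)
  then have *: "[i = k] (mod int n)" "j - i = l - k"
    using ij kl by (auto simp: affine_refl_def split: if_splits)
  from cong_sym[OF *(1)] obtain r where "k = i + r * int n" unfolding cong_iff_shift by blast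
  then show ?thesis using *(2) by (intro exI[of _ r]) simp
qed

definition letter_shift :: "nat \<Rightarrow> int \<times> int \<Rightarrow> int \<times> int \<Rightarrow> bool" where
  "letter_shift n = (\<lambda>(i, j) (k, l). \<exists>r. k = i + r * int n \<and> l = j + r * int n)"

lemma shift_equivalent_letter_shift: "shift_equivalent n = list_all2 (letter_shift n)"
  by (simp add: shift_equivalent_def letter_shift_def)

text \<open>For \<open>w\<close> in the group, the elements \<open>w \<circ> t\<close> of length one
  less lie in a finite set, and \<open>t\<close> is recovered from them because \<open>w\<close> is
  injective. \<open>F\<close> keeps one symbol for each of these reflections.\<close>

lemma finite_descent_letters:
  assumes "2 \<le> n"
  shows "\<exists>F. finite F \<and> F \<subseteq> fk_symbols n \<and> (\<forall>(i, j)\<in>fk_symbols n.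
    affine_length n w = affine_length n (w \<circ> affine_refl n i j) + 1 \<longrightarrow>
    (\<exists>(k, l)\<in>F. letter_shift n (k, l) (i, j) \<and> affine_refl n k l = affine_refl n i j))"
proof -
  define D where "D = {(i, j) \<in> fk_symbols n. affine_length n w = affine_length n (w \<circ> affine_refl n i j) + 1}"
  define t where "t = (\<lambda>(i, j). affine_refl n i j)"
  have "finite (t ` D)"
  proof (cases "\<exists>rs. w = simple_product n rs")
    case True
    have "(\<lambda>v. w \<circ> v) ` t ` D \<subseteq>
      {w'. (\<exists>rs. w' = simple_product n rs) \<and> affine_length n w' = affine_length n w - 1}"
    proof clarify
      fix i j assume ij: "(i, j) \<in> D"
      then obtain rs' where "affine_refl n i j = simple_product n rs'"
        using affine_refl_generated[OF assms, of i j] by (auto simp: D_def fk_symbols_def)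
      then have "\<exists>rs. w \<circ> t (i, j) = simple_product n rs"
        using True simple_product_append unfolding t_def by (metis case_prod_conv)
      then show "(\<exists>rs. w \<circ> t (i, j) = simple_product n rs) \<and>
          affine_length n (w \<circ> t (i, j)) = affine_length n w - 1"
        using ij by (simp add: D_def t_def del: comp_apply)
    qed
    then have "finite ((\<lambda>v. w \<circ> v) ` t ` D)"
      by (rule finite_subset) (rule finite_affine_length[OF assms])
    moreover have "inj w" using True simple_product_bij[OF assms] bij_is_inj by blast
    then have "inj_on (\<lambda>v. w \<circ> v) (t ` D)"
      by (intro inj_onI) (simp add: fun.inj_map_strong inj_on_def fun_eq_iff)
    ultimately show ?thesis by (rule finite_imageD)
  next
    case False
    \<comment> \<open>Here all lengths are the same junk value of \<open>LEAST\<close>, so there is no descent.\<close>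
    have "D = {}"
    proof (rule ccontr)
      assume "D \<noteq> {}"
      then obtain i j where ij: "(i, j) \<in> fk_symbols n"
        "affine_length n w = affine_length n (w \<circ> affine_refl n i j) + 1" by (auto simp: D_def)
      then obtain rs' where rs': "affine_refl n i j = simple_product n rs'"
        using affine_refl_generated[OF assms, of i j] by (auto simp: fk_symbols_def)
      have "\<not> [i = j] (mod int n)" using ij(1) by (simp add: fk_symbols_def)
      then have w: "w = (w \<circ> affine_refl n i j) \<circ> affine_refl n i j"
        unfolding comp_assoc affine_refl_comp_self[OF \<open>\<not> [i = j] (mod int n)\<close>] by simp
      have "\<not> (\<exists>rs. w \<circ> affine_refl n i j = simple_product n rs)"
      proof
        assume "\<exists>rs. w \<circ> affine_refl n i j = simple_product n rs"
        then obtain rs where "w \<circ> affine_refl n i j = simple_product n rs" ..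
        then have "w = simple_product n (rs @ rs')"
          using w rs' simple_product_append by metis
        then show False using False by blast
      qed
      then have "affine_length n (w \<circ> affine_refl n i j) = affine_length n w"
        unfolding affine_length_simple_product using False by simp
      then show False using ij(2) by simp
    qed
    then show ?thesis by simp
  qed
  then obtain F where F: "F \<subseteq> D" "finite F" "t ` F = t ` D"
    by (metis finite_subset_image subset_refl)
  show ?thesis
  proof (intro exI[of _ F] conjI ballI, goal_cases)
    case (3 x)
    obtain i j where x: "x = (i, j)" by (cases x)
    show ?case unfolding x split
    proof
      assume "affine_length n w = affine_length n (w \<circ> affine_refl n i j) + 1"
      then have ij: "(i, j) \<in> D" using 3 x by (simp add: D_def)
      then have "t (i, j) \<in> t ` F" unfolding F(3) by (rule imageI)
      then obtain k l where kl: "(k, l) \<in> F" "affine_refl n k l = affine_refl n i j"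
        by (auto simp: t_def)
      then have "letter_shift n (k, l) (i, j)"
        using affine_refl_eq_shift[OF _ _ kl(2)] F(1) ij by (auto simp: letter_shift_def D_def)
      then show "\<exists>(k, l)\<in>F. letter_shift n (k, l) (i, j) \<and> affine_refl n k l = affine_refl n i j"
        using kl by blast
    qed
  qed (use F in \<open>auto simp: D_def\<close>)
qed

text \<open>Shifting the first letter does not change its reflection, so up to shift only finitely
  many elements remain from which the word continues.\<close>

lemma finite_descent_classes:
  assumes "2 \<le> n"
  shows "\<exists>U. finite U \<and> (\<forall>u. length u = k \<and> set u \<subseteq> fk_symbols n \<and> descent_word n w u \<longrightarrow>
    (\<exists>v\<in>U. shift_equivalent n v u))"
proof (induction k arbitrary: w)
  case 0
  show ?case by (intro exI[of _ "{[]}"]) (simp add: shift_equivalent_def)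
next
  case (Suc k)
  from finite_descent_letters[OF assms, of w] obtain F where finF: "finite F"
    and F: "\<forall>(i, j)\<in>fk_symbols n. affine_length n w = affine_length n (w \<circ> affine_refl n i j) + 1 \<longrightarrow>
      (\<exists>(k, l)\<in>F. letter_shift n (k, l) (i, j) \<and> affine_refl n k l = affine_refl n i j)"
    by (elim exE conjE)
  define Q where "Q = (\<lambda>w U. finite U \<and> (\<forall>u. length u = k \<and> set u \<subseteq> fk_symbols n \<and>
    descent_word n w u \<longrightarrow> (\<exists>v\<in>U. shift_equivalent n v u)))"
  have "\<forall>w. \<exists>U. Q w U" using Suc.IH by (simp add: Q_def)
  from choice[OF this] obtain U where U: "\<forall>w. Q w (U w)" ..
  define U' where "U' = (\<Union>e\<in>F. (\<lambda>u. e # u) ` U (w \<circ> affine_refl n (fst e) (snd e)))"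
  have "\<exists>v\<in>U'. shift_equivalent n v u"
    if u: "length u = Suc k" "set u \<subseteq> fk_symbols n" "descent_word n w u" for u
  proof -
    obtain i j u' where u': "u = (i, j) # u'" using u(1) by (cases u) auto
    obtain e where e: "e \<in> F" "letter_shift n e (i, j)" "affine_refl n (fst e) (snd e) = affine_refl n i j"
      using bspec[OF F, of "(i, j)"] u by (auto simp: u')
    obtain v where "v \<in> U (w \<circ> affine_refl n i j)" "shift_equivalent n v u'"
      using spec[OF U, of "w \<circ> affine_refl n i j"] u by (auto simp: u' Q_def simp del: comp_apply)
    then show ?thesis
      using e unfolding U'_def u' shift_equivalent_letter_shift
      by (intro bexI[of _ "e # v"] UN_I[of e] imageI) auto
  qed
  moreover have "finite U'" unfolding U'_def using finF U by (simp add: Q_def)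
  ultimately show ?case by blast
qed

text \<open>An injection that commutes with translation by \<open>n\<close> permutes the window from
  1 to \<open>n\<close> once its values are reduced to it, and \<open>g\<close> does not see the
  reduction.\<close>

lemma periodic_sum_comp:
  fixes g :: "int \<Rightarrow> int"
  assumes "0 < n" "inj t" "\<And>k m. t (k + m * int n) = t k + m * int n"
    and "\<And>k m. g (k + m * int n) = g k"
  shows "(\<Sum>k=1..int n. g (t k)) = (\<Sum>k=1..int n. g k)"
proof -
  define \<rho> where "\<rho> = (\<lambda>k. (t k - 1) mod int n + 1)"
  have \<rho>: "t k = \<rho> k + ((t k - 1) div int n) * int n" for k
    by (simp add: \<rho>_def)
  have inj: "inj_on \<rho> {1..int n}"
  proof (rule inj_onI)
    fix k k' assume k: "k \<in> {1..int n}" "k' \<in> {1..int n}" "\<rho> k = \<rho> k'"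
    define m where "m = (t k' - 1) div int n - (t k - 1) div int n"
    have "t k' = t k + m * int n"
      using \<rho>[of k] \<rho>[of k'] k(3) by (simp add: m_def algebra_simps)
    then have "t k' = t (k + m * int n)" by (simp add: assms(3))
    then have k': "k' = k + m * int n" using injD[OF assms(2)] by blast
    then have "\<bar>m * int n\<bar> < int n" using k by auto
    have "m = 0"
    proof (rule ccontr)
      assume "m \<noteq> 0"
      then have "int n * 1 \<le> int n * \<bar>m\<bar>" by (intro mult_left_mono) auto
      then show False using \<open>\<bar>m * int n\<bar> < int n\<close> by (simp add: abs_mult mult.commute)
    qed
    then show "k = k'" using k' by simp
  qed
  have "\<rho> ` {1..int n} \<subseteq> {1..int n}"
    using assms(1) pos_mod_bound[of "int n"] by (auto simp: \<rho>_def zless_imp_add1_zle)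
  then have im: "\<rho> ` {1..int n} = {1..int n}"
    using inj by (intro endo_inj_surj) auto
  have "(\<Sum>k=1..int n. g (t k)) = (\<Sum>k=1..int n. g (\<rho> k))"
  proof (rule sum.cong[OF refl])
    fix k show "g (t k) = g (\<rho> k)"
      by (subst \<rho>) (rule assms(4))
  qed
  also have "\<dots> = sum g (\<rho> ` {1..int n})" using inj by (simp add: sum.reindex)
  finally show ?thesis unfolding im .
qed

text \<open>Up to the sum of the window itself, the sum for \<open>w \<circ> t\<close> splits into
  those of the periodic functions \<open>w - id\<close>, composed with \<open>t\<close>, and
  \<open>t - id\<close>. Composition with \<open>t\<close> leaves both sums unchanged, but it
  negates \<open>t - id\<close>, whose sum is therefore zero.\<close>

lemma affine_perms_comp_refl:
  assumes "2 \<le> n" "w \<in> affine_perms n" "\<not> [i = j] (mod int n)"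
  shows "w \<circ> affine_refl n i j \<in> affine_perms n"
proof -
  let ?t = "affine_refl n i j"
  have n0: "0 < n" using assms(1) by simp
  have w: "bij w" "\<And>k m. w (k + m * int n) = w k + m * int n"
    "(\<Sum>k=1..int n. w k) = (\<Sum>k=1..int n. k)"
    using assms(2) periodic_multiple[of w n] by (auto simp: affine_perms_def)
  have t: "bij ?t" "\<And>k m. ?t (k + m * int n) = ?t k + m * int n" "\<And>k. ?t (?t k) = k"
    using assms(3) by (auto simp: bij_affine_refl affine_refl_period affine_refl_involution)
  define f where "f = (\<lambda>k. w k - k)"
  define d where "d = (\<lambda>k. ?t k - k)"
  have "(\<Sum>k=1..int n. f (?t k)) = (\<Sum>k=1..int n. f k)"
    by (rule periodic_sum_comp[OF n0]) (use t w in \<open>auto simp: f_def bij_is_inj\<close>)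
  moreover have "(\<Sum>k=1..int n. d (?t k)) = (\<Sum>k=1..int n. d k)"
    by (rule periodic_sum_comp[OF n0]) (use t in \<open>auto simp: d_def bij_is_inj\<close>)
  moreover have "d (?t k) = - d k" for k by (simp add: d_def t)
  ultimately have "(\<Sum>k=1..int n. d k) = 0" "(\<Sum>k=1..int n. f (?t k)) = (\<Sum>k=1..int n. f k)"
    by (simp_all add: sum_negf)
  moreover have "w (?t k) = f (?t k) + d k + k" for k by (simp add: f_def d_def)
  ultimately have "(\<Sum>k=1..int n. w (?t k)) = (\<Sum>k=1..int n. f k) + (\<Sum>k=1..int n. k)"
    by (simp add: sum.distrib)
  also have "\<dots> = (\<Sum>k=1..int n. k)" using w(3) by (simp add: f_def sum_subtractf)
  finally have "(\<Sum>k=1..int n. w (?t k)) = (\<Sum>k=1..int n. k)" .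
  moreover have "w (?t (k + int n)) = w (?t k) + int n" for k
    using t(2)[of k 1] w(2)[of "?t k" 1] by simp
  ultimately show ?thesis
    using bij_comp[OF t(1) w(1)] by (simp add: affine_perms_def)
qed

lemma act_perm_affine_perms:
  "2 \<le> n \<Longrightarrow> w \<in> affine_perms n \<Longrightarrow> set u \<subseteq> fk_symbols n \<Longrightarrow> act_perm n w u \<in> affine_perms n"
proof (induction u arbitrary: w)
  case (Cons e u)
  obtain i j where e: "e = (i, j)" by (cases e)
  have "w \<circ> affine_refl n i j \<in> affine_perms n"
    using Cons.prems by (intro affine_perms_comp_refl) (auto simp: e fk_symbols_def)
  then show ?case unfolding e using Cons by (simp del: comp_apply)
qed simp

text \<open>The right factor acts on the finitely many basis elements that the left factor reaches
  from \<open>w\<close>. These are again indexed by \<open>affine_perms n\<close>, so its own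
  finiteness condition applies to each of them.\<close>

lemma fk_E_mult_closed:
  assumes "2 \<le> n" "f \<in> carrier (fk_E n)" "g \<in> carrier (fk_E n)"
  shows "f \<star> g \<in> carrier (fk_E n)"
proof -
  have f: "\<And>u. f u \<noteq> 0 \<Longrightarrow> set u \<subseteq> fk_symbols n"
    "\<And>N. finite {u. f u \<noteq> 0 \<and> (\<forall>(i, j)\<in>set u. \<bar>i\<bar> < N \<and> \<bar>j\<bar> < N)}"
    "\<And>w. w \<in> affine_perms n \<Longrightarrow> finite {u. f u \<noteq> 0 \<and> descent_word n w u}"
    using assms(2) by (auto simp: carrier_fk_E fk_completion_def)
  have g: "\<And>u. g u \<noteq> 0 \<Longrightarrow> set u \<subseteq> fk_symbols n"
    "\<And>N. finite {u. g u \<noteq> 0 \<and> (\<forall>(i, j)\<in>set u. \<bar>i\<bar> < N \<and> \<bar>j\<bar> < N)}"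
    "\<And>w. w \<in> affine_perms n \<Longrightarrow> finite {u. g u \<noteq> 0 \<and> descent_word n w u}"
    using assms(3) by (auto simp: carrier_fk_E fk_completion_def)
  have "set u \<subseteq> fk_symbols n" if "(f \<star> g) u \<noteq> 0" for u
    using that f(1) g(1) by (elim fk_mult_nonzeroE) (metis set_append Un_least)
  moreover have "finite {u. (f \<star> g) u \<noteq> 0 \<and> (\<forall>(i, j)\<in>set u. \<bar>i\<bar> < N \<and> \<bar>j\<bar> < N)}" for N
  proof (rule finite_subset)
    let ?A = "\<lambda>h :: 'a fk_series. {u. h u \<noteq> 0 \<and> (\<forall>(i, j)\<in>set u. \<bar>i\<bar> < N \<and> \<bar>j\<bar> < N)}"
    show "{u. (f \<star> g) u \<noteq> 0 \<and> (\<forall>(i, j)\<in>set u. \<bar>i\<bar> < N \<and> \<bar>j\<bar> < N)} \<subseteq> (\<lambda>(x, y). x @ y) ` (?A f \<times> ?A g)"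
    proof clarify
      fix u assume u: "(f \<star> g) u \<noteq> 0" "\<forall>(i, j)\<in>set u. \<bar>i\<bar> < N \<and> \<bar>j\<bar> < N"
      then obtain x y where "u = x @ y" "f x \<noteq> 0" "g y \<noteq> 0" by (elim fk_mult_nonzeroE)
      then show "u \<in> (\<lambda>(x, y). x @ y) ` (?A f \<times> ?A g)"
        using u(2) by (intro image_eqI[of _ _ "(x, y)"]) auto
    qed
    show "finite ((\<lambda>(x, y). x @ y) ` (?A f \<times> ?A g))"
      using f(2)[of N] g(2)[of N] by (intro finite_imageI finite_cartesian_product)
  qed
  moreover have "finite {u. (f \<star> g) u \<noteq> 0 \<and> descent_word n w u}" if w: "w \<in> affine_perms n" for w
  proof (rule finite_subset)
    let ?A = "{x. f x \<noteq> 0 \<and> descent_word n w x}"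
    let ?B = "\<lambda>x. {y. g y \<noteq> 0 \<and> descent_word n (act_perm n w x) y}"
    show "{u. (f \<star> g) u \<noteq> 0 \<and> descent_word n w u} \<subseteq> (\<Union>x\<in>?A. (\<lambda>y. x @ y) ` ?B x)"
    proof clarify
      fix u assume u: "(f \<star> g) u \<noteq> 0" "descent_word n w u"
      from u(1) obtain x y where xy: "u = x @ y" "f x \<noteq> 0" "g y \<noteq> 0" by (elim fk_mult_nonzeroE)
      then have "x \<in> ?A" "y \<in> ?B x" using u(2) by (auto simp: descent_word_append)
      then show "u \<in> (\<Union>x\<in>?A. (\<lambda>y. x @ y) ` ?B x)" using xy(1) by blast
    qed
    have "finite (?B x)" if "x \<in> ?A" for x
      using g(3) act_perm_affine_perms[OF assms(1) w] f(1)[of x] that by blast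
    then show "finite (\<Union>x\<in>?A. (\<lambda>y. x @ y) ` ?B x)"
      using f(3)[OF w] by blast
  qed
  ultimately show ?thesis by (auto simp: carrier_fk_E fk_completion_def)
qed

lemma fk_E_add_closed:
  assumes "f \<in> carrier (fk_E n)" "g \<in> carrier (fk_E n)"
  shows "f + g \<in> carrier (fk_E n)"
proof -
  have nz: "f u \<noteq> 0 \<or> g u \<noteq> 0" if "f u + g u \<noteq> 0" for u using that by auto
  have fin: "finite {u. f u + g u \<noteq> 0 \<and> P u}" if "finite {u. f u \<noteq> 0 \<and> P u}" "finite {u. g u \<noteq> 0 \<and> P u}" for P
    by (rule finite_subset[OF _ finite_UnI[OF that]]) (use nz in auto)
  show ?thesis
    unfolding carrier_fk_E fk_completion_def plus_fun_apply
  proof (intro conjI CollectI allI impI ballI fin)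
    show "set u \<subseteq> fk_symbols n" if "f u + g u \<noteq> 0" for u
      using nz[OF that] assms by (auto simp: carrier_fk_E fk_completion_def)
  qed (use assms in \<open>auto simp: carrier_fk_E fk_completion_def\<close>)
qed

lemma fk_E_uminus_closed: "f \<in> carrier (fk_E n) \<Longrightarrow> - f \<in> carrier (fk_E n)"
  by (simp add: carrier_fk_E fk_completion_def)

lemma fk_E_zero_closed: "0 \<in> carrier (fk_E n)"
  by (simp add: carrier_fk_E fk_completion_def)

lemma fk_E_diff_closed: "f \<in> carrier (fk_E n) \<Longrightarrow> g \<in> carrier (fk_E n) \<Longrightarrow> f - g \<in> carrier (fk_E n)"
  using fk_E_add_closed[of f n "- g"] fk_E_uminus_closed by fastforce

lemma fk_E_sum_closed: "(\<And>x. x \<in> A \<Longrightarrow> F x \<in> carrier (fk_E n)) \<Longrightarrow> sum F A \<in> carrier (fk_E n)"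
  by (induction A rule: infinite_finite_induct)
    (simp_all add: fk_E_zero_closed fk_E_add_closed del: zero_fun_apply plus_fun_apply)

lemma finite_support_carrier:
  "finite {u. f u \<noteq> 0} \<Longrightarrow> (\<And>u. f u \<noteq> 0 \<Longrightarrow> set u \<subseteq> fk_symbols n) \<Longrightarrow> f \<in> carrier (fk_E n)"
  by (simp add: carrier_fk_E fk_completion_def)

lemma fk_word_carrier: "set u \<subseteq> fk_symbols n \<Longrightarrow> fk_word u \<in> carrier (fk_E n)"
  by (rule finite_support_carrier) (auto simp: fk_word_def split: if_splits)

lemma fk_E_ring:
  assumes "2 \<le> n"
  shows "ring (fk_E n :: 'k::comm_ring_1 fk_series ring)"
proof (rule ringI)
  show "abelian_group (fk_E n :: 'k fk_series ring)"
  proof (rule abelian_groupI)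
    fix f :: "'k fk_series" assume f: "f \<in> carrier (fk_E n)"
    show "\<exists>g\<in>carrier (fk_E n). g \<oplus>\<^bsub>fk_E n\<^esub> f = \<zero>\<^bsub>fk_E n\<^esub>"
      using fk_E_uminus_closed[OF f] by (intro bexI[of _ "- f"]) (auto simp: fun_eq_iff)
  qed (auto simp: fk_E_add_closed fk_E_zero_closed fun_eq_iff algebra_simps)
  show "Group.monoid (fk_E n :: 'k fk_series ring)"
    by (rule monoidI) (auto simp: fk_E_mult_closed[OF assms] fk_mult_assoc fk_word_carrier)
qed (simp_all add: fk_mult_add_left fk_mult_add_right del: plus_fun_apply)

lemma fk_E_a_inv:
  assumes "2 \<le> n" "f \<in> carrier (fk_E n)"
  shows "\<ominus>\<^bsub>fk_E n\<^esub> f = - f"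
proof -
  interpret ring "fk_E n" by (rule fk_E_ring[OF assms(1)])
  show ?thesis
    using assms(2) fk_E_uminus_closed[OF assms(2)] by (intro minus_equality) (auto simp: fun_eq_iff)
qed

section \<open>Anchored series\<close>

definition anchored :: "int \<Rightarrow> int \<Rightarrow> (int \<times> int) list \<Rightarrow> bool" where
  "anchored lo hi u \<longleftrightarrow> (\<forall>(p, q)\<in>set u. p \<le> hi \<and> lo \<le> q)"

lemma finite_list_all2:
  assumes "\<And>x. finite {y. R x y}"
  shows "finite {ys. list_all2 R xs ys}"
proof (induction xs)
  case (Cons x xs)
  have "{ys. list_all2 R (x # xs) ys} \<subseteq> (\<lambda>(y, ys). y # ys) ` ({y. R x y} \<times> {ys. list_all2 R xs ys})"
    by (auto simp: list_all2_Cons1)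
  then show ?case
    by (rule finite_subset) (use assms Cons in auto)
qed simp

text \<open>A shift class fixes the difference of the two indices of each letter, and the bounds
  then confine the letter to finitely many positions.\<close>

lemma finite_shift_anchored: "finite {v. shift_equivalent n u v \<and> anchored lo hi v}"
proof -
  define R where "R = (\<lambda>e (k, l). letter_shift n e (k, l) \<and> k \<le> hi \<and> lo \<le> l)"
  have "finite {y. R e y}" for e
  proof (rule finite_subset)
    show "{y. R e y} \<subseteq> (\<lambda>k. (k, k + (snd e - fst e))) ` {lo - (snd e - fst e)..hi}"
      by (cases e) (auto simp: R_def letter_shift_def)
  qed simp
  then have "finite {v. list_all2 R u v}" by (rule finite_list_all2)
  moreover have "{v. shift_equivalent n u v \<and> anchored lo hi v} \<subseteq> {v. list_all2 R u v}"
  proof clarify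
    fix v assume "shift_equivalent n u v" and v: "anchored lo hi v"
    then have "list_all2 (letter_shift n) u v" by (simp add: shift_equivalent_letter_shift)
    then show "list_all2 R u v"
      by (rule list.rel_mono_strong) (use v in \<open>auto simp: R_def anchored_def\<close>)
  qed
  ultimately show ?thesis by (rule finite_subset[rotated])
qed

text \<open>Only finitely many shift classes of each length act nontrivially on a basis element, and
  each contains finitely many anchored words. For the completion, words of bounded length with
  bounded indices are finite in number anyway.\<close>

lemma anchored_carrier:
  assumes "2 \<le> n"
    and "\<And>u. f u \<noteq> 0 \<Longrightarrow> set u \<subseteq> fk_symbols n \<and> length u \<le> m \<and> anchored lo hi u"
  shows "f \<in> carrier (fk_E n)"
  unfolding carrier_fk_E fk_completion_def
proof (intro conjI CollectI allI impI ballI)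
  show "set u \<subseteq> fk_symbols n" if "f u \<noteq> 0" for u using assms(2) that by blast
  show "finite {u. f u \<noteq> 0 \<and> (\<forall>(i, j)\<in>set u. \<bar>i\<bar> < N \<and> \<bar>j\<bar> < N)}" for N
  proof (rule finite_subset)
    show "{u. f u \<noteq> 0 \<and> (\<forall>(i, j)\<in>set u. \<bar>i\<bar> < N \<and> \<bar>j\<bar> < N)} \<subseteq>
      {u. set u \<subseteq> {-N..N} \<times> {-N..N} \<and> length u \<le> m}"
      using assms(2) by fastforce
  qed (simp add: finite_lists_length_le)
  fix w assume "w \<in> affine_perms n"
  have "\<exists>U. finite U \<and> (\<forall>u. length u = k \<and> set u \<subseteq> fk_symbols n \<and> descent_word n w u \<longrightarrow>
    (\<exists>v\<in>U. shift_equivalent n v u))" for k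
    by (rule finite_descent_classes[OF assms(1)])
  then obtain U where U: "\<And>k. finite (U k)"
    "\<And>k u. length u = k \<Longrightarrow> set u \<subseteq> fk_symbols n \<Longrightarrow> descent_word n w u \<Longrightarrow>
      \<exists>v\<in>U k. shift_equivalent n v u"
    by metis
  show "finite {u. f u \<noteq> 0 \<and> descent_word n w u}"
  proof (rule finite_subset)
    show "{u. f u \<noteq> 0 \<and> descent_word n w u} \<subseteq>
      (\<Union>k\<le>m. \<Union>v\<in>U k. {u. shift_equivalent n v u \<and> anchored lo hi u})"
    proof clarify
      fix u assume u: "f u \<noteq> 0" "descent_word n w u"
      with assms(2)[of u] U(2)[of u "length u"] obtain v where
        "v \<in> U (length u)" "shift_equivalent n v u" "length u \<le> m" "anchored lo hi u" by blast
      then show "u \<in> (\<Union>k\<le>m. \<Union>v\<in>U k. {u. shift_equivalent n v u \<and> anchored lo hi u})"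
        by blast
    qed
  qed (use U(1) finite_shift_anchored in auto)
qed

lemma fk_bracket_edge: "fk_bracket i j = (if i < j then fk_word [edge i j] else - fk_word [edge i j])"
  by (auto simp: fk_bracket_def edge_def fun_eq_iff)

lemma fk_bracket_swap: "i \<noteq> j \<Longrightarrow> fk_bracket j i = - fk_bracket i j"
  by (auto simp: fk_bracket_edge edge_commute[of j i])

lemma fk_bracket_nonzero: "fk_bracket i j v \<noteq> 0 \<Longrightarrow> v = [edge i j]"
  by (auto simp: fk_bracket_edge fk_word_def split: if_splits)

lemma fk_bracket_mult_nonzero:
  "(fk_bracket i j \<star> fk_bracket k l) v \<noteq> 0 \<Longrightarrow> v = [edge i j, edge k l]"
  by (elim fk_mult_nonzeroE) (auto dest!: fk_bracket_nonzero)

lemma not_cong_neq: "\<not> [i = j] (mod m) \<Longrightarrow> i \<noteq> j"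
  by auto

lemma edge_symbol: "\<not> [i = j] (mod int n) \<Longrightarrow> edge i j \<in> fk_symbols n"
proof -
  assume ij: "\<not> [i = j] (mod int n)"
  then consider "i < j" | "j < i" by (metis cong_refl linorder_less_linear)
  then show ?thesis using ij by cases (auto simp: edge_def fk_symbols_def cong_sym_eq)
qed

lemma fk_bracket_carrier: "\<not> [i = j] (mod int n) \<Longrightarrow> fk_bracket i j \<in> carrier (fk_E n)"
  using edge_symbol[of i j n]
  by (auto simp: fk_bracket_edge intro!: fk_word_carrier fk_E_uminus_closed)

lemma fk_sum_nonzeroE:
  assumes "fk_sum I F v \<noteq> 0" obtains x where "x \<in> I" "F x v \<noteq> 0"
  using assms unfolding fk_sum_def by (metis (mono_tags, lifting) mem_Collect_eq sum.neutral)

lemma anchored_Nil [simp]: "anchored lo hi []"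
  by (simp add: anchored_def)

lemma anchored_Cons [simp]: "anchored lo hi (e # u) \<longleftrightarrow> fst e \<le> hi \<and> lo \<le> snd e \<and> anchored lo hi u"
  by (auto simp: anchored_def)

lemma anchored_edge: "fst (edge x y) \<le> hi \<and> lo \<le> snd (edge x y)" if "lo \<le> x" "x \<le> hi"
  using that by (auto simp: edge_def)

lemma fk_relations_carrier:
  assumes "2 \<le> n" "f \<in> fk_relations n"
  shows "f \<in> carrier (fk_E n)"
proof -
  note mult = fk_E_mult_closed[OF assms(1)]
  have fd: "(\<lambda>u. g u - h u) = g - h" for g h :: "'a fk_series"
    by (auto simp: fun_eq_iff)
  have fd2: "(\<lambda>u. g u - (h u + k u)) = g - (h + k)" for g h k :: "'a fk_series"
    by (auto simp: fun_eq_iff)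
  show ?thesis using assms(2)
  proof (cases rule: fk_relations.cases)
    case (square i j)
    show ?thesis unfolding square(1)
      by (intro mult fk_bracket_carrier) (use square(2) in \<open>auto simp: cong_def\<close>)
  next
    case (commute i j k l)
    show ?thesis unfolding commute(1) fd
      by (intro fk_E_diff_closed mult fk_bracket_carrier) (use commute(2) in \<open>auto simp: cong_def\<close>)
  next
    case (triple1 i j k)
    show ?thesis unfolding triple1(1) fd2
      by (intro fk_E_diff_closed fk_E_add_closed mult fk_bracket_carrier)
        (use triple1(2) in \<open>auto simp: cong_def\<close>)
  next
    case (triple2 i j k)
    show ?thesis unfolding triple2(1) fd2
      by (intro fk_E_diff_closed fk_E_add_closed mult fk_bracket_carrier)
        (use triple2(2) in \<open>auto simp: cong_def\<close>)
  next
    case (infinite i j)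
    show ?thesis
    proof (rule anchored_carrier[OF assms(1)])
      fix u assume "f u \<noteq> 0"
      then obtain i' j' where ij: "[i' = i] (mod int n)" "[j' = j] (mod int n)"
        "(fk_bracket i j' \<star> fk_bracket j i' :: 'a fk_series) u \<noteq> 0"
        unfolding infinite(1) by (elim fk_sum_nonzeroE) auto
      then have u: "u = [edge i j', edge j i']" by (intro fk_bracket_mult_nonzero)
      have "\<not> [i = j'] (mod int n)" "\<not> [j = i'] (mod int n)"
        using ij(1,2) infinite(2) by (auto simp: cong_def)
      then show "set u \<subseteq> fk_symbols n \<and> length u \<le> 2 \<and> anchored (min i j) (max i j) u"
        using edge_symbol[of i j' n] edge_symbol[of j i' n]
        by (auto simp: u intro!: anchored_edge)
           (simp_all add: edge_def min_def max_def)
    qed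
  next
    case (shift i j)
    show ?thesis unfolding shift(1) fd
      by (intro fk_E_diff_closed fk_bracket_carrier) (use shift(2) in \<open>auto simp: cong_def\<close>)
  qed
qed

section \<open>The closed ideal and its infinite sums\<close>

lemma Idl_ideal:
  assumes "2 \<le> n"
  shows "ideal (Idl\<^bsub>fk_E n\<^esub> (fk_relations n :: 'k::comm_ring_1 fk_series set)) (fk_E n)"
  using ring.genideal_ideal[OF fk_E_ring[OF assms]] fk_relations_carrier[OF assms] by blast

lemma fk_sum_eq_sum:
  assumes "finite A" "A \<subseteq> I" "\<And>x. x \<in> I \<Longrightarrow> x \<notin> A \<Longrightarrow> F x v = 0"
  shows "fk_sum I F v = (\<Sum>x\<in>A. F x v)"
  unfolding fk_sum_def using assms by (intro sum.mono_neutral_left) auto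

context
  fixes n :: nat assumes n: "2 \<le> n"
begin

lemma Idl_zero: "(0 :: 'k::comm_ring_1 fk_series) \<in> Idl\<^bsub>fk_E n\<^esub> (fk_relations n)"
  using additive_subgroup.zero_closed[OF ideal.axioms(1)[OF Idl_ideal[OF n]]] by simp

lemma Idl_carrier: "g \<in> Idl\<^bsub>fk_E n\<^esub> (fk_relations n) \<Longrightarrow> g \<in> carrier (fk_E n)"
  using additive_subgroup.a_Hcarr[OF ideal.axioms(1)[OF Idl_ideal[OF n]]] .

lemma Idl_add:
  "f \<in> Idl\<^bsub>fk_E n\<^esub> (fk_relations n) \<Longrightarrow> g \<in> Idl\<^bsub>fk_E n\<^esub> (fk_relations n) \<Longrightarrow>
    f + g \<in> Idl\<^bsub>fk_E n\<^esub> (fk_relations n)"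
  using additive_subgroup.a_closed[OF ideal.axioms(1)[OF Idl_ideal[OF n]], of f g] by simp

lemma Idl_uminus:
  "f \<in> Idl\<^bsub>fk_E n\<^esub> (fk_relations n) \<Longrightarrow> - f \<in> Idl\<^bsub>fk_E n\<^esub> (fk_relations n)"
  using additive_subgroup.a_inv_closed[OF ideal.axioms(1)[OF Idl_ideal[OF n]], of f]
    fk_E_a_inv[OF n Idl_carrier[of f]] by simp

lemma fk_idealD: "f \<in> fk_ideal n \<Longrightarrow> f \<in> carrier (fk_E n)"
  by (simp add: fk_ideal_def)

lemma fk_idealE:
  assumes "f \<in> fk_ideal n" "finite U"
  obtains g where "g \<in> Idl\<^bsub>fk_E n\<^esub> (fk_relations n)"
    "\<And>u v. u \<in> U \<Longrightarrow> shift_equivalent n u v \<Longrightarrow> f v = g v"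
  using assms by (auto simp: fk_ideal_def)

lemma fk_idealI:
  assumes "f \<in> carrier (fk_E n)"
    and "\<And>U. finite U \<Longrightarrow> \<exists>g\<in>Idl\<^bsub>fk_E n\<^esub> (fk_relations n). \<forall>u\<in>U. \<forall>v. shift_equivalent n u v \<longrightarrow> f v = g v"
  shows "f \<in> fk_ideal n"
  using assms by (simp add: fk_ideal_def)

lemma Idl_fk_ideal: "f \<in> Idl\<^bsub>fk_E n\<^esub> (fk_relations n) \<Longrightarrow> f \<in> fk_ideal n"
  using Idl_carrier by (auto simp: fk_ideal_def)

lemma fk_relations_fk_ideal: "f \<in> fk_relations n \<Longrightarrow> f \<in> fk_ideal n"
  using ring.genideal_self[OF fk_E_ring[OF n]] fk_relations_carrier[OF n]
  by (intro Idl_fk_ideal) blast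

lemma fk_ideal_zero: "0 \<in> fk_ideal n"
  by (rule Idl_fk_ideal[OF Idl_zero])

lemma fk_ideal_add:
  assumes "f \<in> fk_ideal n" "g \<in> fk_ideal n"
  shows "f + g \<in> fk_ideal n"
proof (rule fk_idealI)
  show "f + g \<in> carrier (fk_E n)" using assms by (intro fk_E_add_closed fk_idealD)
  fix U :: "(int \<times> int) list set" assume U: "finite U"
  obtain f' where f': "f' \<in> Idl\<^bsub>fk_E n\<^esub> (fk_relations n)"
    "\<And>u v. u \<in> U \<Longrightarrow> shift_equivalent n u v \<Longrightarrow> f v = f' v" using fk_idealE[OF assms(1) U] by blast
  obtain g' where g': "g' \<in> Idl\<^bsub>fk_E n\<^esub> (fk_relations n)"
    "\<And>u v. u \<in> U \<Longrightarrow> shift_equivalent n u v \<Longrightarrow> g v = g' v" using fk_idealE[OF assms(2) U] by blast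
  show "\<exists>h\<in>Idl\<^bsub>fk_E n\<^esub> (fk_relations n). \<forall>u\<in>U. \<forall>v. shift_equivalent n u v \<longrightarrow> (f + g) v = h v"
    using f' g' by (intro bexI[of _ "f' + g'"] Idl_add) auto
qed

lemma fk_ideal_uminus:
  assumes "f \<in> fk_ideal n"
  shows "- f \<in> fk_ideal n"
proof (rule fk_idealI)
  show "- f \<in> carrier (fk_E n)" using assms by (intro fk_E_uminus_closed fk_idealD)
  fix U :: "(int \<times> int) list set" assume U: "finite U"
  obtain f' where f': "f' \<in> Idl\<^bsub>fk_E n\<^esub> (fk_relations n)"
    "\<And>u v. u \<in> U \<Longrightarrow> shift_equivalent n u v \<Longrightarrow> f v = f' v" using fk_idealE[OF assms(1) U] by blast
  show "\<exists>h\<in>Idl\<^bsub>fk_E n\<^esub> (fk_relations n). \<forall>u\<in>U. \<forall>v. shift_equivalent n u v \<longrightarrow> (- f) v = h v"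
    using f' by (intro bexI[of _ "- f'"] Idl_uminus) auto
qed

lemma fk_ideal_diff: "f \<in> fk_ideal n \<Longrightarrow> g \<in> fk_ideal n \<Longrightarrow> f - g \<in> fk_ideal n"
  using fk_ideal_add[of f "- g"] fk_ideal_uminus by fastforce

lemma fk_ideal_sum: "(\<And>x. x \<in> A \<Longrightarrow> F x \<in> fk_ideal n) \<Longrightarrow> sum F A \<in> fk_ideal n"
  by (induction A rule: infinite_finite_induct)
    (simp_all add: fk_ideal_zero fk_ideal_add del: zero_fun_apply plus_fun_apply)

lemma shift_equivalent_take_drop:
  assumes "shift_equivalent n u v"
  shows "shift_equivalent n (take k u) (take k v)" "shift_equivalent n (drop k u) (drop k v)"
    "length u = length v"
  using assms by (auto simp: shift_equivalent_def list_all2_takeI list_all2_dropI list_all2_lengthD)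

text \<open>The value of the product at \<open>v\<close> involves \<open>f\<close> only at suffixes
  of \<open>v\<close>, and shift equivalence passes to suffixes. So it suffices to approximate
  \<open>f\<close> on the finitely many classes of suffixes of words in \<open>U\<close>.\<close>

lemma fk_ideal_mult_left:
  assumes "f \<in> fk_ideal n" "r \<in> carrier (fk_E n)"
  shows "r \<star> f \<in> fk_ideal n"
proof (rule fk_idealI)
  show "r \<star> f \<in> carrier (fk_E n)" using fk_E_mult_closed[OF n] fk_idealD[OF assms(1)] assms(2) by blast
  fix U :: "(int \<times> int) list set" assume U: "finite U"
  define U' where "U' = (\<Union>u\<in>U. (\<lambda>k. drop k u) ` {..length u})"
  have "finite U'" using U by (simp add: U'_def)
  then obtain f' where f': "f' \<in> Idl\<^bsub>fk_E n\<^esub> (fk_relations n)"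
    "\<And>u v. u \<in> U' \<Longrightarrow> shift_equivalent n u v \<Longrightarrow> f v = f' v" using fk_idealE[OF assms(1)] by blast
  have "(r \<star> f) v = (r \<star> f') v" if uv: "u \<in> U" "shift_equivalent n u v" for u v
    unfolding fk_mult_def
  proof (rule sum.cong[OF refl])
    fix k assume "k \<in> {..length v}"
    then have "drop k u \<in> U'"
      unfolding U'_def using shift_equivalent_take_drop(3)[OF uv(2)]
      by (intro UN_I[OF uv(1)] imageI) simp
    then show "r (take k v) * f (drop k v) = r (take k v) * f' (drop k v)"
      using f'(2)[OF _ shift_equivalent_take_drop(2)[OF uv(2)]] by simp
  qed
  moreover have "r \<star> f' \<in> Idl\<^bsub>fk_E n\<^esub> (fk_relations n)"
    using ideal.I_l_closed[OF Idl_ideal[OF n] f'(1) assms(2)] by simp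
  ultimately show "\<exists>h\<in>Idl\<^bsub>fk_E n\<^esub> (fk_relations n). \<forall>u\<in>U. \<forall>v. shift_equivalent n u v \<longrightarrow> (r \<star> f) v = h v"
    by blast
qed

lemma fk_ideal_mult_right:
  assumes "f \<in> fk_ideal n" "r \<in> carrier (fk_E n)"
  shows "f \<star> r \<in> fk_ideal n"
proof (rule fk_idealI)
  show "f \<star> r \<in> carrier (fk_E n)" using fk_E_mult_closed[OF n] fk_idealD[OF assms(1)] assms(2) by blast
  fix U :: "(int \<times> int) list set" assume U: "finite U"
  define U' where "U' = (\<Union>u\<in>U. (\<lambda>k. take k u) ` {..length u})"
  have "finite U'" using U by (simp add: U'_def)
  then obtain f' where f': "f' \<in> Idl\<^bsub>fk_E n\<^esub> (fk_relations n)"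
    "\<And>u v. u \<in> U' \<Longrightarrow> shift_equivalent n u v \<Longrightarrow> f v = f' v" using fk_idealE[OF assms(1)] by blast
  have "(f \<star> r) v = (f' \<star> r) v" if uv: "u \<in> U" "shift_equivalent n u v" for u v
    unfolding fk_mult_def
  proof (rule sum.cong[OF refl])
    fix k assume "k \<in> {..length v}"
    then have "take k u \<in> U'"
      unfolding U'_def using shift_equivalent_take_drop(3)[OF uv(2)]
      by (intro UN_I[OF uv(1)] imageI) simp
    then show "f (take k v) * r (drop k v) = f' (take k v) * r (drop k v)"
      using f'(2)[OF _ shift_equivalent_take_drop(1)[OF uv(2)]] by simp
  qed
  moreover have "f' \<star> r \<in> Idl\<^bsub>fk_E n\<^esub> (fk_relations n)"
    using ideal.I_r_closed[OF Idl_ideal[OF n] f'(1) assms(2)] by simp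
  ultimately show "\<exists>h\<in>Idl\<^bsub>fk_E n\<^esub> (fk_relations n). \<forall>u\<in>U. \<forall>v. shift_equivalent n u v \<longrightarrow> (f \<star> r) v = h v"
    by blast
qed

lemma fk_ideal_ideal: "ideal (fk_ideal n :: 'k::comm_ring_1 fk_series set) (fk_E n)"
proof (rule idealI[OF fk_E_ring[OF n]])
  show "subgroup (fk_ideal n :: 'k fk_series set) (add_monoid (fk_E n))"
  proof (rule group.subgroupI)
    show "Group.group (add_monoid (fk_E n :: 'k fk_series ring))"
      using abelian_group.a_group[OF ring.is_abelian_group[OF fk_E_ring[OF n]]] .
    show "inv\<^bsub>add_monoid (fk_E n)\<^esub> f \<in> fk_ideal n" if "f \<in> fk_ideal n" for f :: "'k fk_series"
      using fk_ideal_uminus[OF that] fk_E_a_inv[OF n fk_idealD[OF that]] by (simp add: a_inv_def)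
  qed (use fk_ideal_zero fk_ideal_add fk_idealD in auto)
qed (simp_all add: fk_ideal_mult_left fk_ideal_mult_right)

text \<open>On finitely many shift classes the infinite sum agrees with a finite partial sum, which
  lies in the ideal. This is what the closure is made for.\<close>

lemma fk_ideal_fk_sum:
  assumes F: "\<And>x. x \<in> I \<Longrightarrow> F x \<in> fk_ideal n" and carrier: "fk_sum I F \<in> carrier (fk_E n)"
    and fin: "\<And>u. finite {x \<in> I. \<exists>v. shift_equivalent n u v \<and> F x v \<noteq> 0}"
  shows "fk_sum I F \<in> fk_ideal n"
proof (rule fk_idealI[OF carrier])
  fix U :: "(int \<times> int) list set" assume U: "finite U"
  define K where "K = (\<Union>u\<in>U. {x \<in> I. \<exists>v. shift_equivalent n u v \<and> F x v \<noteq> 0})"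
  have "finite K" "K \<subseteq> I" using U fin by (auto simp: K_def)
  then have "sum F K \<in> fk_ideal n" using F by (intro fk_ideal_sum) auto
  then obtain g where g: "g \<in> Idl\<^bsub>fk_E n\<^esub> (fk_relations n)"
    "\<And>u v. u \<in> U \<Longrightarrow> shift_equivalent n u v \<Longrightarrow> (sum F K) v = g v" using fk_idealE[OF _ U] by blast
  have sum_apply: "(sum F A) v = (\<Sum>x\<in>A. F x v)" for A v
    by (induction A rule: infinite_finite_induct) auto
  have "fk_sum I F v = g v" if "u \<in> U" "shift_equivalent n u v" for u v
  proof -
    have "fk_sum I F v = (\<Sum>x\<in>K. F x v)"
      using \<open>finite K\<close> \<open>K \<subseteq> I\<close> that by (intro fk_sum_eq_sum) (auto simp: K_def)
    then show ?thesis using g(2)[OF that] by (simp add: sum_apply)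
  qed
  then show "\<exists>g\<in>Idl\<^bsub>fk_E n\<^esub> (fk_relations n). \<forall>u\<in>U. \<forall>v. shift_equivalent n u v \<longrightarrow> fk_sum I F v = g v"
    using g(1) by blast
qed

text \<open>A shift class has finitely many anchored words, and each of these occurs in finitely
  many terms. All infinite applications of relations below go through this form.\<close>

lemma fk_ideal_anchored_sum:
  assumes F: "\<And>x. x \<in> I \<Longrightarrow> F x \<in> fk_ideal n"
    and anch: "\<And>x v. x \<in> I \<Longrightarrow> F x v \<noteq> 0 \<Longrightarrow> length v \<le> m \<and> anchored lo hi v"
    and fin: "\<And>v. finite {x \<in> I. F x v \<noteq> 0}"
  shows "fk_sum I F \<in> fk_ideal n"
proof (rule fk_ideal_fk_sum[OF F])
  have "set u \<subseteq> fk_symbols n" if "x \<in> I" "F x u \<noteq> 0" for x u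
    using fk_idealD[OF F[OF that(1)]] that(2) by (auto simp: carrier_fk_E fk_completion_def)
  then show "fk_sum I F \<in> carrier (fk_E n)"
    using anch by (intro anchored_carrier[OF n, of _ m lo hi]) (blast elim: fk_sum_nonzeroE)
  fix u
  have "{x \<in> I. \<exists>v. shift_equivalent n u v \<and> F x v \<noteq> 0} \<subseteq>
    (\<Union>v\<in>{v. shift_equivalent n u v \<and> anchored lo hi v}. {x \<in> I. F x v \<noteq> 0})"
    using anch by blast
  then show "finite {x \<in> I. \<exists>v. shift_equivalent n u v \<and> F x v \<noteq> 0}"
    by (rule finite_subset) (use fin finite_shift_anchored in blast)
qed

end

section \<open>Powers of the theta element\<close>

definition summable_family :: "'i set \<Rightarrow> ('i \<Rightarrow> 'k::comm_ring_1 fk_series) \<Rightarrow> bool" where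
  "summable_family I F \<longleftrightarrow> (\<forall>v. finite {x \<in> I. F x v \<noteq> 0})"

lemma sum_fun_apply: "(sum F A) v = (\<Sum>x\<in>A. F x v)" for F :: "'i \<Rightarrow> 'k::comm_ring_1 fk_series"
  by (induction A rule: infinite_finite_induct) auto

text \<open>A word has finitely many splittings, and each piece occurs in finitely many terms of its
  family, so at each word only a finite product of index sets contributes.\<close>

lemma fk_sum_mult:
  assumes "summable_family I F" "summable_family J G"
  shows "summable_family (I \<times> J) (\<lambda>(x, y). F x \<star> G y)"
    and "fk_sum I F \<star> fk_sum J G = fk_sum (I \<times> J) (\<lambda>(x, y). F x \<star> G y)"
proof -
  define A where "A = (\<lambda>v. \<Union>k\<le>length v. {x \<in> I. F x (take k v) \<noteq> 0})"
  define B where "B = (\<lambda>v. \<Union>k\<le>length v. {y \<in> J. G y (drop k v) \<noteq> 0})"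
  have fin: "finite (A v)" "finite (B v)" for v
    using assms by (auto simp: A_def B_def summable_family_def)
  have AB: "(x, y) \<in> A v \<times> B v" if xy: "(x, y) \<in> I \<times> J" "(F x \<star> G y) v \<noteq> 0" for x y v
  proof -
    obtain p q where pq: "v = p @ q" "F x p \<noteq> 0" "G y q \<noteq> 0"
      using fk_mult_nonzeroE[OF xy(2)] by blast
    then show ?thesis
      using xy(1) by (auto simp: A_def B_def intro!: bexI[of _ "length p"])
  qed
  show "summable_family (I \<times> J) (\<lambda>(x, y). F x \<star> G y)"
    unfolding summable_family_def
  proof
    fix v
    show "finite {z \<in> I \<times> J. (case z of (x, y) \<Rightarrow> F x \<star> G y) v \<noteq> 0}"
      by (rule finite_subset[of _ "A v \<times> B v"]) (use AB fin in auto)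
  qed
  show "fk_sum I F \<star> fk_sum J G = fk_sum (I \<times> J) (\<lambda>(x, y). F x \<star> G y)"
  proof
    fix v
    have sF: "fk_sum I F (take k v) = (\<Sum>x\<in>A v. F x (take k v))" if "k \<le> length v" for k
      by (rule fk_sum_eq_sum) (use fin that in \<open>auto simp: A_def\<close>)
    have sG: "fk_sum J G (drop k v) = (\<Sum>y\<in>B v. G y (drop k v))" if "k \<le> length v" for k
      by (rule fk_sum_eq_sum) (use fin that in \<open>auto simp: B_def\<close>)
    have "(fk_sum I F \<star> fk_sum J G) v = (\<Sum>k\<le>length v. (\<Sum>x\<in>A v. F x (take k v)) * (\<Sum>y\<in>B v. G y (drop k v)))"
      unfolding fk_mult_def using sF sG by simp
    also have "\<dots> = (\<Sum>k\<le>length v. \<Sum>(x, y)\<in>A v \<times> B v. F x (take k v) * G y (drop k v))"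
      by (simp add: sum_product sum.cartesian_product)
    also have "\<dots> = (\<Sum>(x, y)\<in>A v \<times> B v. (F x \<star> G y) v)"
      unfolding fk_mult_def by (subst sum.swap) (simp add: case_prod_unfold)
    also have "\<dots> = (\<Sum>z\<in>A v \<times> B v. (case z of (x, y) \<Rightarrow> F x \<star> G y) v)"
      by (simp add: case_prod_unfold)
    also have "\<dots> = fk_sum (I \<times> J) (\<lambda>(x, y). F x \<star> G y) v"
      by (rule fk_sum_eq_sum[symmetric]) (use fin AB in \<open>auto simp: A_def B_def\<close>)
    finally show "(fk_sum I F \<star> fk_sum J G) v = fk_sum (I \<times> J) (\<lambda>(x, y). F x \<star> G y) v" .
  qed
qed

lemma fk_sum_add:
  assumes "summable_family I F" "summable_family I G"
  shows "summable_family I (\<lambda>x. F x + G x)" "fk_sum I (\<lambda>x. F x + G x) = fk_sum I F + fk_sum I G"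
proof -
  define A where "A = (\<lambda>v. {x \<in> I. F x v \<noteq> 0} \<union> {x \<in> I. G x v \<noteq> 0})"
  have A: "finite (A v)" "A v \<subseteq> I" for v
    using assms by (auto simp: A_def summable_family_def)
  show "summable_family I (\<lambda>x. F x + G x)"
    unfolding summable_family_def
  proof
    fix v show "finite {x \<in> I. (F x + G x) v \<noteq> 0}"
      by (rule finite_subset[OF _ A(1)[of v]]) (auto simp: A_def)
  qed
  show "fk_sum I (\<lambda>x. F x + G x) = fk_sum I F + fk_sum I G"
  proof
    fix v
    have "fk_sum I (\<lambda>x. F x + G x) v = (\<Sum>x\<in>A v. (F x + G x) v)"
      by (rule fk_sum_eq_sum[OF A]) (auto simp: A_def)
    moreover have "fk_sum I F v = (\<Sum>x\<in>A v. F x v)"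
      by (rule fk_sum_eq_sum[OF A]) (auto simp: A_def)
    moreover have "fk_sum I G v = (\<Sum>x\<in>A v. G x v)"
      by (rule fk_sum_eq_sum[OF A]) (auto simp: A_def)
    ultimately show "fk_sum I (\<lambda>x. F x + G x) v = (fk_sum I F + fk_sum I G) v"
      by (simp add: sum.distrib)
  qed
qed

lemma fk_sum_uminus:
  assumes "summable_family I F"
  shows "summable_family I (\<lambda>x. - F x)" "fk_sum I (\<lambda>x. - F x) = - fk_sum I F"
  using assms by (auto simp: summable_family_def fk_sum_def fun_eq_iff sum_negf)

lemma fk_sum_diff:
  assumes "summable_family I F" "summable_family I G"
  shows "summable_family I (\<lambda>x. F x - G x)" "fk_sum I (\<lambda>x. F x - G x) = fk_sum I F - fk_sum I G"
  using fk_sum_add[OF assms(1) fk_sum_uminus(1)[OF assms(2)]] fk_sum_uminus(2)[OF assms(2)] by simp_all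

lemma fk_sum_reindex:
  assumes "bij_betw h I J" "summable_family J F"
  shows "summable_family I (\<lambda>x. F (h x))" "fk_sum I (\<lambda>x. F (h x)) = fk_sum J F"
proof -
  have inj: "inj_on h I" and im: "h ` I = J" using assms(1) by (auto simp: bij_betw_def)
  have eq: "{y \<in> J. F y v \<noteq> 0} = h ` {x \<in> I. F (h x) v \<noteq> 0}" for v using im by auto
  have injA: "inj_on h {x \<in> I. F (h x) v \<noteq> 0}" for v using inj by (rule inj_on_subset) auto
  show "summable_family I (\<lambda>x. F (h x))"
    unfolding summable_family_def
  proof
    fix v show "finite {x \<in> I. F (h x) v \<noteq> 0}"
      by (rule finite_imageD[OF _ injA]) (use assms(2) eq in \<open>auto simp: summable_family_def\<close>)
  qed
  show "fk_sum I (\<lambda>x. F (h x)) = fk_sum J F"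
    unfolding fk_sum_def eq by (rule ext) (simp add: sum.reindex[OF injA])
qed

lemma summable_family_bracket: "summable_family I (fk_bracket b)"
  unfolding summable_family_def
proof
  fix v :: "(int \<times> int) list"
  show "finite {x \<in> I. fk_bracket b x v \<noteq> (0 :: 'a)}"
  proof (rule finite_subset)
    show "{x \<in> I. fk_bracket b x v \<noteq> (0 :: 'a)} \<subseteq> {x. v = [edge b x]}"
      using fk_bracket_nonzero by blast
    show "finite {x. v = [edge b x]}"
    proof (rule finite_subset)
      show "{x. v = [edge b x]} \<subseteq> {fst (hd v), snd (hd v)}"
        by (auto simp: edge_def min_def max_def)
    qed simp
  qed
qed

text \<open>The partial sum of theta at \<open>b\<close> over the residue class of \<open>c\<close>.
  Modulo the ideal it plays the role of the generator \<open>[bc]\<close> of the finite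
  Fomin-Kirillov algebra on residues.\<close>

definition fk_part :: "nat \<Rightarrow> int \<Rightarrow> int \<Rightarrow> 'k::comm_ring_1 fk_series" where
  "fk_part n b c = fk_sum {j. [j = c] (mod int n)} (fk_bracket b)"

lemma fk_part_mult:
  "summable_family ({x. [x = b] (mod int n)} \<times> {y. [y = d] (mod int n)})
    (\<lambda>(x, y). fk_bracket a x \<star> fk_bracket c y :: 'k::comm_ring_1 fk_series)"
  "fk_part n a b \<star> fk_part n c d = fk_sum ({x. [x = b] (mod int n)} \<times> {y. [y = d] (mod int n)})
    (\<lambda>(x, y). fk_bracket a x \<star> fk_bracket c y :: 'k::comm_ring_1 fk_series)"
  unfolding fk_part_def by (rule fk_sum_mult; rule summable_family_bracket)+

lemma cong_diff_iff:
  fixes x y b c :: int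
  assumes "[x = b] (mod m)"
  shows "[y - x + b = c] (mod m) \<longleftrightarrow> [y = c] (mod m)"
proof -
  have "[y - x + b = y - x + x] (mod m)" by (rule cong_add[OF cong_refl cong_sym[OF assms]])
  then have "[y - x + b = y] (mod m)" by simp
  then show ?thesis by (simp add: cong_def)
qed

context
  fixes n :: nat assumes n: "2 \<le> n"
begin

lemma fk_part_carrier:
  assumes "\<not> [b = c] (mod int n)"
  shows "fk_part n b c \<in> carrier (fk_E n)"
proof (rule anchored_carrier[OF n, of _ 1 b b])
  fix u assume "fk_part n b c u \<noteq> (0 :: 'a)"
  then obtain j where j: "[j = c] (mod int n)" "fk_bracket b j u \<noteq> (0 :: 'a)"
    unfolding fk_part_def by (elim fk_sum_nonzeroE) simp
  then have "\<not> [b = j] (mod int n)" using assms by (simp add: cong_def)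
  then show "set u \<subseteq> fk_symbols n \<and> length u \<le> 1 \<and> anchored b b u"
    using fk_bracket_nonzero[OF j(2)] edge_symbol anchored_edge[of b b b j] by auto
qed

lemma fk_bracket_shift_nat:
  assumes "\<not> [i = j] (mod int n)"
  shows "fk_bracket i j - fk_bracket (i + int m * int n) (j + int m * int n) \<in> fk_ideal n"
proof (induction m)
  case 0
  then show ?case using fk_ideal_zero[OF n] by (simp del: zero_fun_apply)
next
  case (Suc m)
  let ?i = "i + int m * int n" and ?j = "j + int m * int n"
  have "distinct_residues n [?i, ?j]" using assms by (simp add: cong_def)
  from fk_relations_fk_ideal[OF n fk_relations.shift[OF this]]
  have "fk_bracket ?i ?j - fk_bracket (?i + int n) (?j + int n) \<in> fk_ideal n"
    by (simp add: fun_diff_def)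
  from fk_ideal_add[OF n Suc this] show ?case
    by (simp add: algebra_simps del: plus_fun_apply minus_apply)
qed

lemma fk_bracket_shift:
  assumes "\<not> [i = j] (mod int n)" "[i = i'] (mod int n)" "i' - i = j' - j"
  shows "fk_bracket i j - fk_bracket i' j' \<in> fk_ideal n"
proof -
  obtain m where m: "i' = i + m * int n" using cong_sym[OF assms(2)] unfolding cong_iff_shift by blast
  have j': "j' = j + m * int n" using m assms(3) by simp
  show ?thesis
  proof (cases "0 \<le> m")
    case True
    then show ?thesis using fk_bracket_shift_nat[OF assms(1), of "nat m"] by (simp add: m j')
  next
    case False
    have "\<not> [i' = j'] (mod int n)" using assms(1) by (simp add: m j' cong_def)
    from fk_bracket_shift_nat[OF this, of "nat (- m)"] False
    have "fk_bracket i' j' - fk_bracket i j \<in> fk_ideal n" by (simp add: m j')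
    from fk_ideal_uminus[OF n this] show ?thesis by simp
  qed
qed

text \<open>For \<open>i'\<close> congruent to \<open>a\<close>, shifting gives
  \<open>[c i'] = - [i' c] = - [a, c + a - i']\<close> modulo the ideal. So each term
  \<open>[a j'][c i']\<close> of relation (d) is minus a term of the square, and every term of the
  square arises exactly once.\<close>

lemma fk_part_square:
  assumes "\<not> [a = c] (mod int n)"
  shows "fk_part n a c \<star> fk_part n a c \<in> fk_ideal n"
proof -
  define I where "I = {(i', j'). [i' = a] (mod int n) \<and> [j' = c] (mod int n)}"
  define D where "D = (\<lambda>(i', j'). fk_bracket a j' \<star> fk_bracket c i' :: 'a fk_series)"
  define G where "G = (\<lambda>(i', j'). fk_bracket a j' \<star> fk_bracket a (c + a - i') :: 'a fk_series)"
  have Isw: "bij_betw (\<lambda>(i', j'). (j', i')) I ({x. [x = c] (mod int n)} \<times> {y. [y = a] (mod int n)})"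
    by (rule bij_betwI[of _ _ _ "\<lambda>(x, y). (y, x)"]) (auto simp: I_def)
  have "bij_betw (\<lambda>(i', j'). (j', c + a - i')) I ({x. [x = c] (mod int n)} \<times> {y. [y = c] (mod int n)})"
  proof (rule bij_betwI[of _ _ _ "\<lambda>(x, y). (c + a - y, x)"])
    have "[c + a - x = c + a - y] (mod int n)" if "[x = y] (mod int n)" for x y
      by (rule cong_diff[OF cong_refl that])
    from this[of _ a] this[of _ c]
    show "(\<lambda>(i', j'). (j', c + a - i')) \<in> I \<rightarrow> {x. [x = c] (mod int n)} \<times> {y. [y = c] (mod int n)}"
      "(\<lambda>(x, y). (c + a - y, x)) \<in> {x. [x = c] (mod int n)} \<times> {y. [y = c] (mod int n)} \<rightarrow> I"
      by (auto simp: I_def)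
  qed auto
  note GF = fk_sum_reindex[OF this fk_part_mult(1)[where ?'k = 'a and n = n and a = a and c = a]]
  have Gs: "summable_family I G" "fk_sum I G = fk_part n a c \<star> fk_part n a c"
    using GF by (simp_all add: G_def case_prod_unfold fk_part_mult(2)[where ?'k = 'a and n = n and a = a and c = a])
  have Ds: "summable_family I D"
    using fk_sum_reindex(1)[OF Isw fk_part_mult(1)[where ?'k = 'a and n = n and a = a and c = c]]
    by (simp add: D_def case_prod_unfold)
  have Dr: "fk_sum I D \<in> fk_ideal n"
    unfolding I_def D_def using assms
    by (intro fk_relations_fk_ideal[OF n] fk_relations.infinite) (simp add: cong_def)
  have "fk_sum I (\<lambda>x. D x + G x) \<in> fk_ideal n"
  proof (rule fk_ideal_anchored_sum[OF n, where m = 2 and lo = "min a c" and hi = "max a c"])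
    fix x assume "x \<in> I"
    then obtain i' j' where x: "x = (i', j')" "[i' = a] (mod int n)" "[j' = c] (mod int n)"
      by (auto simp: I_def)
    have ne: "\<not> [i' = c] (mod int n)" "\<not> [a = j'] (mod int n)"
      using x(2,3) assms by (simp_all add: cong_def)
    have "fk_bracket i' c - fk_bracket a (c + a - i') \<in> (fk_ideal n :: 'a fk_series set)"
      by (rule fk_bracket_shift[OF ne(1) x(2)]) simp
    from fk_ideal_uminus[OF n fk_ideal_mult_left[OF n this fk_bracket_carrier[OF ne(2)]]]
    show "D x + G x \<in> fk_ideal n"
      using fk_bracket_swap[of i' c, where ?'a = 'a] not_cong_neq[OF ne(1)]
      by (simp add: D_def G_def x fk_mult_diff_right fk_mult_minus_right)
    fix v assume "(D x + G x) v \<noteq> 0"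
    then have "D x v \<noteq> 0 \<or> G x v \<noteq> 0" by auto
    then have "v = [edge a j', edge c i'] \<or> v = [edge a j', edge a (c + a - i')]"
      by (auto simp: D_def G_def x dest!: fk_bracket_mult_nonzero)
    then show "length v \<le> 2 \<and> anchored (min a c) (max a c) v"
      using anchored_edge[of "min a c" a "max a c"] anchored_edge[of "min a c" c "max a c"] by auto
  next
    fix v show "finite {x \<in> I. (D x + G x) v \<noteq> 0}"
      using fk_sum_add(1)[OF Ds Gs(1)] by (simp add: summable_family_def)
  qed
  then have "fk_sum I D + fk_part n a c \<star> fk_part n a c \<in> fk_ideal n"
    by (simp only: fk_sum_add(2)[OF Ds Gs(1)] Gs(2))
  from fk_ideal_diff[OF n this Dr] show ?thesis by simp
qed

lemma fk_part_commute:
  assumes "distinct_residues n [a, b, c, d]"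
  shows "fk_part n b c \<star> fk_part n a d - fk_part n a d \<star> fk_part n b c \<in> fk_ideal n"
proof -
  define I where "I = {x. [x = c] (mod int n)} \<times> {y. [y = d] (mod int n)}"
  define F where "F = (\<lambda>(x, y). fk_bracket b x \<star> fk_bracket a y :: 'a fk_series)"
  define G where "G = (\<lambda>(x, y). fk_bracket a y \<star> fk_bracket b x :: 'a fk_series)"
  have Fs: "summable_family I F" "fk_sum I F = fk_part n b c \<star> fk_part n a d"
    using fk_part_mult[where ?'k = 'a and n = n and a = b and b = c and c = a and d = d] by (simp_all add: I_def F_def)
  have bij: "bij_betw (\<lambda>(x, y). (y, x)) I ({y. [y = d] (mod int n)} \<times> {x. [x = c] (mod int n)})"
    by (rule bij_betwI[of _ _ _ "\<lambda>(x, y). (y, x)"]) (auto simp: I_def)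
  have Gs: "summable_family I G" "fk_sum I G = fk_part n a d \<star> fk_part n b c"
    using fk_sum_reindex[OF bij fk_part_mult(1)[where ?'k = 'a and n = n and a = a and c = b]]
      fk_part_mult(2)[where ?'k = 'a and n = n and a = a and b = d and c = b and d = c]
    by (simp_all add: G_def case_prod_unfold)
  have "fk_sum I (\<lambda>x. F x - G x) \<in> fk_ideal n"
  proof (rule fk_ideal_anchored_sum[OF n, where m = 2 and lo = "min a b" and hi = "max a b"])
    fix z assume "z \<in> I"
    then obtain x y where z: "z = (x, y)" "[x = c] (mod int n)" "[y = d] (mod int n)"
      by (auto simp: I_def)
    have "distinct_residues n [b, x, a, y]" using z assms by (auto simp: cong_def)
    from fk_relations_fk_ideal[OF n fk_relations.commute[OF this]]
    show "F z - G z \<in> fk_ideal n" by (simp add: F_def G_def z fun_diff_def)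
    fix v assume "(F z - G z) v \<noteq> 0"
    then have "F z v \<noteq> 0 \<or> G z v \<noteq> 0" by auto
    then have "v = [edge b x, edge a y] \<or> v = [edge a y, edge b x]"
      by (auto simp: F_def G_def z dest!: fk_bracket_mult_nonzero)
    then show "length v \<le> 2 \<and> anchored (min a b) (max a b) v"
      using anchored_edge[of "min a b" a "max a b"] anchored_edge[of "min a b" b "max a b"] by auto
  next
    fix v show "finite {x \<in> I. (F x - G x) v \<noteq> 0}"
      using fk_sum_diff(1)[OF Fs(1) Gs(1)] by (simp add: summable_family_def)
  qed
  then show ?thesis by (simp only: fk_sum_diff(2)[OF Fs(1) Gs(1)] Fs(2) Gs(2))
qed

text \<open>The triple relation for \<open>a\<close>, \<open>x\<close>, \<open>y\<close> is summed
  over \<open>x\<close> in the class of \<open>b\<close> and \<open>y\<close> in that of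
  \<open>c\<close>. Its factor \<open>[x y]\<close> is first shifted to
  \<open>[b, y - x + b]\<close>, so that the left index is fixed; after reindexing, the three
  families are the three products.\<close>

lemma fk_part_triple:
  assumes "distinct_residues n [a, b, c]"
  shows "fk_part n a b \<star> fk_part n b c - fk_part n b c \<star> fk_part n a c - fk_part n a c \<star> fk_part n a b
    \<in> fk_ideal n"
proof -
  define I where "I = {x. [x = b] (mod int n)} \<times> {y. [y = c] (mod int n)}"
  define F where "F = (\<lambda>(x, y). fk_bracket a x \<star> fk_bracket b (y - x + b) :: 'a fk_series)"
  define G where "G = (\<lambda>(x, y). fk_bracket b (y - x + b) \<star> fk_bracket a y :: 'a fk_series)"
  define H where "H = (\<lambda>(x, y). fk_bracket a y \<star> fk_bracket a x :: 'a fk_series)"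
  have ne: "\<not> [a = b] (mod int n)" "\<not> [a = c] (mod int n)" "\<not> [b = c] (mod int n)"
    using assms by (auto simp: cong_def)
  have bijF: "bij_betw (\<lambda>(x, y). (x, y - x + b)) I ({x. [x = b] (mod int n)} \<times> {y. [y = c] (mod int n)})"
  proof (rule bij_betwI[of _ _ _ "\<lambda>(x, y). (x, y + x - b)"])
    show "(\<lambda>(x, y). (x, y - x + b)) \<in> I \<rightarrow> {x. [x = b] (mod int n)} \<times> {y. [y = c] (mod int n)}"
      by (auto simp: I_def cong_diff_iff)
    have "[y + x - b = c] (mod int n)" if "[x = b] (mod int n)" "[y = c] (mod int n)" for x y
      using cong_diff_iff[OF cong_sym[OF that(1)], of y c] that(2) by (simp add: algebra_simps)
    then show "(\<lambda>(x, y). (x, y + x - b)) \<in> {x. [x = b] (mod int n)} \<times> {y. [y = c] (mod int n)} \<rightarrow> I"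
      by (auto simp: I_def)
  qed auto
  have Fs: "summable_family I F" "fk_sum I F = fk_part n a b \<star> fk_part n b c"
    using fk_sum_reindex[OF bijF fk_part_mult(1)[where ?'k = 'a and n = n and a = a and c = b]]
      fk_part_mult(2)[where ?'k = 'a and n = n and a = a and b = b and c = b and d = c]
    by (simp_all add: F_def case_prod_unfold)
  have bijG: "bij_betw (\<lambda>(x, y). (y - x + b, y)) I ({x. [x = c] (mod int n)} \<times> {y. [y = c] (mod int n)})"
  proof (rule bij_betwI[of _ _ _ "\<lambda>(x, y). (y - x + b, y)"])
    show "(\<lambda>(x, y). (y - x + b, y)) \<in> I \<rightarrow> {x. [x = c] (mod int n)} \<times> {y. [y = c] (mod int n)}"
      by (auto simp: I_def cong_diff_iff)
    have "[y - x + b = b] (mod int n)" if "[x = c] (mod int n)" "[y = c] (mod int n)" for x y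
    proof -
      have "[y - x + b = c - c + b] (mod int n)" by (rule cong_add[OF cong_diff[OF that(2,1)] cong_refl])
      then show ?thesis by simp
    qed
    then show "(\<lambda>(x, y). (y - x + b, y)) \<in> {x. [x = c] (mod int n)} \<times> {y. [y = c] (mod int n)} \<rightarrow> I"
      by (auto simp: I_def)
  qed auto
  have Gs: "summable_family I G" "fk_sum I G = fk_part n b c \<star> fk_part n a c"
    using fk_sum_reindex[OF bijG fk_part_mult(1)[where ?'k = 'a and n = n and a = b and c = a]]
      fk_part_mult(2)[where ?'k = 'a and n = n and a = b and b = c and c = a and d = c]
    by (simp_all add: G_def case_prod_unfold)
  have bijH: "bij_betw (\<lambda>(x, y). (y, x)) I ({y. [y = c] (mod int n)} \<times> {x. [x = b] (mod int n)})"
    by (rule bij_betwI[of _ _ _ "\<lambda>(x, y). (y, x)"]) (auto simp: I_def)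
  have Hs: "summable_family I H" "fk_sum I H = fk_part n a c \<star> fk_part n a b"
    using fk_sum_reindex[OF bijH fk_part_mult(1)[where ?'k = 'a and n = n and a = a and c = a]]
      fk_part_mult(2)[where ?'k = 'a and n = n and a = a and b = c and c = a and d = b]
    by (simp_all add: H_def case_prod_unfold)
  note FG = fk_sum_diff[OF Fs(1) Gs(1)]
  note FGH = fk_sum_diff[OF FG(1) Hs(1)]
  have "fk_sum I (\<lambda>x. F x - G x - H x) \<in> fk_ideal n"
  proof (rule fk_ideal_anchored_sum[OF n, where m = 2 and lo = "min a b" and hi = "max a b"])
    fix z assume "z \<in> I"
    then obtain x y where z: "z = (x, y)" "[x = b] (mod int n)" "[y = c] (mod int n)"
      by (auto simp: I_def)
    have dr: "distinct_residues n [a, x, y]" using z assms by (auto simp: cong_def)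
    have ne': "\<not> [a = x] (mod int n)" "\<not> [a = y] (mod int n)" "\<not> [x = y] (mod int n)"
      using dr by (auto simp: cong_def)
    define s :: "'a fk_series" where "s = fk_bracket x y - fk_bracket b (y - x + b)"
    have s: "s \<in> fk_ideal n" unfolding s_def
      by (rule fk_bracket_shift[OF ne'(3) z(2)]) simp
    from fk_relations_fk_ideal[OF n fk_relations.triple1[OF dr]]
    have t: "fk_bracket a x \<star> fk_bracket x y - (fk_bracket x y \<star> fk_bracket a y + fk_bracket a y \<star> fk_bracket a x)
      \<in> (fk_ideal n :: 'a fk_series set)" by (simp add: fun_diff_def plus_fun_def)
    \<comment> \<open>The error made by shifting \<open>[x y]\<close> in the two products in which
      it occurs.\<close>
    have "fk_bracket a x \<star> s - s \<star> fk_bracket a y \<in> fk_ideal n"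
      using fk_bracket_carrier ne' by (intro fk_ideal_diff fk_ideal_mult_left fk_ideal_mult_right n s)
    from fk_ideal_diff[OF n t this] show "F z - G z - H z \<in> fk_ideal n"
      by (simp add: F_def G_def H_def z s_def fk_mult_diff_left fk_mult_diff_right algebra_simps
          del: plus_fun_apply)
    fix v assume "(F z - G z - H z) v \<noteq> 0"
    then have "F z v \<noteq> 0 \<or> G z v \<noteq> 0 \<or> H z v \<noteq> 0" by auto
    then have "v = [edge a x, edge b (y - x + b)] \<or> v = [edge b (y - x + b), edge a y] \<or> v = [edge a y, edge a x]"
      by (auto simp: F_def G_def H_def z dest!: fk_bracket_mult_nonzero)
    then show "length v \<le> 2 \<and> anchored (min a b) (max a b) v"
      using anchored_edge[of "min a b" a "max a b"] anchored_edge[of "min a b" b "max a b"] by auto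
  next
    fix v show "finite {x \<in> I. (F x - G x - H x) v \<noteq> 0}"
      using FGH(1) by (simp add: summable_family_def)
  qed
  then show ?thesis by (simp only: FGH(2) FG(2) Fs(2) Gs(2) Hs(2))
qed

end

section \<open>The cyclic relation\<close>

definition part_word :: "nat \<Rightarrow> int \<Rightarrow> int list \<Rightarrow> 'k::comm_ring_1 fk_series" where
  "part_word n a rs = foldr (\<lambda>r f. fk_part n a r \<star> f) rs (fk_word [])"

lemma part_word_simps [simp]:
  "part_word n a [] = fk_word []"
  "part_word n a (r # rs) = fk_part n a r \<star> part_word n a rs"
  by (simp_all add: part_word_def)

lemma part_word_append: "part_word n a (rs @ rs') = part_word n a rs \<star> part_word n a rs'"
  by (induction rs) (simp_all add: fk_mult_assoc)

lemmas fk_mult_distribs = fk_mult_add_left fk_mult_add_right fk_mult_diff_left fk_mult_diff_right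
  fk_mult_minus_left fk_mult_minus_right

context
  fixes n :: nat assumes n: "2 \<le> n"
begin

lemma part_word_carrier: "\<forall>r\<in>set rs. \<not> [a = r] (mod int n) \<Longrightarrow> part_word n a rs \<in> carrier (fk_E n)"
proof (induction rs)
  case Nil
  then show ?case by (simp add: fk_word_carrier)
next
  case (Cons r rs)
  then show ?case by (simp add: fk_E_mult_closed[OF n] fk_part_carrier[OF n])
qed

lemma fk_part_commute_word:
  assumes "distinct_residues n [a, c, d]" "\<forall>r\<in>set rs. distinct_residues n [a, c, d, r]"
  shows "fk_part n c d \<star> part_word n a rs - part_word n a rs \<star> fk_part n c d \<in> fk_ideal n"
  using assms(2)
proof (induction rs)
  case Nil
  then show ?case using fk_ideal_zero[OF n] by (simp del: zero_fun_apply)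
next
  case (Cons r rs)
  let ?Y = "fk_part n c d :: 'a fk_series" and ?X = "fk_part n a r :: 'a fk_series"
    and ?W = "part_word n a rs :: 'a fk_series"
  have ne: "\<not> [a = r] (mod int n)" "\<forall>r\<in>set rs. \<not> [a = r] (mod int n)"
    using Cons.prems by (auto simp: cong_def)
  have "distinct_residues n [a, c, d, r]" using Cons.prems by simp
  from fk_ideal_mult_right[OF n fk_part_commute[OF n this] part_word_carrier[OF ne(2)]]
  have 1: "(?Y \<star> ?X - ?X \<star> ?Y) \<star> ?W \<in> fk_ideal n" .
  have "?Y \<star> ?W - ?W \<star> ?Y \<in> fk_ideal n" using Cons by (simp del: minus_apply)
  from fk_ideal_mult_left[OF n this fk_part_carrier[OF n ne(1)]]
  have 2: "?X \<star> (?Y \<star> ?W - ?W \<star> ?Y) \<in> fk_ideal n" .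
  from fk_ideal_add[OF n 1 2] show ?case
    by (simp add: fk_mult_distribs fk_mult_assoc algebra_simps del: plus_fun_apply minus_apply)
qed

text \<open>The product for the residues \<open>zs\<close>, closed up by repeating its first factor.
  The head is taken only of nonempty lists.\<close>

definition cyclic_term :: "int \<Rightarrow> int list \<Rightarrow> 'k::comm_ring_1 fk_series" where
  "cyclic_term a zs = part_word n a zs \<star> fk_part n a (hd zs)"

text \<open>
  The induction rewrites the adjacent factors for \<open>d\<close> and \<open>c\<close> by the triple relation: the sum for
  \<open>c\<close> and \<open>ys @ [d]\<close> is the one for \<open>c\<close> and \<open>ys\<close> times \<open>Y\<close> minus \<open>Y\<close> times the one for \<open>d\<close> and \<open>ys\<close>.
\<close>

lemma cyclic_relation:
  assumes "distinct_residues n (a # c # ys)"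
  shows "(\<Sum>k\<le>length ys. cyclic_term a (drop k ys @ c # take k ys)) \<in> fk_ideal n"
  using assms
proof (induction ys arbitrary: c rule: rev_induct)
  case Nil
  then have "\<not> [a = c] (mod int n)" by (simp add: cong_def)
  from fk_part_square[OF n this] show ?case by (simp add: cyclic_term_def)
next
  case (snoc d ys)
  let ?Xc = "fk_part n a c :: 'a fk_series" and ?Xd = "fk_part n a d :: 'a fk_series"
    and ?Y = "fk_part n c d :: 'a fk_series" and ?P = "part_word n a :: int list \<Rightarrow> 'a fk_series"
    and ?T = "cyclic_term a :: int list \<Rightarrow> 'a fk_series"
  have dr: "distinct_residues n [a, c, d]" "distinct_residues n (a # c # ys)" "distinct_residues n (a # d # ys)"
    using snoc.prems by auto
  have ne: "\<not> [a = c] (mod int n)" "\<not> [a = d] (mod int n)" "\<not> [c = d] (mod int n)"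
    "\<forall>r\<in>set ys. \<not> [a = r] (mod int n)" "\<forall>r\<in>set ys. distinct_residues n [a, c, d, r]"
    using snoc.prems by (auto simp: cong_def)
  have car: "?Xc \<in> carrier (fk_E n)" "?Xd \<in> carrier (fk_E n)" "?Y \<in> carrier (fk_E n)"
    using ne by (simp_all add: fk_part_carrier[OF n])
  have carP: "?P rs \<in> carrier (fk_E n)" if "set rs \<subseteq> set ys" for rs
    using ne(4) that by (intro part_word_carrier) auto
  have comm: "?Y \<star> ?P rs - ?P rs \<star> ?Y \<in> fk_ideal n" if "set rs \<subseteq> set ys" for rs
    using ne(5) that by (intro fk_part_commute_word[OF dr(1)]) auto
  define tr where "tr = ?Xc \<star> ?Y - ?Y \<star> ?Xd - ?Xd \<star> ?Xc"
  have tr: "tr \<in> fk_ideal n" unfolding tr_def by (rule fk_part_triple[OF n dr(1)])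
  note closed = fk_ideal_add[OF n] fk_ideal_diff[OF n] fk_ideal_mult_left[OF n]
    fk_ideal_mult_right[OF n] fk_E_mult_closed[OF n] car tr
  \<comment> \<open>\<open>t\<close> has the terms of the relation to be shown, one more than
    \<open>A\<close> and \<open>B\<close>, which belong to \<open>c\<close> and to \<open>d\<close>
    with the shorter list \<open>ys\<close>.\<close>
  define t where "t = (\<lambda>k. ?T (drop k (ys @ [d]) @ c # take k (ys @ [d])))"
  define A where "A = (\<lambda>k. ?T (drop k ys @ c # take k ys))"
  define B where "B = (\<lambda>k. ?T (drop k ys @ d # take k ys))"
  \<comment> \<open>Modulo the ideal, \<open>Y\<close> commutes with all factors from
    \<open>ys\<close>, so it can be brought next to the factor for \<open>c\<close> or
    \<open>d\<close>; there the triple relation leaves the adjacent factors \<open>d\<close>,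
    \<open>c\<close> of \<open>t k\<close>.\<close>
  have small: "A k \<star> ?Y - ?Y \<star> B k - t k \<in> fk_ideal n" if k: "k < length ys" for k
  proof -
    define h where "h = hd (drop k ys)"
    have h: "h \<in> set ys" using k by (simp add: h_def hd_drop_conv_nth)
    define P Q where "P = ?P (drop k ys)" and "Q = ?P (take k ys @ [h])"
    have hd: "hd (drop k ys @ xs) = h" for xs using k by (simp add: h_def)
    have sub: "set (drop k ys) \<subseteq> set ys" "set (take k ys @ [h]) \<subseteq> set ys"
      using h by (auto dest: in_set_dropD in_set_takeD)
    have PQ: "P \<in> carrier (fk_E n)" "Q \<in> carrier (fk_E n)"
      "?Y \<star> P - P \<star> ?Y \<in> fk_ideal n" "?Y \<star> Q - Q \<star> ?Y \<in> fk_ideal n"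
      unfolding P_def Q_def using carP comm sub by blast+
    have "t k = P \<star> ?Xd \<star> ?Xc \<star> Q" "A k = P \<star> ?Xc \<star> Q" "B k = P \<star> ?Xd \<star> Q"
      using k hd by (simp_all add: t_def A_def B_def cyclic_term_def P_def Q_def part_word_append fk_mult_assoc)
    then have "A k \<star> ?Y - ?Y \<star> B k - t k =
      P \<star> tr \<star> Q - P \<star> ?Xc \<star> (?Y \<star> Q - Q \<star> ?Y) - (?Y \<star> P - P \<star> ?Y) \<star> ?Xd \<star> Q"
      by (simp add: tr_def fk_mult_distribs fk_mult_assoc algebra_simps del: plus_fun_apply minus_apply)
    moreover have "P \<star> tr \<star> Q - P \<star> ?Xc \<star> (?Y \<star> Q - Q \<star> ?Y) - (?Y \<star> P - P \<star> ?Y) \<star> ?Xd \<star> Q \<in> fk_ideal n"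
      by (intro closed PQ)
    ultimately show ?thesis by (simp only:)
  qed
  let ?m = "length ys"
  define Q where "Q = ?P ys"
  have Q: "Q \<in> carrier (fk_E n)" "?Y \<star> Q - Q \<star> ?Y \<in> fk_ideal n"
    unfolding Q_def using carP comm by blast+
  \<comment> \<open>For the last index the closing factor is itself the one for \<open>c\<close> or
    \<open>d\<close>. The triple relation is then used at both ends and yields two terms of
    \<open>t\<close>.\<close>
  have "t ?m = ?Xd \<star> ?Xc \<star> Q \<star> ?Xd" "t (Suc ?m) = ?Xc \<star> Q \<star> ?Xd \<star> ?Xc"
    "A ?m = ?Xc \<star> Q \<star> ?Xc" "B ?m = ?Xd \<star> Q \<star> ?Xd"
    by (simp_all add: t_def A_def B_def cyclic_term_def Q_def part_word_append fk_mult_assoc)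
  then have "A ?m \<star> ?Y - ?Y \<star> B ?m - (t ?m + t (Suc ?m)) =
    tr \<star> Q \<star> ?Xd + ?Xc \<star> Q \<star> tr - ?Xc \<star> (?Y \<star> Q - Q \<star> ?Y) \<star> ?Xd"
    by (simp add: tr_def fk_mult_distribs fk_mult_assoc algebra_simps del: plus_fun_apply minus_apply)
  moreover have "tr \<star> Q \<star> ?Xd + ?Xc \<star> Q \<star> tr - ?Xc \<star> (?Y \<star> Q - Q \<star> ?Y) \<star> ?Xd \<in> fk_ideal n"
    by (intro closed Q)
  ultimately have big: "A ?m \<star> ?Y - ?Y \<star> B ?m - (t ?m + t (Suc ?m)) \<in> fk_ideal n"
    by (simp only:)
  have "(\<Sum>k<?m. A k \<star> ?Y - ?Y \<star> B k - t k) + (A ?m \<star> ?Y - ?Y \<star> B ?m - (t ?m + t (Suc ?m))) \<in> fk_ideal n"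
    by (intro closed fk_ideal_sum[OF n] small big) simp
  also have "(\<Sum>k<?m. A k \<star> ?Y - ?Y \<star> B k - t k) + (A ?m \<star> ?Y - ?Y \<star> B ?m - (t ?m + t (Suc ?m))) =
    (\<Sum>k\<le>?m. A k) \<star> ?Y - ?Y \<star> (\<Sum>k\<le>?m. B k) - (\<Sum>k\<le>Suc ?m. t k)"
    by (simp add: lessThan_Suc_atMost[symmetric] fk_mult_sum_left fk_mult_sum_right sum_subtractf
        sum.distrib fk_mult_distribs algebra_simps del: plus_fun_apply minus_apply)
  finally have R: "(\<Sum>k\<le>?m. A k) \<star> ?Y - ?Y \<star> (\<Sum>k\<le>?m. B k) - (\<Sum>k\<le>Suc ?m. t k) \<in> fk_ideal n" .
  have "(\<Sum>k\<le>?m. A k) \<star> ?Y - ?Y \<star> (\<Sum>k\<le>?m. B k) \<in> fk_ideal n"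
    unfolding A_def B_def by (intro closed snoc.IH dr)
  from fk_ideal_diff[OF n this R] show ?case by (simp add: t_def del: plus_fun_apply)
qed

text \<open>For a fixed \<open>c\<close> in \<open>Z\<close>, every ordering of \<open>Z\<close> is
  a unique rotation of one that begins with \<open>c\<close>. So the sum over all orderings is a sum
  of cyclic relations.\<close>

lemma cyclic_relation_set:
  assumes "finite Z" "Z \<noteq> {}" "inj_on (\<lambda>x. x mod int n) (insert a Z)" "a \<notin> Z"
  shows "(\<Sum>zs\<in>permutations_of_set Z. cyclic_term a zs) \<in> fk_ideal n"
proof -
  obtain c where c: "c \<in> Z" using assms(2) by blast
  let ?Y = "permutations_of_set (Z - {c})"
  have "(\<Sum>zs\<in>permutations_of_set Z. cyclic_term a zs) =
    (\<Sum>(ys, k)\<in>Sigma ?Y (\<lambda>ys. {..length ys}). cyclic_term a (drop k ys @ c # take k ys))"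
  proof (rule sum.reindex_bij_witness[symmetric, where
        j = "\<lambda>(ys, k). drop k ys @ c # take k ys" and
        i = "\<lambda>zs. (tl (dropWhile (\<lambda>x. x \<noteq> c) zs) @ takeWhile (\<lambda>x. x \<noteq> c) zs,
          length (tl (dropWhile (\<lambda>x. x \<noteq> c) zs)))"])
    fix p assume "p \<in> Sigma ?Y (\<lambda>ys. {..length ys})"
    then obtain ys k where p: "p = (ys, k)" "set ys = Z - {c}" "distinct ys" "k \<le> length ys"
      by (auto simp: permutations_of_set_def)
    have cy: "c \<notin> set (drop k ys)" using p(2) by (auto dest: in_set_dropD)
    have tw: "takeWhile (\<lambda>x. x \<noteq> c) (drop k ys @ c # take k ys) = drop k ys"
      "dropWhile (\<lambda>x. x \<noteq> c) (drop k ys @ c # take k ys) = c # take k ys"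
      using cy by (subst takeWhile_append2 dropWhile_append2; auto)+
    show "(tl (dropWhile (\<lambda>x. x \<noteq> c) (case p of (ys, k) \<Rightarrow> drop k ys @ c # take k ys)) @
        takeWhile (\<lambda>x. x \<noteq> c) (case p of (ys, k) \<Rightarrow> drop k ys @ c # take k ys),
        length (tl (dropWhile (\<lambda>x. x \<noteq> c) (case p of (ys, k) \<Rightarrow> drop k ys @ c # take k ys)))) = p"
      using p(4) by (simp add: p(1) tw)
    have "set (drop k ys) \<union> set (take k ys) = set ys" by (metis Un_commute append_take_drop_id set_append)
    moreover have "distinct (drop k ys @ c # take k ys)"
      using p(2,3) cy set_take_disj_set_drop_if_distinct[OF p(3), of k k]
      by (auto dest: in_set_takeD)
    ultimately show "(case p of (ys, k) \<Rightarrow> drop k ys @ c # take k ys) \<in> permutations_of_set Z"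
      using p(2) c by (auto simp: p(1) permutations_of_set_def)
  next
    fix zs assume zs: "zs \<in> permutations_of_set Z"
    then have "c \<in> set zs" using c by (simp add: permutations_of_set_def)
    then obtain us vs where uv: "zs = us @ c # vs" "c \<notin> set us" by (meson split_list_first)
    have tw: "takeWhile (\<lambda>x. x \<noteq> c) zs = us" "dropWhile (\<lambda>x. x \<noteq> c) zs = c # vs"
      unfolding uv(1) using uv(2) by (subst takeWhile_append2 dropWhile_append2; auto)+
    show "(case (tl (dropWhile (\<lambda>x. x \<noteq> c) zs) @ takeWhile (\<lambda>x. x \<noteq> c) zs,
        length (tl (dropWhile (\<lambda>x. x \<noteq> c) zs))) of (ys, k) \<Rightarrow> drop k ys @ c # take k ys) = zs"
      by (simp add: tw) (simp add: uv(1))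
    show "(tl (dropWhile (\<lambda>x. x \<noteq> c) zs) @ takeWhile (\<lambda>x. x \<noteq> c) zs,
        length (tl (dropWhile (\<lambda>x. x \<noteq> c) zs))) \<in> Sigma ?Y (\<lambda>ys. {..length ys})"
      using zs unfolding tw by (auto simp: permutations_of_set_def uv(1))
  qed auto
  also have "\<dots> = (\<Sum>ys\<in>?Y. \<Sum>k\<le>length ys. cyclic_term a (drop k ys @ c # take k ys))"
    by (subst sum.Sigma) (use assms(1) in auto)
  also have "\<dots> \<in> fk_ideal n"
  proof (rule fk_ideal_sum[OF n], rule cyclic_relation)
    fix ys assume "ys \<in> ?Y"
    then have ys: "set ys = Z - {c}" "distinct ys" by (auto simp: permutations_of_set_def)
    have "insert a (insert c (set ys)) = insert a Z" using ys(1) c by auto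
    then show "distinct_residues n (a # c # ys)"
      unfolding distinct_map using ys assms(3,4) c by auto
  qed
  finally show ?thesis .
qed

section \<open>Removing the words with a repeated residue\<close>

definition residues_off :: "int \<Rightarrow> int set" where
  "residues_off a = {0..<int n} - {a mod int n}"

definition distinct_words :: "int \<Rightarrow> nat \<Rightarrow> int list set" where
  "distinct_words a m = {rs. set rs \<subseteq> residues_off a \<and> distinct rs \<and> length rs = m}"

lemma finite_distinct_words: "finite (distinct_words a m)"
  by (rule finite_subset[OF _ finite_lists_length_eq[of "residues_off a" m]])
    (auto simp: distinct_words_def residues_off_def)

lemma residues_off_not_cong: "r \<in> residues_off a \<Longrightarrow> \<not> [a = r] (mod int n)"
  by (auto simp: residues_off_def cong_def)

lemma fk_theta_parts:
  "(fk_theta n a :: 'k::comm_ring_1 fk_series) = (\<Sum>r\<in>residues_off a. fk_part n a r)"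
proof
  fix v
  define A where "A = {j. fk_bracket a j v \<noteq> (0 :: 'k)}"
  have finA: "finite (A \<inter> X)" for X
    using summable_family_bracket[of X a, where ?'a = 'k] by (simp add: A_def summable_family_def Collect_conj_eq Int_commute)
  have "(fk_theta n a v :: 'k) = (\<Sum>j\<in>A \<inter> {j. \<not> [j = a] (mod int n)}. fk_bracket a j v)"
    unfolding fk_theta_def by (rule fk_sum_eq_sum[OF finA]) (auto simp: A_def)
  also have "A \<inter> {j. \<not> [j = a] (mod int n)} = (\<Union>r\<in>residues_off a. A \<inter> {j. [j = r] (mod int n)})"
  proof -
    have "\<not> [j = a] (mod int n) \<longleftrightarrow> (\<exists>r\<in>residues_off a. [j = r] (mod int n))" for j
    proof
      assume "\<not> [j = a] (mod int n)"
      then show "\<exists>r\<in>residues_off a. [j = r] (mod int n)"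
        using n by (intro bexI[of _ "j mod int n"]) (auto simp: residues_off_def cong_def)
    qed (auto simp: residues_off_def cong_def)
    then show ?thesis by blast
  qed
  also have "(\<Sum>j\<in>\<dots>. fk_bracket a j v :: 'k) =
    (\<Sum>r\<in>residues_off a. \<Sum>j\<in>A \<inter> {j. [j = r] (mod int n)}. fk_bracket a j v)"
    by (rule sum.UNION_disjoint) (use finA in \<open>auto simp: residues_off_def cong_def\<close>)
  also have "\<dots> = (\<Sum>r\<in>residues_off a. fk_part n a r v)"
    unfolding fk_part_def by (intro sum.cong refl fk_sum_eq_sum[OF finA, symmetric]) (auto simp: A_def)
  finally show "(fk_theta n a v :: 'k) = (\<Sum>r\<in>residues_off a. fk_part n a r) v"
    by (simp add: sum_fun_apply)
qed

lemma fk_theta_carrier: "fk_theta n a \<in> carrier (fk_E n)"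
  unfolding fk_theta_parts using residues_off_not_cong by (intro fk_E_sum_closed fk_part_carrier[OF n])

text \<open>The word is cut before the first occurrence of the residue that its last factor repeats;
  what follows is a cyclic term. The words with a common initial piece and a common set of later
  residues add up to a multiple of a cyclic relation.\<close>

lemma repeated_words_ideal:
  "(\<Sum>(rs, r)\<in>Sigma (distinct_words a m) set. part_word n a (rs @ [r])) \<in> fk_ideal n"
proof -
  define UZ where "UZ = {(us, Z). set us \<subseteq> residues_off a \<and> distinct us \<and> Z \<subseteq> residues_off a - set us \<and>
    Z \<noteq> {} \<and> length us + card Z = m}"
  have finR: "finite (residues_off a)" by (simp add: residues_off_def)
  have "UZ \<subseteq> {us. set us \<subseteq> residues_off a \<and> length us \<le> m} \<times> Pow (residues_off a)"
    by (auto simp: UZ_def)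
  then have finUZ: "finite UZ"
    by (rule finite_subset) (use finR in \<open>simp add: finite_lists_length_le\<close>)
  have finZ: "finite Z" if "(us, Z) \<in> UZ" for us Z
    using that finR by (auto simp: UZ_def intro: finite_subset)
  have "(\<Sum>(rs, r)\<in>Sigma (distinct_words a m) set. part_word n a (rs @ [r])) =
    (\<Sum>(x, zs)\<in>Sigma UZ (\<lambda>(us, Z). permutations_of_set Z). part_word n a (fst x) \<star> cyclic_term a zs)"
  proof (rule sum.reindex_bij_witness[where
        j = "\<lambda>(rs, r). ((takeWhile (\<lambda>x. x \<noteq> r) rs, set (dropWhile (\<lambda>x. x \<noteq> r) rs)), dropWhile (\<lambda>x. x \<noteq> r) rs)"
        and i = "\<lambda>(x, zs). (fst x @ zs, hd zs)"])
    fix p assume "p \<in> Sigma (distinct_words a m) set"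
    then obtain rs r where p: "p = (rs, r)" "rs \<in> distinct_words a m" "r \<in> set rs" by auto
    from p(3) obtain us vs where uv: "rs = us @ r # vs" "r \<notin> set us" by (meson split_list_first)
    have tw: "takeWhile (\<lambda>x. x \<noteq> r) rs = us" "dropWhile (\<lambda>x. x \<noteq> r) rs = r # vs"
      unfolding uv(1) using uv(2) by (subst takeWhile_append2 dropWhile_append2; auto)+
    show "(case case p of (rs, r) \<Rightarrow> ((takeWhile (\<lambda>x. x \<noteq> r) rs, set (dropWhile (\<lambda>x. x \<noteq> r) rs)),
        dropWhile (\<lambda>x. x \<noteq> r) rs) of (x, zs) \<Rightarrow> (fst x @ zs, hd zs)) = p"
      by (simp add: p(1) tw) (simp add: uv(1))
    have "(us, set (r # vs)) \<in> UZ"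
      using p(2) by (auto simp: UZ_def distinct_words_def uv(1) distinct_card card_insert_if)
    moreover have "r # vs \<in> permutations_of_set (set (r # vs))"
      using p(2) by (auto simp: distinct_words_def uv(1) permutations_of_set_def)
    ultimately show "(case p of (rs, r) \<Rightarrow> ((takeWhile (\<lambda>x. x \<noteq> r) rs, set (dropWhile (\<lambda>x. x \<noteq> r) rs)),
        dropWhile (\<lambda>x. x \<noteq> r) rs)) \<in> Sigma UZ (\<lambda>(us, Z). permutations_of_set Z)"
      by (simp add: p(1) tw)
    show "(case case p of (rs, r) \<Rightarrow> ((takeWhile (\<lambda>x. x \<noteq> r) rs, set (dropWhile (\<lambda>x. x \<noteq> r) rs)),
        dropWhile (\<lambda>x. x \<noteq> r) rs) of (x, zs) \<Rightarrow> part_word n a (fst x) \<star> cyclic_term a zs) =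
        (case p of (rs, r) \<Rightarrow> part_word n a (rs @ [r]))"
      by (simp add: p(1) tw) (simp add: uv(1) cyclic_term_def part_word_append fk_mult_assoc)
  next
    fix q assume "q \<in> Sigma UZ (\<lambda>(us, Z). permutations_of_set Z)"
    then obtain us Z zs where q: "q = ((us, Z), zs)" "(us, Z) \<in> UZ" "zs \<in> permutations_of_set Z"
      by auto
    have zs: "set zs = Z" "distinct zs" using q(3) by (auto simp: permutations_of_set_def)
    have uZ: "set us \<subseteq> residues_off a" "distinct us" "Z \<subseteq> residues_off a - set us" "Z \<noteq> {}"
      "length us + card Z = m" using q(2) by (auto simp: UZ_def)
    obtain r vs where z: "zs = r # vs" using zs(1) uZ(4) by (cases zs) auto
    have r: "r \<notin> set us" using zs(1) uZ(3) z by auto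
    have tw: "takeWhile (\<lambda>x. x \<noteq> r) (us @ r # vs) = us" "dropWhile (\<lambda>x. x \<noteq> r) (us @ r # vs) = r # vs"
      using r by (subst takeWhile_append2 dropWhile_append2; auto)+
    show "(case case q of (x, zs) \<Rightarrow> (fst x @ zs, hd zs) of (rs, r) \<Rightarrow>
        ((takeWhile (\<lambda>x. x \<noteq> r) rs, set (dropWhile (\<lambda>x. x \<noteq> r) rs)), dropWhile (\<lambda>x. x \<noteq> r) rs)) = q"
      using zs(1) by (simp add: q(1) z tw)
    have "length zs = card Z" using zs distinct_card by fastforce
    then show "(case q of (x, zs) \<Rightarrow> (fst x @ zs, hd zs)) \<in> Sigma (distinct_words a m) set"
      using uZ zs by (auto simp: q(1) z distinct_words_def)
  qed
  also have "\<dots> = (\<Sum>x\<in>UZ. \<Sum>zs\<in>permutations_of_set (snd x). part_word n a (fst x) \<star> cyclic_term a zs)"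
    using finUZ finZ by (subst sum.Sigma) (auto simp: case_prod_unfold)
  also have "\<dots> = (\<Sum>x\<in>UZ. part_word n a (fst x) \<star> (\<Sum>zs\<in>permutations_of_set (snd x). cyclic_term a zs))"
    by (simp add: fk_mult_sum_right)
  also have "\<dots> \<in> fk_ideal n"
  proof (rule fk_ideal_sum[OF n])
    fix x assume "x \<in> UZ"
    then obtain us Z where x: "x = (us, Z)" "(us, Z) \<in> UZ" by (cases x) auto
    have uZ: "set us \<subseteq> residues_off a" "Z \<subseteq> residues_off a" "Z \<noteq> {}" using x(2) by (auto simp: UZ_def)
    have inj: "inj_on (\<lambda>x. x mod int n) (insert a Z)"
    proof -
      have "x mod int n = x \<and> x \<noteq> a mod int n" if "x \<in> Z" for x
        using uZ(2) that by (auto simp: residues_off_def)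
      then show ?thesis unfolding inj_on_def by (metis insert_iff)
    qed
    have "a \<notin> Z" using residues_off_not_cong[of a a] uZ(2) by auto
    note cyc = cyclic_relation_set[OF finZ[OF x(2)] uZ(3) inj this]
    have "\<forall>r\<in>set us. \<not> [a = r] (mod int n)" using uZ(1) residues_off_not_cong by auto
    from fk_ideal_mult_left[OF n cyc part_word_carrier[OF this]]
    show "part_word n a (fst x) \<star> (\<Sum>zs\<in>permutations_of_set (snd x). cyclic_term a zs) \<in> fk_ideal n"
      unfolding x fst_conv snd_conv .
  qed
  finally show ?thesis .
qed

text \<open>Another factor theta extends a distinct word either by a new residue, giving the
  distinct words that are longer by one, or by a residue already present, and those words sum to
  zero modulo the ideal.\<close>

lemma fk_theta_power:
  "fk_theta n a [^]\<^bsub>fk_E n\<^esub> m - (\<Sum>rs\<in>distinct_words a m. part_word n a rs) \<in> fk_ideal n"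
proof (induction m)
  case 0
  have "distinct_words a 0 = {[]}" by (auto simp: distinct_words_def)
  then show ?case using fk_ideal_zero[OF n] by (simp del: zero_fun_apply)
next
  case (Suc m)
  let ?\<theta> = "fk_theta n a :: 'a fk_series" and ?p = "part_word n a :: int list \<Rightarrow> 'a fk_series"
  have "(\<Sum>rs\<in>distinct_words a m. ?p rs) \<star> ?\<theta> =
    (\<Sum>rs\<in>distinct_words a m. \<Sum>r\<in>residues_off a. ?p (rs @ [r]))"
    unfolding fk_theta_parts fk_mult_sum_left
    by (simp add: fk_mult_sum_right part_word_append)
  also have "\<dots> = (\<Sum>(rs, r)\<in>Sigma (distinct_words a m) (\<lambda>_. residues_off a). ?p (rs @ [r]))"
    by (rule sum.Sigma) (auto simp: finite_distinct_words residues_off_def)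
  also have "Sigma (distinct_words a m) (\<lambda>_. residues_off a) =
    Sigma (distinct_words a m) (\<lambda>rs. residues_off a - set rs) \<union> Sigma (distinct_words a m) set"
    by (auto simp: distinct_words_def)
  also have "(\<Sum>(rs, r)\<in>\<dots>. ?p (rs @ [r])) =
    (\<Sum>(rs, r)\<in>Sigma (distinct_words a m) (\<lambda>rs. residues_off a - set rs). ?p (rs @ [r])) +
    (\<Sum>(rs, r)\<in>Sigma (distinct_words a m) set. ?p (rs @ [r]))"
    by (rule sum.union_disjoint) (auto simp: finite_distinct_words residues_off_def)
  also have "(\<Sum>(rs, r)\<in>Sigma (distinct_words a m) (\<lambda>rs. residues_off a - set rs). ?p (rs @ [r])) =
    (\<Sum>rs\<in>distinct_words a (Suc m). ?p rs)"
  proof (rule sum.reindex_bij_witness[of _ "\<lambda>rs. (butlast rs, last rs)" "\<lambda>(rs, r). rs @ [r]"])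
    fix rs assume rs: "rs \<in> distinct_words a (Suc m)"
    then obtain us r where "rs = us @ [r]" by (cases rs rule: rev_cases) (auto simp: distinct_words_def)
    then show "(case (butlast rs, last rs) of (rs, r) \<Rightarrow> rs @ [r]) = rs"
      "(butlast rs, last rs) \<in> Sigma (distinct_words a m) (\<lambda>rs. residues_off a - set rs)"
      using rs by (auto simp: distinct_words_def)
  qed (auto simp: distinct_words_def)
  finally have prod: "(\<Sum>rs\<in>distinct_words a m. ?p rs) \<star> ?\<theta> = (\<Sum>rs\<in>distinct_words a (Suc m). ?p rs) +
    (\<Sum>(rs, r)\<in>Sigma (distinct_words a m) set. ?p (rs @ [r]))" .
  have "(?\<theta> [^]\<^bsub>fk_E n\<^esub> m - (\<Sum>rs\<in>distinct_words a m. ?p rs)) \<star> ?\<theta> \<in> fk_ideal n"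
    by (rule fk_ideal_mult_right[OF n Suc fk_theta_carrier])
  from fk_ideal_add[OF n this repeated_words_ideal[of a m]]
  have "?\<theta> [^]\<^bsub>fk_E n\<^esub> m \<star> ?\<theta> - (\<Sum>rs\<in>distinct_words a m. ?p rs) \<star> ?\<theta> +
    (\<Sum>(rs, r)\<in>Sigma (distinct_words a m) set. ?p (rs @ [r])) \<in> fk_ideal n"
    by (simp only: fk_mult_diff_left)
  then show ?case
    unfolding prod by (simp add: fk_E_def nat_pow_def del: plus_fun_apply minus_apply)
qed

end

section \<open>Comparison of coefficients\<close>

lemma fk_mult_letter:
  assumes "\<And>v. g v \<noteq> 0 \<Longrightarrow> length v = 1"
  shows "(g \<star> f) v = (case v of [] \<Rightarrow> 0 | e # v' \<Rightarrow> g [e] * f v')"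
proof (cases v)
  case Nil
  have "g [] = 0" using assms[of "[]"] by (cases "g [] = 0") auto
  then show ?thesis by (simp add: Nil fk_mult_Nil)
next
  case (Cons e v')
  have g: "(\<lambda>u. g (e # u)) = (\<lambda>u. g [e] * fk_word [] u)"
    using assms by (fastforce simp: fk_word_def fun_eq_iff)
  have "((\<lambda>u. g [e] * fk_word [] u) \<star> f) v' = g [e] * (fk_word [] \<star> f) v'"
    unfolding fk_mult_def by (simp add: sum_distrib_left mult.assoc)
  moreover have "g [] = 0" using assms[of "[]"] by auto
  ultimately show ?thesis by (simp add: Cons fk_mult_Cons g)
qed

text \<open>Each letter \<open>(j, a)\<close> arises from \<open>[a j] = - [j a]\<close> with
  \<open>j < a\<close>.\<close>

definition star_sign :: "int \<Rightarrow> (int \<times> int) list \<Rightarrow> 'k::comm_ring_1" where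
  "star_sign a v = (- 1) ^ length (filter (\<lambda>e. snd e = a) v)"

lemma fk_part_letter:
  assumes "\<not> [a = r] (mod int n)"
  shows "fk_part n a r [e] = (if \<exists>j. e = edge a j \<and> [j = r] (mod int n) then star_sign a [e] else 0)"
proof (cases "\<exists>j. e = edge a j \<and> [j = r] (mod int n)")
  case True
  then obtain j where j: "e = edge a j" "[j = r] (mod int n)" by blast
  have "fk_bracket a x [e] = (0 :: 'a)" if "x \<noteq> j" for x
    using fk_bracket_nonzero[of a x "[e]"] that by (cases "fk_bracket a x [e] = (0 :: 'a)") (auto simp: j(1))
  then have "fk_part n a r [e] = (\<Sum>x\<in>{j}. fk_bracket a x [e] :: 'a)"
    unfolding fk_part_def by (intro fk_sum_eq_sum) (use j in auto)
  moreover have "j \<noteq> a" using j(2) assms by (metis cong_sym)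
  ultimately show ?thesis
    using True by (auto simp: j(1) fk_bracket_edge fk_word_def star_sign_def edge_def)
next
  case False
  have "fk_part n a r [e] = (0 :: 'a)"
  proof (rule ccontr)
    assume "fk_part n a r [e] \<noteq> (0 :: 'a)"
    then obtain j where "[j = r] (mod int n)" "fk_bracket a j [e] \<noteq> (0 :: 'a)"
      unfolding fk_part_def by (elim fk_sum_nonzeroE) simp
    then show False using fk_bracket_nonzero False by blast
  qed
  then show ?thesis unfolding if_not_P[OF False] .
qed

lemma part_word_coeff:
  assumes "\<forall>r\<in>set rs. \<not> [a = r] (mod int n)"
  shows "part_word n a rs v = (if \<exists>js. v = map (edge a) js \<and> list_all2 (\<lambda>j r. [j = r] (mod int n)) js rs
    then star_sign a v else 0)"
  using assms
proof (induction rs arbitrary: v)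
  case Nil
  then show ?case by (auto simp: fk_word_def star_sign_def)
next
  case (Cons r rs)
  have len: "length w = 1" if nz: "fk_part n a r w \<noteq> (0 :: 'a)" for w
  proof -
    obtain j where "fk_bracket a j w \<noteq> (0 :: 'a)" using nz unfolding fk_part_def by (elim fk_sum_nonzeroE)
    then show ?thesis using fk_bracket_nonzero by fastforce
  qed
  show ?case
  proof (cases v)
    case Nil
    then show ?thesis by (simp add: fk_mult_letter[OF len])
  next
    case v: (Cons e v')
    have IH: "part_word n a rs v' = (if \<exists>js. v' = map (edge a) js \<and> list_all2 (\<lambda>j r. [j = r] (mod int n)) js rs
      then star_sign a v' else 0 :: 'a)" using Cons by simp
    have ex: "(\<exists>js. v = map (edge a) js \<and> list_all2 (\<lambda>j r. [j = r] (mod int n)) js (r # rs)) \<longleftrightarrow>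
      (\<exists>j. e = edge a j \<and> [j = r] (mod int n)) \<and>
      (\<exists>js. v' = map (edge a) js \<and> list_all2 (\<lambda>j r. [j = r] (mod int n)) js rs)"
    proof safe
      fix j js assume "e = edge a j" "[j = r] (mod int n)" "v' = map (edge a) js"
        "list_all2 (\<lambda>j r. [j = r] (mod int n)) js rs"
      then show "\<exists>js. v = map (edge a) js \<and> list_all2 (\<lambda>j r. [j = r] (mod int n)) js (r # rs)"
        by (intro exI[of _ "j # js"]) (simp add: v)
    qed (auto simp: v list_all2_Cons2)
    have "star_sign a (e # v') = (star_sign a [e] * star_sign a v' :: 'a)"
      by (simp add: star_sign_def)
    moreover have "part_word n a (r # rs) v = fk_part n a r [e] * (part_word n a rs v' :: 'a)"
      by (simp add: v fk_mult_letter[OF len])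
    moreover define P where "P \<longleftrightarrow> (\<exists>j. e = edge a j \<and> [j = r] (mod int n))"
    moreover define Q where "Q \<longleftrightarrow> (\<exists>js. v' = map (edge a) js \<and> list_all2 (\<lambda>j r. [j = r] (mod int n)) js rs)"
    moreover have "fk_part n a r [e] = (if P then star_sign a [e] else 0 :: 'a)"
      unfolding P_def using Cons.prems by (intro fk_part_letter) simp
    ultimately show ?thesis
      unfolding ex IH P_def[symmetric] Q_def[symmetric] by (simp add: v del: part_word_simps)
  qed
qed

definition star_words :: "nat \<Rightarrow> int \<Rightarrow> nat \<Rightarrow> (int \<times> int) list set" where
  "star_words n a m = map (edge a) ` {js. length js = m \<and> distinct_residues n (a # js)}"

lemma map_edge_inj: "map (edge a) js = map (edge a) js' \<Longrightarrow> js = js'"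
  by (rule map_injective[of "edge a"]) (auto simp: inj_def)

text \<open>A star word determines the other ends \<open>js\<close> of its letters, and only their
  reduction modulo \<open>n\<close> contributes to it.\<close>

lemma sum_part_words_coeff:
  assumes "2 \<le> n"
  shows "(\<Sum>rs\<in>distinct_words n a m. part_word n a rs) v = (if v \<in> star_words n a m then star_sign a v else 0)"
proof -
  have nc: "\<forall>r\<in>set rs. \<not> [a = r] (mod int n)" if "rs \<in> distinct_words n a m" for rs
    using that residues_off_not_cong[OF assms] by (auto simp: distinct_words_def[OF assms])
  have uniq: "rs = map (\<lambda>j. j mod int n) js"
    if "rs \<in> distinct_words n a m" "list_all2 (\<lambda>j r. [j = r] (mod int n)) js rs" for rs js
  proof -
    have "\<forall>r\<in>set rs. r mod int n = r"
      using that(1) by (auto simp: distinct_words_def[OF assms] residues_off_def[OF assms])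
    with that(2) show ?thesis
      by (induction rule: list_all2_induct) (auto simp: cong_def)
  qed
  have mem: "map (\<lambda>j. j mod int n) js \<in> distinct_words n a m \<longleftrightarrow> length js = m \<and> distinct_residues n (a # js)" for js
    using assms by (auto simp: distinct_words_def[OF assms] residues_off_def[OF assms] image_iff)
  have la: "list_all2 (\<lambda>j r. [j = r] (mod int n)) js (map (\<lambda>j. j mod int n) js)" for js
    by (simp add: list_all2_conv_all_nth cong_def)
  have "(\<Sum>rs\<in>distinct_words n a m. part_word n a rs) v = (\<Sum>rs\<in>distinct_words n a m. part_word n a rs v)"
    by (simp add: sum_fun_apply)
  also have "\<dots> = (if v \<in> star_words n a m then star_sign a v else 0 :: 'a)"
  proof (cases "v \<in> star_words n a m")
    case True
    then obtain js where js: "v = map (edge a) js" "length js = m" "distinct_residues n (a # js)"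
      by (auto simp: star_words_def)
    have "(\<Sum>rs\<in>distinct_words n a m. part_word n a rs v) =
      (\<Sum>rs\<in>distinct_words n a m. if rs = map (\<lambda>j. j mod int n) js then star_sign a v else 0 :: 'a)"
    proof (rule sum.cong[OF refl])
      fix rs assume rs: "rs \<in> distinct_words n a m"
      have "(\<exists>js'. v = map (edge a) js' \<and> list_all2 (\<lambda>j r. [j = r] (mod int n)) js' rs) \<longleftrightarrow>
        rs = map (\<lambda>j. j mod int n) js"
        using uniq[OF rs] la[of js] map_edge_inj[of a js] unfolding js(1) by metis
      then show "part_word n a rs v = (if rs = map (\<lambda>j. j mod int n) js then star_sign a v else 0 :: 'a)"
        unfolding part_word_coeff[OF nc[OF rs]] by simp
    qed
    also have "\<dots> = star_sign a v"
      using mem[of js] js(2,3) finite_distinct_words[OF assms] by (simp add: sum.delta)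
    finally show ?thesis using True by simp
  next
    case False
    have "part_word n a rs v = (0 :: 'a)" if rs: "rs \<in> distinct_words n a m" for rs
    proof -
      have no: "\<not> (\<exists>js. v = map (edge a) js \<and> list_all2 (\<lambda>j r. [j = r] (mod int n)) js rs)"
      proof
        assume "\<exists>js. v = map (edge a) js \<and> list_all2 (\<lambda>j r. [j = r] (mod int n)) js rs"
        then obtain js where js: "v = map (edge a) js" "list_all2 (\<lambda>j r. [j = r] (mod int n)) js rs" by blast
        then have "length js = m \<and> distinct_residues n (a # js)" using uniq[OF rs js(2)] rs mem[of js] by simp
        then show False using False js(1) by (auto simp: star_words_def)
      qed
      then show ?thesis unfolding part_word_coeff[OF nc[OF rs]] if_not_P[OF no] by simp
    qed
    then show ?thesis using False by simp
  qed
  finally show ?thesis .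
qed

text \<open>Representatives are permutations of their tree, so the tree is recovered from the word
  and at most one term contributes.\<close>

lemma mn_element_coeff:
  assumes M: "\<And>D. connected_tree n c D \<Longrightarrow> mn_representatives D (M D)"
  shows "mn_element n M m c v = (if connected_tree n c (set v) \<and> card (set v) = m \<and> v \<in> M (set v)
    then (- 1) ^ (lower_vertices c (set v) - 1) else 0)"
proof -
  define I where "I = {(D, u). connected_tree n c D \<and> card D = m \<and> u \<in> M D}"
  define F where "F = (\<lambda>(D, u) v. (- 1) ^ (lower_vertices c D - 1) * fk_word u v :: 'a)"
  have set_u: "set u = D" if "(D, u) \<in> I" for D u
    using that M[of D] by (auto simp: I_def mn_representatives_def permutations_of_set_def)
  have "mn_element n M m c v = (\<Sum>x\<in>{(set v, v)} \<inter> I. F x v)"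
    unfolding mn_element_def I_def[symmetric] F_def[symmetric]
  proof (rule fk_sum_eq_sum)
    fix x assume x: "x \<in> I" "x \<notin> {(set v, v)} \<inter> I"
    obtain D u where Du: "x = (D, u)" by (cases x)
    have "u \<noteq> v" using x set_u by (auto simp: Du)
    then show "F x v = 0" by (simp add: F_def Du fk_word_def)
  qed auto
  also have "\<dots> = (if (set v, v) \<in> I then (- 1) ^ (lower_vertices c (set v) - 1) else 0)"
    by (auto simp: F_def fk_word_def)
  finally show ?thesis by (simp add: I_def)
qed

lemma connected_tree_card:
  assumes "connected_tree n c D"
  shows "card (box_vertices D) = card D + 1"
proof -
  have "finite D" "D \<noteq> {}" using assms by (auto simp: connected_tree_def)
  then obtain x where x: "x \<in> box_vertices D" using box_vertices_eq_empty_iff by blast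
  obtain u where u: "set u = D" "distinct u" using finite_distinct_list[OF \<open>finite D\<close>] by blast
  obtain ts where ts: "swap_step\<^sup>*\<^sup>* u (forest_word x ts)" "distinct (x # forest_nodes ts)"
    using connected_tree_forest[OF assms x, of u] u by (auto simp: permutations_of_set_def)
  have D: "set (forest_word x ts) = D" using swaps_set[OF ts(1)] u(1) by simp
  then have "ts \<noteq> []" using \<open>D \<noteq> {}\<close> by auto
  then have "box_vertices D = set (x # forest_nodes ts)"
    using D box_vertices_forest_word[of x ts] by simp
  then have "card (box_vertices D) = length (x # forest_nodes ts)" using distinct_card[OF ts(2)] by simp
  also have "\<dots> = card D + 1"
    using distinct_card[OF distinct_forest_word[OF ts(2)]] D by (simp add: length_forest_word)
  finally show ?thesis .
qed

text \<open>Moving the cut from \<open>a\<close> to \<open>a - 1\<close> changes the side of the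
  vertex \<open>a\<close> only. This is why trees avoiding \<open>a\<close> cancel in the difference
  of the two elements.\<close>

lemma connected_tree_shift_cut:
  assumes "a \<notin> box_vertices D"
  shows "connected_tree n (a - 1) D \<longleftrightarrow> connected_tree n a D"
    and "lower_vertices (a - 1) D = lower_vertices a D"
proof -
  have "(i \<le> a - 1 \<and> a - 1 < j) \<longleftrightarrow> (i \<le> a \<and> a < j)" if "(i, j) \<in> D" for i j
  proof -
    have "i \<noteq> a" "j \<noteq> a" using that assms by (force simp: box_vertices_def)+
    then show ?thesis by auto
  qed
  then have "(\<forall>(i, j)\<in>D. i \<le> a - 1 \<and> a - 1 < j) \<longleftrightarrow> (\<forall>(i, j)\<in>D. i \<le> a \<and> a < j)"
    by blast
  then show "connected_tree n (a - 1) D \<longleftrightarrow> connected_tree n a D"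
    unfolding connected_tree_def by (simp only:)
  have "{x \<in> box_vertices D. x \<le> a - 1} = {x \<in> box_vertices D. x \<le> a}"
    using assms by (auto simp: order.order_iff_strict)
  then show "lower_vertices (a - 1) D = lower_vertices a D" by (simp add: lower_vertices_def)
qed

section \<open>The identity in the algebra, one vertex set at a time\<close>

lemma connected_tree_word:
  assumes "connected_tree n c (set v)" "mn_representatives (set v) (M (set v))" "v \<in> M (set v)"
  shows "distinct v" "set v \<subseteq> fk_symbols n" "\<And>e. e \<in> set v \<Longrightarrow> fst e \<le> c \<and> c < snd e"
proof -
  show "distinct v" using assms(2,3) by (auto simp: mn_representatives_def permutations_of_set_def)
  show cr: "fst e \<le> c \<and> c < snd e" if "e \<in> set v" for e
    using assms(1) that by (cases e) (auto simp: connected_tree_def)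
  have inj: "inj_on (\<lambda>x. x mod int n) (box_vertices (set v))" using assms(1) by (simp add: connected_tree_def)
  show "set v \<subseteq> fk_symbols n"
  proof
    fix e assume e: "e \<in> set v"
    have "fst e \<in> box_vertices (set v)" "snd e \<in> box_vertices (set v)"
      using e by (auto simp: box_vertices_def)
    moreover have "fst e < snd e" using cr[OF e] by simp
    ultimately have "\<not> [fst e = snd e] (mod int n)"
      using inj by (auto simp: inj_on_def cong_def)
    then show "e \<in> fk_symbols n" using \<open>fst e < snd e\<close> by (cases e) (simp add: fk_symbols_def)
  qed
qed


text \<open>Zero on words with a letter that is no symbol, so that the relations hold in every context.\<close>

definition symbol_word :: "nat \<Rightarrow> (int \<times> int) list \<Rightarrow> 'k::comm_ring_1 fk_series" where
  "symbol_word n u = (if set u \<subseteq> fk_symbols n then fk_word u else 0)"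

lemma symbol_word_context:
  "symbol_word n (p @ [(i, j), (k, l)] @ q) =
    (if set p \<union> set q \<subseteq> fk_symbols n \<and> (i, j) \<in> fk_symbols n \<and> (k, l) \<in> fk_symbols n
     then fk_word p \<star> (fk_bracket i j \<star> fk_bracket k l) \<star> fk_word q else 0)"
  by (auto simp: symbol_word_def fk_bracket_def fk_symbols_def fk_word_mult)

text \<open>The three axioms come from \<open>commute\<close>, \<open>triple1\<close> and
  \<open>triple2\<close>; their indices are in increasing order, so every bracket is a plain symbol.
  A context made of symbols lies in the ring and preserves the ideal, and in any other context all
  terms are zero.\<close>

lemma tree_relations_fk_ideal:
  assumes n: "2 \<le> n" and inj: "inj_on (\<lambda>x. x mod int n) V" and a: "a \<in> V"
  shows "tree_relations a V (symbol_word n :: _ \<Rightarrow> 'k::comm_ring_1 fk_series) (fk_ideal n)"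
proof
  let ?J = "fk_ideal n :: 'k fk_series set"
  have nc: "x mod int n \<noteq> y mod int n" if "x \<in> V" "y \<in> V" "x \<noteq> y" for x y
    using inj that by (auto simp: inj_on_def)
  have sym: "(x, y) \<in> fk_symbols n" if "x \<in> V" "y \<in> V" "x < y" for x y
    using nc[of x y] that by (auto simp: fk_symbols_def cong_def)
  have ctx: "fk_word p \<star> f \<star> fk_word q \<in> ?J" if "f \<in> ?J" "set p \<union> set q \<subseteq> fk_symbols n" for f p q
    using that by (intro fk_ideal_mult_left[OF n] fk_ideal_mult_right[OF n] fk_word_carrier) auto
  have zero: "symbol_word n (p @ w @ q) = (0 :: 'k fk_series)"
    if "\<not> set p \<union> set q \<subseteq> fk_symbols n" for p q w
    using that by (auto simp: symbol_word_def)
  show "a \<in> V" by (rule a)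
  show "0 \<in> ?J" by (rule fk_ideal_zero[OF n])
  show "x - y \<in> ?J" if "x \<in> ?J" "y \<in> ?J" for x y using fk_ideal_diff[OF n that] .
  show "symbol_word n (p @ [(i, j), (k, l)] @ q) - symbol_word n (p @ [(k, l), (i, j)] @ q) \<in> ?J"
    if V: "i \<in> V" "j \<in> V" "k \<in> V" "l \<in> V" "i < j" "k < l" "{i, j} \<inter> {k, l} = {}" for p q i j k l
  proof (cases "set p \<union> set q \<subseteq> fk_symbols n")
    case True
    have "distinct_residues n [i, j, k, l]" using V nc by auto
    from fk_relations_fk_ideal[OF n fk_relations.commute[OF this]]
    have "fk_bracket i j \<star> fk_bracket k l - fk_bracket k l \<star> fk_bracket i j \<in> ?J"
      by (simp only: fun_diff_def)
    from ctx[OF this True] have "fk_word p \<star> (fk_bracket i j \<star> fk_bracket k l) \<star> fk_word q -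
      fk_word p \<star> (fk_bracket k l \<star> fk_bracket i j) \<star> fk_word q \<in> ?J"
      by (simp only: fk_mult_diff_left fk_mult_diff_right)
    then show ?thesis
      using sym[OF V(1,2,5)] sym[OF V(3,4,6)] True by (simp only: symbol_word_context simp_thms if_True)
  next
    case False
    show ?thesis unfolding zero[OF False] using fk_ideal_zero[OF n] by (simp del: zero_fun_apply)
  qed
  fix p q l u assume V: "l \<in> V" "u \<in> V" "l < a" "a < u"
  have dr: "distinct_residues n [l, a, u]" using V a nc by auto
  have s: "(l, a) \<in> fk_symbols n" "(a, u) \<in> fk_symbols n" "(l, u) \<in> fk_symbols n"
    using sym V a by auto
  show "symbol_word n (p @ [(l, a), (a, u)] @ q) -
      (symbol_word n (p @ [(a, u), (l, u)] @ q) + symbol_word n (p @ [(l, u), (l, a)] @ q)) \<in> ?J"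
  proof (cases "set p \<union> set q \<subseteq> fk_symbols n")
    case True
    from fk_relations_fk_ideal[OF n fk_relations.triple1[OF dr]]
    have "fk_bracket l a \<star> fk_bracket a u - (fk_bracket a u \<star> fk_bracket l u + fk_bracket l u \<star> fk_bracket l a) \<in> ?J"
      by (simp only: fun_diff_def plus_fun_def)
    from ctx[OF this True] have "fk_word p \<star> (fk_bracket l a \<star> fk_bracket a u) \<star> fk_word q -
      (fk_word p \<star> (fk_bracket a u \<star> fk_bracket l u) \<star> fk_word q + fk_word p \<star> (fk_bracket l u \<star> fk_bracket l a) \<star> fk_word q) \<in> ?J"
      by (simp only: fk_mult_diff_left fk_mult_diff_right fk_mult_add_left fk_mult_add_right)
    then show ?thesis
      using s True by (simp only: symbol_word_context simp_thms if_True)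
  next
    case False
    show ?thesis unfolding zero[OF False] using fk_ideal_zero[OF n] by (simp del: zero_fun_apply)
  qed
  show "symbol_word n (p @ [(a, u), (l, a)] @ q) -
      (symbol_word n (p @ [(l, u), (a, u)] @ q) + symbol_word n (p @ [(l, a), (l, u)] @ q)) \<in> ?J"
  proof (cases "set p \<union> set q \<subseteq> fk_symbols n")
    case True
    from fk_relations_fk_ideal[OF n fk_relations.triple2[OF dr]]
    have "fk_bracket a u \<star> fk_bracket l a - (fk_bracket l u \<star> fk_bracket a u + fk_bracket l a \<star> fk_bracket l u) \<in> ?J"
      by (simp only: fun_diff_def plus_fun_def)
    from ctx[OF this True] have "fk_word p \<star> (fk_bracket a u \<star> fk_bracket l a) \<star> fk_word q -
      (fk_word p \<star> (fk_bracket l u \<star> fk_bracket a u) \<star> fk_word q + fk_word p \<star> (fk_bracket l a \<star> fk_bracket l u) \<star> fk_word q) \<in> ?J"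
      by (simp only: fk_mult_diff_left fk_mult_diff_right fk_mult_add_left fk_mult_add_right)
    then show ?thesis
      using s True by (simp only: symbol_word_context simp_thms if_True)
  next
    case False
    show ?thesis unfolding zero[OF False] using fk_ideal_zero[OF n] by (simp del: zero_fun_apply)
  qed
qed

text \<open>\<open>star_eqv_forests\<close>, carried over from plane forests to the representatives
  in \<open>M\<close> by \<open>hook_forests_representatives\<close>; the swaps in between cost only
  elements of the ideal.\<close>

lemma star_minus_trees_ideal:
  assumes n: "2 \<le> n" and M: "\<And>c D. connected_tree n c D \<Longrightarrow> mn_representatives D (M D)"
    and inj: "inj_on (\<lambda>x. x mod int n) (insert a S)" and S: "finite S" "S \<noteq> {}" "a \<notin> S"
  defines "R \<equiv> \<lambda>c. {u. connected_tree n c (set u) \<and> u \<in> M (set u) \<and> box_vertices (set u) = insert a S}"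
  shows "finite (R a)" "finite (R (a - 1))"
    and "(\<Sum>js\<in>permutations_of_set S. fk_word (map (edge a) js)) - (\<Sum>u\<in>R a. fk_word u) -
      (\<Sum>u\<in>R (a - 1). fk_word u) \<in> (fk_ideal n :: 'k::comm_ring_1 fk_series set)"
proof -
  let ?\<phi> = "symbol_word n :: _ \<Rightarrow> 'k fk_series"
  interpret tree_relations a "insert a S" ?\<phi> "fk_ideal n"
    by (rule tree_relations_fk_ideal[OF n inj]) simp
  have Usub: "upper_forests a S = {ts. spanning_forest a S ts \<and> hook_word (forest_word a ts) \<and>
      (\<forall>e\<in>set (forest_word a ts). crosses a e)}"
    using upper_forest_iff[of a] by (auto simp: upper_forests_def spanning_forest_def)
  have Lsub: "lower_forests a S = {ts. spanning_forest a S ts \<and> hook_word (forest_word a ts) \<and>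
      (\<forall>e\<in>set (forest_word a ts). crosses (a - 1) e)}"
    using lower_forest_iff[of a] by (auto simp: lower_forests_def spanning_forest_def)
  have rep: "finite (R c) \<and> (\<Sum>u\<in>R c. fk_word u) - (\<Sum>ts\<in>F. ?\<phi> (forest_word a ts)) \<in> fk_ideal n"
    if F: "F = {ts. spanning_forest a S ts \<and> hook_word (forest_word a ts) \<and>
      (\<forall>e\<in>set (forest_word a ts). crosses c e)}" for c F
  proof -
    obtain \<rho> where \<rho>: "bij_betw \<rho> F (R c)" "\<forall>ts\<in>F. swap_step\<^sup>*\<^sup>* (forest_word a ts) (\<rho> ts)"
      using hook_forests_representatives[OF M[of c] inj S(2,3)] unfolding F R_def by blast
    have "finite F" using finite_spanning_forests[of a S] unfolding F by (rule finite_subset[rotated]) auto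
    then have fin: "finite (R c)" using \<rho>(1) bij_betw_finite by blast
    have "(\<Sum>u\<in>R c. fk_word u) = (\<Sum>u\<in>R c. ?\<phi> u)"
    proof (rule sum.cong[OF refl])
      fix u assume "u \<in> R c"
      then have "set u \<subseteq> fk_symbols n"
        using connected_tree_word(2)[of n c u M] M[of c "set u"] by (auto simp: R_def)
      then show "fk_word u = ?\<phi> u" by (simp add: symbol_word_def)
    qed
    also have "\<dots> = (\<Sum>ts\<in>F. ?\<phi> (\<rho> ts))"
      by (rule sum.reindex_bij_betw[OF \<rho>(1), symmetric])
    finally have eq: "(\<Sum>u\<in>R c. fk_word u) = (\<Sum>ts\<in>F. ?\<phi> (\<rho> ts))" .
    have "eqv (\<Sum>ts\<in>F. ?\<phi> (forest_word a ts)) (\<Sum>ts\<in>F. ?\<phi> (\<rho> ts))"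
    proof (rule eqv_sum)
      fix ts assume ts: "ts \<in> F"
      then have "edge_word (insert a S) (forest_word a ts)"
        by (intro edge_word_forest) (auto simp: F spanning_forest_def)
      from swaps_eqv[OF _ this, of "\<rho> ts" "[]" "[]"] \<rho>(2) ts
      show "eqv (?\<phi> (forest_word a ts)) (?\<phi> (\<rho> ts))" by simp
    qed
    from eqv_sym[OF this] fin show ?thesis unfolding eq eqv_def by blast
  qed
  note ru = rep[OF Usub] and rl = rep[OF Lsub]
  show "finite (R a)" "finite (R (a - 1))" using ru rl by auto
  have star: "(\<Sum>js\<in>permutations_of_set S. fk_word (map (edge a) js)) =
    (\<Sum>js\<in>permutations_of_set S. ?\<phi> (map (edge a) js))"
  proof (rule sum.cong[OF refl])
    fix js assume "js \<in> permutations_of_set S"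
    then have "set js = S" by (simp add: permutations_of_set_def)
    then have "edge a j \<in> fk_symbols n" if "j \<in> set js" for j
      using inj S(3) that by (intro edge_symbol) (auto simp: inj_on_def cong_def)
    then show "fk_word (map (edge a) js) = ?\<phi> (map (edge a) js)" by (auto simp: symbol_word_def)
  qed
  have "(\<Sum>js\<in>permutations_of_set S. ?\<phi> (map (edge a) js)) -
    ((\<Sum>us\<in>upper_forests a S. ?\<phi> (forest_word a us)) + (\<Sum>ls\<in>lower_forests a S. ?\<phi> (forest_word a ls)))
    \<in> fk_ideal n"
    using star_eqv_forests[OF S(1,3) _ S(2)] unfolding eqv_def by blast
  from fk_ideal_diff[OF n this fk_ideal_add[OF n conjunct2[OF ru] conjunct2[OF rl]]]
  show "(\<Sum>js\<in>permutations_of_set S. fk_word (map (edge a) js)) - (\<Sum>u\<in>R a. fk_word u) -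
      (\<Sum>u\<in>R (a - 1). fk_word u) \<in> (fk_ideal n :: 'k fk_series set)"
    unfolding star by (simp add: algebra_simps del: minus_apply plus_fun_apply)
qed

lemma box_vertices_star:
  "js \<noteq> [] \<Longrightarrow> box_vertices (set (map (edge a) js)) = insert a (set js)"
  by (induction js) (auto simp: box_vertices_touches)

lemma star_sign_star:
  assumes "distinct js" "a \<notin> set js"
  shows "star_sign a (map (edge a) js) = (- 1) ^ card {x \<in> set js. x < a}"
proof -
  have "filter (\<lambda>e. snd e = a) (map (edge a) js) = map (edge a) (filter (\<lambda>x. x < a) js)"
    using assms(2) by (induction js) (auto simp: edge_def)
  moreover have "length (filter (\<lambda>x. x < a) js) = card {x \<in> set js. x < a}"
    using assms(1) distinct_card[of "filter (\<lambda>x. x < a) js"] by (simp add: Int_def conj_commute)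
  ultimately show ?thesis by (simp add: star_sign_def)
qed

lemma sum_fk_word: "finite A \<Longrightarrow> (\<Sum>u\<in>A. fk_word u) v = (if v \<in> A then 1 else 0)"
  unfolding sum_fun_apply fk_word_def by (simp add: sum.delta')

text \<open>Let \<open>s\<close> be the sign given by the number of vertices below \<open>a\<close>.
  Stars and trees for the cut \<open>a\<close> carry \<open>s\<close>, since \<open>a\<close> is a
  lower vertex of the latter and the exponent subtracts one. For the cut \<open>a - 1\<close> it is
  no lower vertex, and trees carry \<open>- s\<close>. So \<open>f\<close> restricts to
  \<open>s\<close> times the combination of \<open>star_minus_trees_ideal\<close>.\<close>

lemma fixed_vertices_ideal:
  fixes M :: "(int \<times> int) set \<Rightarrow> (int \<times> int) list set" and a :: int
  assumes n: "2 \<le> n" and m: "1 \<le> m"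
    and M: "\<And>c D. connected_tree n c D \<Longrightarrow> mn_representatives D (M D)"
  defines "f \<equiv> mn_element n M m (a - 1) + (\<Sum>rs\<in>distinct_words n a m. part_word n a rs) -
      (mn_element n M m a :: 'k::comm_ring_1 fk_series)"
  shows "(\<lambda>v. if box_vertices (set v) = S' then f v else 0) \<in> fk_ideal n"
proof -
  have f: "f v = mn_element n M m (a - 1) v + (if v \<in> star_words n a m then star_sign a v else 0) -
      mn_element n M m a v" for v
    by (simp add: f_def sum_part_words_coeff[OF n])
  have mn: "mn_element n M m c v = (if connected_tree n c (set v) \<and> card (set v) = m \<and> v \<in> M (set v)
    then (- 1) ^ (lower_vertices c (set v) - 1) else 0 :: 'k)" for c v
    by (rule mn_element_coeff) (rule M)
  have star: "box_vertices (set v) = insert a (set js) \<and> a \<notin> set js \<and> distinct js \<and> card (set js) = m \<and>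
      inj_on (\<lambda>x. x mod int n) (insert a (set js))"
    if "v = map (edge a) js" "length js = m" "distinct_residues n (a # js)" for v js
  proof -
    have "js \<noteq> []" using that(2) m by auto
    moreover have "distinct (a # js)" "inj_on (\<lambda>x. x mod int n) (set (a # js))"
      using that(3) by (simp_all only: distinct_map)
    ultimately show ?thesis using box_vertices_star[of js a] that(1,2) distinct_card[of js] by simp
  qed
  show ?thesis
  proof (cases "a \<in> S' \<and> finite S' \<and> card S' = m + 1 \<and> inj_on (\<lambda>x. x mod int n) S'")
    case True
    define S where "S = S' - {a}"
    have S': "S' = insert a S" and S: "finite S" "a \<notin> S" "card S = m"
      using True by (auto simp: S_def)
    have "S \<noteq> {}" using S(3) m by auto
    have inj: "inj_on (\<lambda>x. x mod int n) (insert a S)" using True S' by simp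
    define R where "R = (\<lambda>c. {u. connected_tree n c (set u) \<and> u \<in> M (set u) \<and> box_vertices (set u) = insert a S})"
    have finR: "finite (R a)" "finite (R (a - 1))"
      unfolding R_def using star_minus_trees_ideal(1,2)[OF n _ inj S(1) \<open>S \<noteq> {}\<close> S(2), of M] M by blast+
    define g where "g = (\<Sum>js\<in>permutations_of_set S. fk_word (map (edge a) js)) - (\<Sum>u\<in>R a. fk_word u) -
      (\<Sum>u\<in>R (a - 1). fk_word u :: 'k fk_series)"
    have g: "g \<in> fk_ideal n" unfolding g_def R_def
      by (rule star_minus_trees_ideal(3)[OF n _ inj S(1) \<open>S \<noteq> {}\<close> S(2)]) (erule M)
    define W where "W = map (edge a) ` permutations_of_set S"
    have "(\<Sum>js\<in>permutations_of_set S. fk_word (map (edge a) js)) = (\<Sum>u\<in>W. fk_word u :: 'k fk_series)"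
      unfolding W_def by (rule sum.reindex[symmetric, unfolded comp_def]) (auto intro: inj_onI map_edge_inj)
    then have gv: "g v = (if v \<in> W then 1 else 0) - (if v \<in> R a then 1 else 0) - (if v \<in> R (a - 1) then 1 else 0)" for v
      using finR S(1) by (simp add: g_def sum_fk_word W_def)
    define s :: 'k where "s = (- 1) ^ card {x \<in> S. x < a}"
    have fv: "f v = s * g v" if v: "box_vertices (set v) = insert a S" for v
    proof -
      have W: "v \<in> star_words n a m \<longleftrightarrow> v \<in> W"
      proof
        assume "v \<in> star_words n a m"
        then obtain js where js: "v = map (edge a) js" "length js = m" "distinct_residues n (a # js)"
          by (auto simp: star_words_def)
        have "set js = S" using star[OF js] v S(2) by auto
        then show "v \<in> W" using js(1) star[OF js] by (auto simp: W_def permutations_of_set_def)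
      next
        assume "v \<in> W"
        then obtain js where js: "v = map (edge a) js" "set js = S" "distinct js"
          by (auto simp: W_def permutations_of_set_def)
        have "length js = m" using js(2,3) S(3) distinct_card[of js] by simp
        moreover have "distinct_residues n (a # js)" unfolding distinct_map using js inj S(2) by simp
        ultimately show "v \<in> star_words n a m" using js(1) by (auto simp: star_words_def)
      qed
      have st: "star_sign a v = s" if "v \<in> W"
        using that star_sign_star[of _ a, where ?'a = 'k] S(2) by (auto simp: W_def permutations_of_set_def s_def)
      have cm: "card (set v) = m" if "connected_tree n c (set v)" for c
        using connected_tree_card[OF that] v S by simp
      have "{x \<in> insert a S. x \<le> a} = insert a {x \<in> S. x < a}" using S(2) by force
      then have lv: "lower_vertices a (set v) - Suc 0 = card {x \<in> S. x < a}"
        using S(1,2) by (simp add: lower_vertices_def v)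
      have mn1: "mn_element n M m a v = (if v \<in> R a then s else 0)"
        unfolding mn using cm v by (auto simp: R_def lv s_def)
      have "{x \<in> insert a S. x \<le> a - 1} = {x \<in> S. x < a}" by auto
      then have lv': "lower_vertices (a - 1) (set v) = card {x \<in> S. x < a}"
        by (simp add: lower_vertices_def v)
      \<comment> \<open>The exponent is a difference of natural numbers; it is proper because a tree
        for the cut \<open>a - 1\<close> has a vertex below \<open>a\<close>.\<close>
      have mn2: "mn_element n M m (a - 1) v = (if v \<in> R (a - 1) then - s else 0)"
      proof (cases "v \<in> R (a - 1)")
        case True
        then have conn: "connected_tree n (a - 1) (set v)" by (simp add: R_def)
        then have "set v \<noteq> {}" "\<forall>(i, j)\<in>set v. i \<le> a - 1 \<and> a - 1 < j"
          unfolding connected_tree_def by blast+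
        then obtain e where "e \<in> set v" by (meson ex_in_conv)
        then have e: "e \<in> set v" "fst e \<le> a - 1"
          using \<open>\<forall>(i, j)\<in>set v. i \<le> a - 1 \<and> a - 1 < j\<close> by (auto simp: case_prod_unfold)
        then have "fst e \<in> box_vertices (set v)" by (simp add: box_vertices_def)
        then have "fst e \<in> {x \<in> S. x < a}" using e(2) v by auto
        then have "{x \<in> S. x < a} \<noteq> {}" by blast
        then have "card {x \<in> S. x < a} \<noteq> 0" using S(1) by simp
        then obtain k where "card {x \<in> S. x < a} = Suc k" using not0_implies_Suc by blast
        then show ?thesis unfolding mn using True cm[OF conn] by (simp add: R_def lv' s_def)
      next
        case False
        then show ?thesis unfolding mn using v by (auto simp: R_def)
      qed
      show ?thesis unfolding f mn1 mn2 gv W using st by (simp add: algebra_simps)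
    qed
    have "g v = 0" if v: "box_vertices (set v) \<noteq> insert a S" for v
    proof -
      have "v \<notin> W"
      proof
        assume "v \<in> W"
        then obtain js where js: "v = map (edge a) js" "set js = S"
          by (auto simp: W_def permutations_of_set_def)
        moreover have "js \<noteq> []" using js(2) \<open>S \<noteq> {}\<close> by auto
        ultimately show False using v box_vertices_star[of js a] by simp
      qed
      then show ?thesis using v by (simp add: gv R_def)
    qed
    then have "(\<lambda>v. if box_vertices (set v) = S' then f v else 0) = (\<lambda>v. s * g v)"
      using fv S' by (auto simp: fun_eq_iff)
    moreover have "(\<lambda>v. s * g v) = g \<or> (\<lambda>v. s * g v) = - g"
      by (cases "even (card {x \<in> S. x < a})") (auto simp: s_def fun_eq_iff)
    ultimately show ?thesis using g fk_ideal_uminus[OF n g] by metis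
  next
    \<comment> \<open>If \<open>a\<close> is missing, the two tree terms cancel. Otherwise the set
      has the wrong size or repeated residues and supports neither stars nor trees.\<close>
    case False
    have "f v = 0" if v: "box_vertices (set v) = S'" for v
    proof (cases "a \<in> S'")
      case True
      have no: "\<not> (connected_tree n c (set v) \<and> card (set v) = m \<and> v \<in> M (set v))" for c
      proof
        assume c: "connected_tree n c (set v) \<and> card (set v) = m \<and> v \<in> M (set v)"
        then have "card S' = m + 1" "inj_on (\<lambda>x. x mod int n) S'"
          using connected_tree_card[of n c "set v"] v by (auto simp: connected_tree_def)
        moreover have "finite S'" unfolding v[symmetric] box_vertices_def by simp
        ultimately show False using False True by simp
      qed
      have "mn_element n M m c v = (0 :: 'k)" for c unfolding mn if_not_P[OF no] ..
      moreover have "v \<notin> star_words n a m"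
      proof
        assume "v \<in> star_words n a m"
        then obtain js where js: "v = map (edge a) js" "length js = m" "distinct_residues n (a # js)"
          by (auto simp: star_words_def)
        from star[OF js] have "S' = insert a (set js)" "a \<notin> set js" "card (set js) = m"
          "inj_on (\<lambda>x. x mod int n) (insert a (set js))" unfolding v by blast+
        then have "finite S' \<and> card S' = m + 1 \<and> inj_on (\<lambda>x. x mod int n) S'" by (simp del: inj_on_insert)
        then show False using False True by simp
      qed
      ultimately show ?thesis by (simp add: f)
    next
      case a: False
      have "v \<notin> star_words n a m"
      proof
        assume "v \<in> star_words n a m"
        then obtain js where js: "v = map (edge a) js" "length js = m" "distinct_residues n (a # js)"
          by (auto simp: star_words_def)
        from star[OF js] show False using a v by auto
      qed
      moreover have "mn_element n M m (a - 1) v = (mn_element n M m a v :: 'k)"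
        unfolding mn using connected_tree_shift_cut[of a "set v"] a v by simp
      ultimately show ?thesis by (simp add: f)
    qed
    then have "(\<lambda>v. if box_vertices (set v) = S' then f v else 0) = 0" by (auto simp: fun_eq_iff)
    then show ?thesis using fk_ideal_zero[OF n] by metis
  qed
qed

text \<open>A letter that crosses either cut begins at or below \<open>a\<close> and ends at or
  above it, so one anchor serves both elements.\<close>

lemma mn_word_anchored:
  assumes "mn_element n M m c v \<noteq> 0" "\<And>D. connected_tree n c D \<Longrightarrow> mn_representatives D (M D)"
    "c = a \<or> c = a - 1"
  shows "set v \<subseteq> fk_symbols n \<and> length v \<le> m \<and> anchored a a v"
proof -
  have c: "connected_tree n c (set v)" "card (set v) = m" "v \<in> M (set v)"
    using assms(1) mn_element_coeff[where M = M and n = n and c = c and m = m and v = v, OF assms(2)]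
    by (auto split: if_splits)
  note w = connected_tree_word[where M = M, OF c(1) assms(2)[OF c(1)] c(3)]
  have "length v = m" using distinct_card[OF w(1)] c(2) by simp
  moreover have "anchored a a v" using w(3) assms(3) by (fastforce simp: anchored_def)
  ultimately show ?thesis using w(2) by simp
qed

lemma mn_element_carrier:
  assumes "2 \<le> n" "\<And>D. connected_tree n c D \<Longrightarrow> mn_representatives D (M D)"
  shows "mn_element n M m c \<in> carrier (fk_E n)"
  by (rule anchored_carrier[OF assms(1)], rule mn_word_anchored) (use assms(2) in auto)

text \<open>The series is the infinite sum of its restrictions to the possible vertex sets. Every
  word belongs to one of them, and all words are anchored at \<open>a\<close>, so the ideal also
  contains the sum.\<close>

lemma mn_star_difference_ideal:
  fixes M :: "(int \<times> int) set \<Rightarrow> (int \<times> int) list set"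
  assumes n: "2 \<le> n" and m: "1 \<le> m"
    and M: "\<And>c D. connected_tree n c D \<Longrightarrow> mn_representatives D (M D)"
  shows "mn_element n M m (a - 1) + (\<Sum>rs\<in>distinct_words n a m. part_word n a rs) - mn_element n M m a
    \<in> (fk_ideal n :: 'k::comm_ring_1 fk_series set)"
proof -
  define f :: "'k fk_series" where
    "f = mn_element n M m (a - 1) + (\<Sum>rs\<in>distinct_words n a m. part_word n a rs) - mn_element n M m a"
  define F where "F = (\<lambda>S' v. if box_vertices (set v) = S' then f v else 0)"
  have "fk_sum UNIV F \<in> fk_ideal n"
  proof (rule fk_ideal_anchored_sum[OF n, where m = m and lo = a and hi = a])
    show "F S' \<in> fk_ideal n" for S'
      unfolding F_def f_def by (rule fixed_vertices_ideal[OF n m M])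
    show "finite {S' \<in> UNIV. F S' v \<noteq> 0}" for v
      by (rule finite_subset[of _ "{box_vertices (set v)}"]) (auto simp: F_def split: if_splits)
    fix S' v assume "F S' v \<noteq> 0"
    then have "f v \<noteq> 0" by (auto simp: F_def split: if_splits)
    then consider "mn_element n M m (a - 1) v \<noteq> (0 :: 'k)" | "mn_element n M m a v \<noteq> (0 :: 'k)"
      | "v \<in> star_words n a m"
      by (cases "mn_element n M m (a - 1) v = (0 :: 'k)"; cases "mn_element n M m a v = (0 :: 'k)")
        (auto simp: f_def sum_part_words_coeff[OF n] split: if_splits)
    then show "length v \<le> m \<and> anchored a a v"
    proof cases
      case 1
      then show ?thesis using mn_word_anchored[of n M m "a - 1" v a, OF _ M[of "a - 1"]] by blast
    next
      case 2
      then show ?thesis using mn_word_anchored[of n M m a v a, OF _ M[of a]] by blast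
    next
      case 3
      then show ?thesis by (auto simp: star_words_def anchored_def edge_def)
    qed
  qed
  moreover have "fk_sum UNIV F = f"
  proof
    fix v
    have "fk_sum UNIV F v = (\<Sum>S'\<in>{box_vertices (set v)}. F S' v)"
      by (rule fk_sum_eq_sum) (auto simp: F_def)
    then show "fk_sum UNIV F v = f v" by (simp add: F_def)
  qed
  ultimately show ?thesis by (simp only: f_def)
qed

theorem theorem4p9:
  fixes n m :: nat and i :: int
    and M :: "(int \<times> int) set \<Rightarrow> (int \<times> int) list set"
  assumes "2 \<le> n" and "1 \<le> m" and "m < n"
    and "\<And>a D. connected_tree n a D \<Longrightarrow> mn_representatives D (M D)"
  shows "fk_class n (mn_element n M m i :: 'k::comm_ring_1 fk_series)
      \<oplus>\<^bsub>affine_FK n\<^esub> fk_class n (fk_theta n (i + 1)) [^]\<^bsub>affine_FK n\<^esub> m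
    = fk_class n (mn_element n M m (i + 1))"
proof -
  let ?E = "fk_E n :: 'k fk_series ring" and ?I = "fk_ideal n :: 'k fk_series set"
  let ?p = "mn_element n M m i :: 'k fk_series" and ?q = "mn_element n M m (i + 1) :: 'k fk_series"
    and ?\<theta> = "fk_theta n (i + 1) :: 'k fk_series"
  interpret E: ring ?E by (rule fk_E_ring[OF assms(1)])
  interpret h: ring_hom_ring ?E "?E Quot ?I" "(+>\<^bsub>?E\<^esub>) ?I"
    by (rule ideal.rcos_ring_hom_ring[OF fk_ideal_ideal[OF assms(1)]])
  have p: "?p \<in> carrier ?E" and q: "?q \<in> carrier ?E"
    using mn_element_carrier[OF assms(1) assms(4)[of i]] mn_element_carrier[OF assms(1) assms(4)[of "i + 1"]]
    by blast+
  have \<theta>: "?\<theta> \<in> carrier ?E" by (rule fk_theta_carrier[OF assms(1)])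
  let ?s = "\<Sum>rs\<in>distinct_words n (i + 1) m. part_word n (i + 1) rs :: 'k fk_series"
  \<comment> \<open>Here \<open>a\<close> is \<open>i + 1\<close>, so the cut \<open>a - 1\<close>
    is \<open>i\<close>. The sum \<open>?s\<close> over distinct residue words links the trees with
    the power of theta.\<close>
  have "?p + ?s - ?q \<in> ?I"
    using mn_star_difference_ideal[of n m M "i + 1", where ?'k = 'k] assms by simp
  moreover have "?\<theta> [^]\<^bsub>?E\<^esub> m - ?s \<in> ?I" by (rule fk_theta_power[OF assms(1)])
  ultimately have "?p + ?\<theta> [^]\<^bsub>?E\<^esub> m - ?q \<in> ?I"
    using fk_ideal_add[OF assms(1)] by (force simp: algebra_simps)
  then have "(?p \<oplus>\<^bsub>?E\<^esub> ?\<theta> [^]\<^bsub>?E\<^esub> m) \<ominus>\<^bsub>?E\<^esub> ?q \<in> ?I"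
    using fk_E_a_inv[OF assms(1) q] by (simp add: a_minus_def)
  then have "?I +>\<^bsub>?E\<^esub> (?p \<oplus>\<^bsub>?E\<^esub> ?\<theta> [^]\<^bsub>?E\<^esub> m) = ?I +>\<^bsub>?E\<^esub> ?q"
    by (rule iffD1[OF E.quotient_eq_iff_same_a_r_cos[OF fk_ideal_ideal[OF assms(1)]
          E.a_closed[OF p E.nat_pow_closed[OF \<theta>]] q]])
  then show ?thesis
    unfolding fk_class_def affine_FK_def
    using h.hom_add[OF p E.nat_pow_closed[OF \<theta>]] h.hom_nat_pow[OF \<theta>] by (simp del: fk_E_simps)
qed

end
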